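(* Let $d\ge1$, and let $\sigma$ be a nonzero, $T^{\times d}$-invariant, boundedly finite measure on $X^d$ such that the system $(X^d,\sigma,T^{\times d})$ is ergodic. Then there exists a partition of $\{1,\ldots,d\}$ into $r$ subsets $I_1,\ldots,I_r$ (for some $r\ge 1$) such that $\sigma=\sigma^{I_1}\otimes\cdots\otimes\sigma^{I_r}$ (identifying $X^d$ with $X^{I_1}\times\cdots\times X^{I_r}$), where, for each $1\le j\le r$, $\sigma^{I_j}$ is a diagonal measure on $X^{I_j}$. Moreover, if the system $(X^d,\sigma,T^{\times d})$ is totally dissipative, then $\sigma$ is a diagonal measure supported on a single $T^{\times d}$-orbit.
   Context: Construction of $T$ (Chacon infinite transformation). Let $X=\mathbb{R}_+=[0,\infty)$ with its Borel $\sigma$-algebra and Lebesgue measure $\mu$. Tower $0$ is the single interval $[0,1)$, of height $h_0=1$. For $n\ge0$, given tower $n$, a stack of $h_n$ disjoint intervals (called levels) of length $3^{-n}$, each closed on the left and open on the right, step $n+1$ is: cut tower $n$ vertically into three subcolumns of equal width (first, second, third from left to right); put one extra interval of length $3^{-(n+1)}$ above the second (middle) subcolumn and $3h_n+1$ extra intervals of length $3^{-(n+1)}$ above the third subcolumn (extra intervals are picked successively, each time taking the leftmost interval of the desired length in the unused part of $\mathbb{R}_+$); then stack the three subcolumns, left under right, to get tower $n+1$, of height $h_{n+1}=2(3h_n+1)$. In each tower, $T$ maps each point not in the top level to the point exactly above it. This defines $T:X\to X$, which preserves $\mu$; it is injective with image $X\setminus\{0\}$. For negative powers, $T^{-k}A$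 ($k>0$) denotes the preimage of a set $A$, and $T^{-k}x$ denotes the point mapped to $x$ by $T^k$ when it exists; same convention for $T^{\times d}$. Define $T^{\times d}(x_1,\ldots,x_d)=(Tx_1,\ldots,Tx_d)$ on $X^d$. For $n\ge1$, $C_n$ is the bottom half of tower $n$: the union of its $h_n/2$ lowest levels. One has $C_n\subset C_{n+1}$ and $X=\bigcup_n C_n$. A (Borel) measure $\sigma$ on $X^d$ is boundedly finite if $\sigma(A)<\infty$ for every bounded measurable $A\subset X^d$. An $n$-box is a subset of $X^d$ of the form $L_1\times\cdots\times L_d$ where each $L_j$ is a level of $C_n$. An $n$-diagonal is a finite family of $n$-boxes $B,T^{\times d}B,\ldots,(T^{\times d})^{\ell}B$ which is maximal in the sense that $(T^{\times d})^{-1}B\not\subset C_n^d$ and $(T^{\times d})^{\ell+1}B\not\subset C_n^d$. A boundedly finite, $T^{\times d}$-invariant measure $\sigma$ on $X^d$ is a diagonal measure if there exists an integer $n_0$ such that for all $n\ge n_0$, $\sigma|_{C_n^d}$ is concentrated on (the union of the boxes of) a single $n$-diagonal. For a finite nonempty index set $I$, diagonal measures on $X^I$ are defined in the same way with $d=|I|$. *)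

theory Defs
  imports "HOL-Analysis.Analysis" "HOL-Library.Disjoint_Sets"
begin

subsection \<open>The infinite Chacon transformation on $X = [0,\infty)$\<close>

text \<open>
  A tower is represented by the list of the left endpoints of its levels, from bottom to top;
  the levels of tower \<open>n\<close> have length \<open>1 / 3 ^ n\<close>. Tower \<open>n\<close> covers exactly \<open>[0, u)\<close> with
  \<open>u = h / 3 ^ n\<close>, where \<open>h\<close> is its height, so that the leftmost unused intervals of length
  \<open>w = 1 / 3 ^ (n + 1)\<close> are \<open>[u + s * w, u + (s + 1) * w)\<close> for \<open>s = 0, 1, 2, \<dots>\<close>.
  The one with \<open>s = 0\<close> goes above the middle subcolumn, the next \<open>3 * h + 1\<close> ones above the third.
\<close>

primrec tower :: "nat \<Rightarrow> real list" where
  "tower 0 = [0]"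
| "tower (Suc n) =
     (let L = tower n; h = length L; w = 1 / 3 ^ Suc n; u = real h / 3 ^ n
      in L
         @ map (\<lambda>a. a + w) L @ [u]
         @ map (\<lambda>a. a + 2 * w) L @ map (\<lambda>s. u + real s * w) [1..<3 * h + 2])"

definition height :: "nat \<Rightarrow> nat" where
  "height n = length (tower n)"

definition level :: "nat \<Rightarrow> nat \<Rightarrow> real set" where
  "level n k = {tower n ! k ..< tower n ! k + 1 / 3 ^ n}"

text \<open>
  Every point of \<open>[0,\<infinity>)\<close> lies in a level other than the top one of some tower, and successive towers
  give consistent prescriptions. Values at negative arguments are irrelevant.
\<close>

definition chacon :: "real \<Rightarrow> real" where
  "chacon x = (THE y. \<exists>n k. Suc k < height n \<and> x \<in> level n k \<and>
                        y = tower n ! Suc k + (x - tower n ! k))"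

text \<open>Meaningful for \<open>n \<ge> 1\<close> only, when the height is even.\<close>

definition bottom_half :: "nat \<Rightarrow> real set" where
  "bottom_half n = (\<Union>k<height n div 2. level n k)"


subsection \<open>Cartesian powers\<close>

text \<open>$X^I$ is the set of extensional functions from \<open>I\<close> to \<open>[0,\<infinity>)\<close>; only the
  measurable-space structure of \<open>powX I\<close> is used, not its measure.\<close>

definition powX :: "'i set \<Rightarrow> ('i \<Rightarrow> real) measure" where
  "powX I = (\<Pi>\<^sub>M i\<in>I. restrict_space borel {0..})"

definition chacon_pow :: "'i set \<Rightarrow> ('i \<Rightarrow> real) \<Rightarrow> ('i \<Rightarrow> real)" where
  "chacon_pow I x = (\<lambda>i\<in>I. chacon (x i))"

text \<open>Boundedness is that of $\mathbb{R}^I$; the library metric on functions, under which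
  everything is bounded, must not be used here.\<close>

definition boundedly_finite :: "'i set \<Rightarrow> ('i \<Rightarrow> real) measure \<Rightarrow> bool" where
  "boundedly_finite I \<sigma> \<longleftrightarrow>
     (\<forall>A\<in>sets \<sigma>. (\<exists>R. \<forall>x\<in>A. \<forall>i\<in>I. \<bar>x i\<bar> \<le> R) \<longrightarrow> emeasure \<sigma> A < \<infinity>)"


subsection \<open>Notions from ergodic theory\<close>

definition invariant_measure :: "'a measure \<Rightarrow> ('a \<Rightarrow> 'a) \<Rightarrow> bool" where
  "invariant_measure \<sigma> S \<longleftrightarrow>
     S \<in> measurable \<sigma> \<sigma> \<and> (\<forall>A\<in>sets \<sigma>. emeasure \<sigma> (S -` A \<inter> space \<sigma>) = emeasure \<sigma> A)"

definition ergodic :: "'a measure \<Rightarrow> ('a \<Rightarrow> 'a) \<Rightarrow> bool" where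
  "ergodic \<sigma> S \<longleftrightarrow>
     (\<forall>A\<in>sets \<sigma>. S -` A \<inter> space \<sigma> = A \<longrightarrow>
        emeasure \<sigma> A = 0 \<or> emeasure \<sigma> (space \<sigma> - A) = 0)"

definition wandering :: "'a measure \<Rightarrow> ('a \<Rightarrow> 'a) \<Rightarrow> 'a set \<Rightarrow> bool" where
  "wandering \<sigma> S W \<longleftrightarrow>
     W \<in> sets \<sigma> \<and> (\<forall>m n. m \<noteq> n \<longrightarrow>
        ((S ^^ m) -` W \<inter> space \<sigma>) \<inter> ((S ^^ n) -` W \<inter> space \<sigma>) = {})"

text \<open>The union of the $S^n W$ over all integers \<open>n\<close>; the two parts are the negative and the
  nonnegative powers.\<close>

definition saturation :: "'a measure \<Rightarrow> ('a \<Rightarrow> 'a) \<Rightarrow> 'a set \<Rightarrow> 'a set" where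
  "saturation \<sigma> S W = (\<Union>n. (S ^^ n) -` W \<inter> space \<sigma>) \<union> (\<Union>n. (S ^^ n) ` W)"

definition totally_dissipative :: "'a measure \<Rightarrow> ('a \<Rightarrow> 'a) \<Rightarrow> bool" where
  "totally_dissipative \<sigma> S \<longleftrightarrow>
     (\<exists>W. wandering \<sigma> S W \<and> (AE x in \<sigma>. x \<in> saturation \<sigma> S W))"

definition supported_on_single_orbit :: "'a measure \<Rightarrow> ('a \<Rightarrow> 'a) \<Rightarrow> bool" where
  "supported_on_single_orbit \<sigma> S \<longleftrightarrow>
     (\<exists>x\<in>space \<sigma>. AE y in \<sigma>. y \<in> saturation \<sigma> S {x})"


subsection \<open>Diagonal measures\<close>

definition n_box :: "'i set \<Rightarrow> nat \<Rightarrow> ('i \<Rightarrow> real) set \<Rightarrow> bool" where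
  "n_box I n B \<longleftrightarrow>
     (\<exists>k. (\<forall>i\<in>I. k i < height n div 2) \<and> B = (\<Pi>\<^sub>E i\<in>I. level n (k i)))"

definition n_diagonal :: "'i set \<Rightarrow> nat \<Rightarrow> ('i \<Rightarrow> real) set set \<Rightarrow> bool" where
  "n_diagonal I n D \<longleftrightarrow>
     (\<exists>B l. D = {(chacon_pow I ^^ j) ` B | j. j \<le> l} \<and> (\<forall>A\<in>D. n_box I n A) \<and>
        \<not> chacon_pow I -` B \<inter> space (powX I) \<subseteq> (\<Pi>\<^sub>E i\<in>I. bottom_half n) \<and>
        \<not> (chacon_pow I ^^ Suc l) ` B \<subseteq> (\<Pi>\<^sub>E i\<in>I. bottom_half n))"

definition diagonal_measure :: "'i set \<Rightarrow> ('i \<Rightarrow> real) measure \<Rightarrow> bool" where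
  "diagonal_measure I \<sigma> \<longleftrightarrow>
     sets \<sigma> = sets (powX I) \<and> boundedly_finite I \<sigma> \<and> invariant_measure \<sigma> (chacon_pow I) \<and>
     (\<exists>n0\<ge>1. \<forall>n\<ge>n0. \<exists>D. n_diagonal I n D \<and>
        (AE x in \<sigma>. x \<in> (\<Pi>\<^sub>E i\<in>I. bottom_half n) \<longrightarrow> x \<in> \<Union>D))"

text \<open>The product over the blocks \<open>J \<in> P\<close> of the measures \<open>\<tau> J\<close> on $X^J$, carried over to
  $X^{\bigcup P}$ by the canonical identification: \<open>z J\<close> is the component of \<open>z\<close> in $X^J$.\<close>

definition block_product ::
    "'i set set \<Rightarrow> ('i set \<Rightarrow> ('i \<Rightarrow> real) measure) \<Rightarrow> ('i \<Rightarrow> real) measure" where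
  "block_product P \<tau> =
     distr (\<Pi>\<^sub>M J\<in>P. \<tau> J) (powX (\<Union>P)) (\<lambda>z. \<lambda>i\<in>\<Union>P. z (THE J. J \<in> P \<and> i \<in> J) i)"

end

theory Submission
  imports Defs
begin

text \<open>
  Write $C_n$ for the bottom half of tower \<open>n\<close> and \<open>S\<close> for $T^{\times I}$.
  The crossing of order \<open>n\<close> of a point \<open>x\<close> of $C_n^I$ is the piece of its
  orbit, around the present time, during which all coordinates stay in $C_n$. Crossings of order
  \<open>n\<close> are the classes of a finite equivalence relation, these relations grow with
  \<open>n\<close>, and every finite piece of orbit is eventually contained in a single crossing. An
  invariant measure gives equal masses to the boxes of a diagonal, so integrating a function over
  $C_n^I$ amounts to summing it over crossings (\<open>averaging\<close>). Two crossings are nested or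
  disjoint; this yields a maximal inequality, and with ergodicity a ratio theorem
  (\<open>generic_ratio\<close>): for almost every \<open>x\<close>, called generic below, the numbers
  of visits of the crossing of order \<open>n\<close> of \<open>x\<close> to two boxes are, as
  \<open>n\<close> grows, in the ratio of the measures of these boxes. Conservative and dissipative
  systems are treated alike.

  Fix a generic \<open>x\<close> and let the \<open>n\<close>-th digits of \<open>x\<close> be the
  numbers (0, 1 or 2) of the subcolumns of tower \<open>n\<close> that contain its coordinates. If
  these digits all agree, or if 0 and 2 both occur, then all crossings of order \<open>n\<close>
  within the crossing of order \<open>n + 1\<close> of \<open>x\<close> lie on one diagonal. If this
  happens for all large \<open>n\<close>, the orbit of \<open>x\<close> meets $C_n^I$ on a single
  \<open>n\<close>-diagonal, hence so does \<open>\<sigma>\<close>, which is therefore a diagonal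
  measure (\<open>diagonal_measureI\<close>).

  Otherwise, for infinitely many \<open>n\<close> the set \<open>K\<close> of the coordinates with
  digit 1 is nonempty and proper, with \<open>K\<close> independent of \<open>n\<close>, and the other
  digits are all 0 or all 2. Then the crossing of order \<open>n + 1\<close> of \<open>x\<close>
  meets $C_n^I$ in the crossing of order \<open>n\<close> of \<open>x\<close> and, at most, in one
  other crossing of order \<open>n\<close>, which looks like that of \<open>x\<close> with the
  coordinates in \<open>K\<close> moved one level down (\<open>visits_split\<close>). By the ratio
  theorem, shifting the coordinates in \<open>K\<close> alone multiplies \<open>\<sigma>\<close> by a
  constant \<open>\<kappa>\<close>. If \<open>\<kappa>\<close> differs from 1, a Borel-Cantelli
  argument for the shift on \<open>K\<close> and the shift on the complement of \<open>K\<close> shows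
  that almost every orbit visits every bounded set finitely often
  (\<open>contraction_finite_visits\<close>), while \<open>visits_split\<close> produces infinitely
  many visits. So \<open>\<sigma>\<close> is invariant under the shift of the coordinates in
  \<open>K\<close> (\<open>diagonal_or_partially_invariant\<close>).

  In that case the slices \<open>A \<mapsto> \<sigma> (A \<times> W)\<close> are ergodic
  invariant measures on $X^K$, and a point which is generic for two of them shows that they are
  proportional. Hence \<open>\<sigma>\<close> is a product of two ergodic measures
  (\<open>product_of_slices\<close>), and induction on the number of coordinates gives the
  decomposition.

  Finally, in a totally dissipative system almost every point of a wandering set has finitely many
  visits to each bounded set, which excludes the second alternative. So \<open>\<sigma>\<close> is a
  diagonal measure, and since boxes missed by the orbit of a generic point are null,
  \<open>\<sigma>\<close> lives on that orbit.
\<close>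

section \<open>Towers\<close>

text \<open>
  The region $[0, h_n / 3^n)$ swept by tower \<open>n\<close>. A point in it is described by its
  position (the index of its level) and its offset (its distance to the left end of the level). Along
  an orbit within the tower the position increases by one at each step and the offset stays constant.
\<close>

definition covered :: "nat \<Rightarrow> real set" where
  "covered n = {0 ..< real (height n) / 3 ^ n}"

definition pos :: "nat \<Rightarrow> real \<Rightarrow> nat" where
  "pos n x = (THE k. k < height n \<and> x \<in> level n k)"

definition offset :: "nat \<Rightarrow> real \<Rightarrow> real" where
  "offset n x = x - tower n ! pos n x"

text \<open>
  The subcolumn (0, 1 or 2) containing the point when tower \<open>n\<close> is cut into three.
\<close>

definition digit :: "nat \<Rightarrow> real \<Rightarrow> nat" where
  "digit n x = nat \<lfloor>offset n x * 3 ^ Suc n\<rfloor>"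

text \<open>
  The position, in tower \<open>n + 1\<close>, of the lowest level of the subcolumn \<open>t\<close>
  of tower \<open>n\<close>: one spacer separates the second copy of tower \<open>n\<close> from the
  third.
\<close>

definition copy_start :: "nat \<Rightarrow> nat \<Rightarrow> nat" where
  "copy_start n t = (if t = 0 then 0 else if t = 1 then height n else 2 * height n + 1)"

declare tower.simps(2) [simp del]

lemma height_0 [simp]: "height 0 = 1"
  by (simp add: height_def)

lemma height_Suc: "height (Suc n) = 6 * height n + 2"
  by (simp add: height_def tower.simps(2) Let_def del: upt_Suc)

lemma height_pos: "height n > 0"
  by (cases n) (auto simp: height_Suc)

lemma height_gt: "n < height n"
  by (induction n) (auto simp: height_Suc)

lemma half_height_Suc: "height (Suc n) div 2 = 3 * height n + 1"
  by (simp add: height_Suc)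

lemma half_height_double: "n \<ge> 1 \<Longrightarrow> 2 * (height n div 2) = height n"
  by (cases n) (auto simp: height_Suc)

lemma half_height_pos: "n \<ge> 1 \<Longrightarrow> 0 < height n div 2"
  by (cases n) (auto simp: height_Suc)

lemma tower_copy:
  assumes "k < height n" "t < 3"
  shows "tower (Suc n) ! (k + copy_start n t) = tower n ! k + real t / 3 ^ Suc n"
proof -
  have "t = 0 \<or> t = 1 \<or> t = 2" using assms by auto
  then show ?thesis using assms
    by (auto simp: tower.simps(2) Let_def nth_append height_def copy_start_def simp del: upt_Suc)
qed

lemma tower_spacer:
  assumes "s < 3 * height n + 2"
  shows "tower (Suc n) ! (if s = 0 then 2 * height n else 3 * height n + s)
         = real (height n) / 3 ^ n + real s / 3 ^ Suc n"
proof (cases "s = 0")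
  case True
  then show ?thesis by (auto simp: tower.simps(2) Let_def nth_append height_def simp del: upt_Suc)
next
  case False
  obtain s' where s': "s = Suc s'" using False by (cases s) auto
  show ?thesis using assms s' by (auto simp: tower.simps(2) Let_def nth_append height_def simp del: upt_Suc)
qed

text \<open>
  The spacers of tower \<open>n + 1\<close> are numbered from left to right: number 0 sits above the
  second copy, at index \<open>2 * h\<close>, and number \<open>s\<close> with
  \<open>s > 0\<close> sits above the third copy, at index \<open>3 * h + s\<close>.
\<close>

lemma index_cases:
  assumes "j < height (Suc n)"
  obtains (copy) k t where "k < height n" "t < 3" "j = k + copy_start n t"
  | (spacer) s where "s < 3 * height n + 2" "j = (if s = 0 then 2 * height n else 3 * height n + s)"
proof -
  let ?h = "height n"
  consider "j < ?h" | "?h \<le> j" "j < 2 * ?h" | "j = 2 * ?h" | "2 * ?h < j" "j < 3 * ?h + 1"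
    | "3 * ?h + 1 \<le> j" by linarith
  then show thesis
  proof cases
    case 1 then show thesis using copy[of j 0] by (simp add: copy_start_def)
  next
    case 2 then show thesis using copy[of "j - ?h" 1] by (simp add: copy_start_def)
  next
    case 3 then show thesis using spacer[of 0] by simp
  next
    case 4 then show thesis using copy[of "j - (2 * ?h + 1)" 2] by (simp add: copy_start_def)
  next
    case 5 then show thesis using spacer[of "j - 3 * ?h"] assms by (simp add: height_Suc)
  qed
qed

lemma copy_start_less: "k < height n \<Longrightarrow> k + copy_start n t < height (Suc n)"
  by (auto simp: copy_start_def height_Suc)

lemma copy_start_less_half: "k < height n \<Longrightarrow> k + copy_start n t < height (Suc n) div 2"
  by (auto simp: copy_start_def half_height_Suc)

text \<open>
  Induction on \<open>n\<close>: left of $u = h_n / 3^n$ the levels of tower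
  \<open>n + 1\<close> are the thirds of the levels of tower \<open>n\<close>, and right of
  \<open>u\<close> they are the spacers, which form a grid of mesh $w = 3^{-(n+1)}$.
\<close>

lemma tower_partition:
  "(\<forall>k<height n. level n k \<subseteq> covered n) \<and>
   (\<forall>x\<in>covered n. \<exists>k<height n. x \<in> level n k) \<and>
   (\<forall>j<height n. \<forall>k<height n. \<forall>x. x \<in> level n j \<longrightarrow> x \<in> level n k \<longrightarrow> j = k)"
proof (induction n)
  case 0
  show ?case by (auto simp: level_def covered_def)
next
  case (Suc n)
  let ?h = "height n" and ?w = "1 / 3 ^ Suc n :: real" and ?u = "real (height n) / 3 ^ n"
  have w: "?w > 0" "1 / 3 ^ n = 3 * ?w" by auto
  have top: "real (height (Suc n)) / 3 ^ Suc n = ?u + real (3 * ?h + 2) * ?w"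
    by (simp add: height_Suc field_simps)
  have cop: "level (Suc n) (k + copy_start n t)
      = {tower n ! k + real t * ?w ..< tower n ! k + (real t + 1) * ?w}" if "k < ?h" "t < 3" for k t
    unfolding level_def tower_copy[OF that] by (simp add: field_simps)
  have spa: "level (Suc n) (if s = 0 then 2 * ?h else 3 * ?h + s)
      = {?u + real s * ?w ..< ?u + (real s + 1) * ?w}" if "s < 3 * ?h + 2" for s
    unfolding level_def tower_spacer[OF that] by (simp add: field_simps)
  have cop_sub: "level (Suc n) (k + copy_start n t) \<subseteq> level n k" if "k < ?h" "t < 3" for k t
  proof -
    have "0 \<le> real t * ?w" by simp
    moreover have "(real t + 1) * ?w \<le> 3 * ?w" using that by (intro mult_right_mono) auto
    ultimately have "{tower n ! k + real t * ?w ..< tower n ! k + (real t + 1) * ?w}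
        \<subseteq> {tower n ! k ..< tower n ! k + 3 * ?w}" by auto
    then show ?thesis unfolding cop[OF that] level_def[of n k] w(2) .
  qed
  have un: "0 \<le> ?u" by simp
  have below: "x < ?u" if "k < ?h" "t < 3" "x \<in> level (Suc n) (k + copy_start n t)" for k t x
    using Suc that cop_sub[OF that(1,2)] by (fastforce simp: covered_def)
  have above: "?u \<le> x" if "s < 3 * ?h + 2"
     "x \<in> level (Suc n) (if s = 0 then 2 * ?h else 3 * ?h + s)" for s x
  proof -
    have "0 \<le> real s * ?w" by simp
    then have "{?u + real s * ?w ..< ?u + (real s + 1) * ?w} \<subseteq> {?u..}"
      by (intro subsetI, unfold atLeastLessThan_iff atLeast_iff, linarith)
    then show ?thesis using that(2) unfolding spa[OF that(1)] by blast
  qed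
  have sub: "level (Suc n) j \<subseteq> covered (Suc n)" if j: "j < height (Suc n)" for j
    using j
  proof (cases rule: index_cases)
    case (copy k t)
    have "?u \<le> ?u + real (3 * ?h + 2) * ?w" by simp
    then have "covered n \<subseteq> covered (Suc n)" unfolding covered_def top by auto
    then show ?thesis using copy cop_sub[OF copy(1,2)] Suc by blast
  next
    case (spacer s)
    have "(real s + 1) * ?w \<le> real (3 * ?h + 2) * ?w" using spacer by (intro mult_right_mono) auto
    moreover have "0 \<le> real s * ?w" by simp
    ultimately show ?thesis unfolding spacer(2) spa[OF spacer(1)] covered_def top using un by auto
  qed
  have ex: "\<exists>k<height (Suc n). x \<in> level (Suc n) k" if x: "x \<in> covered (Suc n)" for x
  proof (cases "x < ?u")
    case True
    then have "x \<in> covered n" using x by (simp add: covered_def)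
    then obtain k where k: "k < ?h" "x \<in> level n k" using Suc by blast
    define t where "t = nat \<lfloor>(x - tower n ! k) / ?w\<rfloor>"
    have r: "0 \<le> (x - tower n ! k) / ?w" "(x - tower n ! k) / ?w < 3"
      using k by (auto simp: level_def field_simps)
    have t: "t < 3" "real t \<le> (x - tower n ! k) / ?w" "(x - tower n ! k) / ?w < real t + 1"
      unfolding t_def using r by linarith+
    have "x \<in> level (Suc n) (k + copy_start n t)"
      unfolding cop[OF k(1) t(1)]
      using t(2,3)[unfolded pos_le_divide_eq[OF w(1)] pos_divide_less_eq[OF w(1)]]
      by (auto simp: algebra_simps)
    then show ?thesis using copy_start_less[OF k(1)] by blast
  next
    case False
    define s where "s = nat \<lfloor>(x - ?u) / ?w\<rfloor>"
    have "x - ?u < real (3 * ?h + 2) * ?w" using x unfolding covered_def top by auto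
    then have r: "0 \<le> (x - ?u) / ?w" "(x - ?u) / ?w < real (3 * ?h + 2)"
      using False w(1) by (auto simp: field_simps)
    have s: "s < 3 * ?h + 2" "real s \<le> (x - ?u) / ?w" "(x - ?u) / ?w < real s + 1"
      unfolding s_def using r by linarith+
    have "x \<in> level (Suc n) (if s = 0 then 2 * ?h else 3 * ?h + s)"
      unfolding spa[OF s(1)] using s(2,3)[unfolded pos_le_divide_eq[OF w(1)] pos_divide_less_eq[OF w(1)]]
      by (auto simp: algebra_simps)
    moreover have "(if s = 0 then 2 * ?h else 3 * ?h + s) < height (Suc n)"
      using s(1) by (auto simp: height_Suc)
    ultimately show ?thesis by blast
  qed
  have grid: "a = b" if "v + real a * ?w \<le> x" "x < v + (real a + 1) * ?w"
    "v + real b * ?w \<le> x" "x < v + (real b + 1) * ?w" for a b :: nat and v x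
  proof -
    have "real a * ?w < (real b + 1) * ?w" "real b * ?w < (real a + 1) * ?w" using that by linarith+
    then have "real a < real b + 1" "real b < real a + 1"
      using w(1) mult_less_cancel_right_pos by blast+
    then show ?thesis by linarith
  qed
  have uni: "i = j" if i: "i < height (Suc n)" and j: "j < height (Suc n)"
    and xi: "x \<in> level (Suc n) i" and xj: "x \<in> level (Suc n) j" for i j x
    using i
  proof (cases rule: index_cases)
    case i: (copy k t)
    show ?thesis using j
    proof (cases rule: index_cases)
      case j: (copy k' t')
      have "k = k'" using Suc i j xi xj cop_sub[of k t] cop_sub[of k' t'] by blast
      moreover have "t = t'" 
        using xi xj i j cop[of k t] cop[of k' t'] grid[of "tower n ! k" t x t'] \<open>k = k'\<close> by auto
      ultimately show ?thesis using i j by simp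
    next
      case j: (spacer s)
      show ?thesis using below[of k t x] above[of s x] i j xi xj by auto
    qed
  next
    case i: (spacer s)
    show ?thesis using j
    proof (cases rule: index_cases)
      case j: (copy k' t')
      show ?thesis using below[of k' t' x] above[of s x] i j xi xj by auto
    next
      case j: (spacer s')
      have "s = s'"
        using xi xj unfolding i(2) j(2) spa[OF i(1)] spa[OF j(1)]
        using grid[of ?u s x s'] by auto
      then show ?thesis using i j by simp
    qed
  qed
  show ?case using sub ex uni by blast
qed

lemma pos_unique: "k < height n \<Longrightarrow> x \<in> level n k \<Longrightarrow> pos n x = k"
  unfolding pos_def using tower_partition[of n] by (intro the_equality) blast+

lemma level_subset_covered: "k < height n \<Longrightarrow> level n k \<subseteq> covered n"
  using tower_partition by blast

lemma pos_less: "x \<in> covered n \<Longrightarrow> pos n x < height n"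
  and in_level_pos: "x \<in> covered n \<Longrightarrow> x \<in> level n (pos n x)"
  using tower_partition[of n] pos_unique by blast+

lemma level_iff: "k < height n \<Longrightarrow> x \<in> level n k \<longleftrightarrow> x \<in> covered n \<and> pos n x = k"
  using pos_unique level_subset_covered in_level_pos by blast

lemma offset_bounds: "x \<in> covered n \<Longrightarrow> 0 \<le> offset n x" "x \<in> covered n \<Longrightarrow> offset n x < 1 / 3 ^ n"
  using in_level_pos[of x n] by (auto simp: offset_def level_def)

lemma pos_offset: "tower n ! pos n x + offset n x = x"
  by (simp add: offset_def)

lemma point_eqI: "pos n x = pos n y \<Longrightarrow> offset n x = offset n y \<Longrightarrow> x = y"
  by (simp add: offset_def)

lemma point_level: "0 \<le> r \<Longrightarrow> r < 1 / 3 ^ n \<Longrightarrow> tower n ! k + r \<in> level n k"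
  by (auto simp: level_def)

lemma
  assumes "k < height n" "0 \<le> r" "r < 1 / 3 ^ n"
  shows point_covered: "tower n ! k + r \<in> covered n"
    and pos_point: "pos n (tower n ! k + r) = k"
    and offset_point: "offset n (tower n ! k + r) = r"
  using level_iff[OF assms(1), of "tower n ! k + r"] point_level[OF assms(2,3)] by (auto simp: offset_def)

lemma covered_mono_Suc: "covered n \<subseteq> covered (Suc n)"
  by (auto simp: covered_def height_Suc divide_simps)

lemma covered_mono: "m \<le> n \<Longrightarrow> covered m \<subseteq> covered n"
  using covered_mono_Suc by (simp add: lift_Suc_mono_le)

lemma digit_less: "x \<in> covered n \<Longrightarrow> digit n x < 3"
proof -
  assume x: "x \<in> covered n"
  have "offset n x * 3 ^ Suc n < 3" using offset_bounds[OF x] by (simp add: field_simps)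
  then show ?thesis unfolding digit_def by linarith
qed

lemma digit_bounds:
  assumes x: "x \<in> covered n"
  shows "real (digit n x) / 3 ^ Suc n \<le> offset n x" "offset n x < (real (digit n x) + 1) / 3 ^ Suc n"
proof -
  have "0 \<le> offset n x * 3 ^ Suc n" using offset_bounds[OF x] by simp
  then have "real (digit n x) \<le> offset n x * 3 ^ Suc n" "offset n x * 3 ^ Suc n < real (digit n x) + 1"
    unfolding digit_def by linarith+
  then show "real (digit n x) / 3 ^ Suc n \<le> offset n x" "offset n x < (real (digit n x) + 1) / 3 ^ Suc n"
    by (simp_all add: field_simps)
qed

lemma
  assumes x: "x \<in> covered n"
  shows pos_Suc: "pos (Suc n) x = pos n x + copy_start n (digit n x)"
    and offset_Suc: "offset (Suc n) x = offset n x - real (digit n x) / 3 ^ Suc n"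
proof -
  let ?k = "pos n x + copy_start n (digit n x)"
  let ?r = "offset n x - real (digit n x) / 3 ^ Suc n"
  have eq: "tower (Suc n) ! ?k + ?r = x"
    unfolding tower_copy[OF pos_less[OF x] digit_less[OF x]] by (simp add: offset_def)
  have k: "?k < height (Suc n)" by (rule copy_start_less[OF pos_less[OF x]])
  have r: "0 \<le> ?r" "?r < 1 / 3 ^ Suc n" using digit_bounds[OF x] by (auto simp: add_divide_distrib)
  show "pos (Suc n) x = ?k" "offset (Suc n) x = ?r"
    using pos_point[OF k r] offset_point[OF k r] unfolding eq by auto
qed

text \<open>
  Conversely, a level of tower \<open>n\<close>, a subcolumn and an offset in the new tower can be
  prescribed arbitrarily. This is how points with given digits are constructed later.
\<close>

lemma
  assumes "k < height n" "t < 3" "0 \<le> r" "r < 1 / 3 ^ Suc n"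
  shows copy_point_covered: "tower n ! k + (real t / 3 ^ Suc n + r) \<in> covered n"
    and copy_point_pos: "pos n (tower n ! k + (real t / 3 ^ Suc n + r)) = k"
    and copy_point_digit: "digit n (tower n ! k + (real t / 3 ^ Suc n + r)) = t"
    and copy_point_offset: "offset (Suc n) (tower n ! k + (real t / 3 ^ Suc n + r)) = r"
proof -
  let ?x = "tower n ! k + (real t / 3 ^ Suc n + r)"
  have b: "0 \<le> real t / 3 ^ Suc n + r" "real t / 3 ^ Suc n + r < 1 / 3 ^ n"
  proof -
    show "0 \<le> real t / 3 ^ Suc n + r" using assms by simp
    have "real t / 3 ^ Suc n + r < real t / 3 ^ Suc n + 1 / 3 ^ Suc n" using assms by simp
    also have "\<dots> = (real t + 1) / 3 ^ Suc n" by (simp add: add_divide_distrib)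
    also have "\<dots> \<le> 3 / 3 ^ Suc n" using assms by (intro divide_right_mono) auto
    finally show "real t / 3 ^ Suc n + r < 1 / 3 ^ n" by simp
  qed
  show c: "?x \<in> covered n" and p: "pos n ?x = k"
    using point_covered[OF assms(1) b] pos_point[OF assms(1) b] by auto
  have o: "offset n ?x = real t / 3 ^ Suc n + r" using offset_point[OF assms(1) b] .
  have e: "offset n ?x * 3 ^ Suc n = real t + r * 3 ^ Suc n" unfolding o by (simp add: field_simps)
  have "0 \<le> r * 3 ^ Suc n" "r * 3 ^ Suc n < 1" using assms by (auto simp: field_simps)
  then show d: "digit n ?x = t" unfolding digit_def e by linarith
  show "offset (Suc n) ?x = r" unfolding offset_Suc[OF c] o d by simp
qed

section \<open>The bottom halves\<close>

lemma bottom_half_iff: "x \<in> bottom_half n \<longleftrightarrow> x \<in> covered n \<and> pos n x < height n div 2"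
proof -
  have "k < height n div 2 \<Longrightarrow> k < height n" for k by simp
  then show ?thesis unfolding bottom_half_def using level_iff by (auto simp: Bex_def) 
qed

lemma covered_subset_bottom_half_Suc: "covered n \<subseteq> bottom_half (Suc n)"
proof
  fix x assume x: "x \<in> covered n"
  then show "x \<in> bottom_half (Suc n)"
    using covered_mono_Suc copy_start_less_half[OF pos_less[OF x]] pos_Suc[OF x]
    by (auto simp: bottom_half_iff)
qed

lemma bottom_half_mono: "m \<le> n \<Longrightarrow> bottom_half m \<subseteq> bottom_half n"
proof (rule lift_Suc_mono_le[of bottom_half])
  fix n show "bottom_half n \<subseteq> bottom_half (Suc n)"
    using covered_subset_bottom_half_Suc[of n] by (force simp: bottom_half_iff[of _ n])
qed

lemma bottom_half_covered: "bottom_half n \<subseteq> covered n"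
  by (auto simp: bottom_half_iff)

text \<open>
  In the copies of tower \<open>n\<close> inside tower \<open>n + 1\<close> the bottom half of tower
  \<open>n\<close> stays at distance at least $h_n / 2$ below the top of the bottom half of tower
  \<open>n + 1\<close>, and the heights tend to infinity. So every point eventually lies in the
  bottom halves, as far below their tops as desired.
\<close>

lemma eventually_bottom_half_aux:
  assumes "0 \<le> x"
  shows "\<exists>N\<ge>1. \<forall>n\<ge>N. x \<in> bottom_half n \<and> pos n x + j < height n div 2"
proof -
  have hn: "(2::real) ^ n \<le> real (height n) / 3 ^ n" for n
    by (induction n) (auto simp: height_Suc field_simps)
  obtain a where a: "x < 2 ^ a" using real_arch_pow[of 2 x] by auto
  then have xa: "x \<in> covered a" using assms hn[of a] by (auto simp: covered_def)
  have "x \<in> bottom_half n \<and> pos n x + j < height n div 2" if n: "n \<ge> a + j + 2" for n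
  proof -
    define m where "m = n - 2"
    have m: "n = Suc (Suc m)" "m \<ge> a + j" using n by (auto simp: m_def)
    have xm: "x \<in> bottom_half (Suc m)"
      using xa covered_mono[of a m] covered_subset_bottom_half_Suc m by auto
    then have c: "x \<in> covered (Suc m)" using bottom_half_covered by auto
    have p: "pos (Suc m) x < height (Suc m) div 2" using xm by (simp add: bottom_half_iff)
    have "pos n x \<le> pos (Suc m) x + 2 * height (Suc m) + 1"
      unfolding m(1) pos_Suc[OF c] by (auto simp: copy_start_def)
    moreover have "height n div 2 = 3 * height (Suc m) + 1" unfolding m(1) by (rule half_height_Suc)
    moreover have "j < height (Suc m) div 2"
      unfolding half_height_Suc using height_gt[of m] m(2) by linarith
    ultimately have "pos n x + j < height n div 2" using p by linarith
    moreover have "x \<in> bottom_half n" using xm bottom_half_mono[of "Suc m" n] m by auto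
    ultimately show ?thesis by simp
  qed
  then show ?thesis by (intro exI[of _ "a + j + 2"]) auto
qed

lemma eventually_bottom_half:
  assumes "0 \<le> x"
  shows "eventually (\<lambda>n. x \<in> bottom_half n \<and> pos n x + j < height n div 2) sequentially"
  using eventually_bottom_half_aux[OF assms, of j] unfolding eventually_sequentially by blast

lemma covered_nonneg: "x \<in> covered n \<Longrightarrow> 0 \<le> x"
  by (auto simp: covered_def)

text \<open>
  A level of tower \<open>n + 1\<close> is contained in a level of tower \<open>n\<close> or
  disjoint from the whole tower. This is why a box of high order decides the visits to all boxes of
  lower order.
\<close>

lemma pos_coarser_step:
  assumes "x \<in> covered n" "y \<in> covered (Suc n)" "pos (Suc n) y = pos (Suc n) x"
  shows "y \<in> covered n \<and> pos n y = pos n x"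
proof -
  have "y = tower (Suc n) ! (pos (Suc n) x) + offset (Suc n) y"
    using assms(3) by (simp add: offset_def)
  also have "\<dots> = tower n ! pos n x + (real (digit n x) / 3 ^ Suc n + offset (Suc n) y)"
    unfolding pos_Suc[OF assms(1)] tower_copy[OF pos_less[OF assms(1)] digit_less[OF assms(1)]] by simp
  finally show ?thesis
    using copy_point_covered[OF pos_less[OF assms(1)] digit_less[OF assms(1)] offset_bounds[OF assms(2)]]
      copy_point_pos[OF pos_less[OF assms(1)] digit_less[OF assms(1)] offset_bounds[OF assms(2)]] by simp
qed

lemma pos_coarser:
  assumes "m \<le> n" "x \<in> covered m" "y \<in> covered n" "pos n y = pos n x"
  shows "y \<in> covered m \<and> pos m y = pos m x"
  using assms
proof (induction n rule: dec_induct)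
  case base then show ?case by simp
next
  case (step n)
  have "x \<in> covered n" using step.prems covered_mono[of m n] step.hyps by auto
  then have "y \<in> covered n \<and> pos n y = pos n x" using pos_coarser_step step.prems by blast
  then show ?case using step by blast
qed

text \<open>
  The subcolumn entered at each cutting depends on the offset only. So two points with equal offsets
  are moved up by the same amounts from one tower to the next: once they are at a certain distance
  along the tower, they remain so.
\<close>

lemma offset_finer:
  assumes "m \<le> n" "x \<in> covered m" "y \<in> covered m" "offset m y = offset m x"
  shows "offset n y = offset n x \<and> int (pos n y) - int (pos n x) = int (pos m y) - int (pos m x)"
  using assms
proof (induction n rule: dec_induct)
  case base then show ?case by simp
next
  case (step n)
  have "x \<in> covered n" "y \<in> covered n" using step.prems covered_mono[of m n] step.hyps by auto
  moreover have "offset n y = offset n x \<and> int (pos n y) - int (pos n x) = int (pos m y) - int (pos m x)"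
    using step by blast
  moreover then have "digit n y = digit n x" by (simp add: digit_def)
  ultimately show ?case by (simp add: pos_Suc offset_Suc)
qed

lemma points_separated:
  assumes "0 \<le> x" "0 \<le> y" "x \<noteq> y"
  shows "eventually (\<lambda>n. pos n x \<noteq> pos n y) sequentially"
proof -
  have "(\<lambda>n. (1/3::real) ^ n) \<longlonglongrightarrow> 0" by (rule LIMSEQ_realpow_zero) auto
  then have "eventually (\<lambda>n. (1/3::real) ^ n < \<bar>x - y\<bar>) sequentially"
    using assms(3) by (intro order_tendstoD) auto
  moreover have "eventually (\<lambda>n. x \<in> bottom_half n) sequentially" "eventually (\<lambda>n. y \<in> bottom_half n) sequentially"
    using eventually_bottom_half[OF assms(1), of 0] eventually_bottom_half[OF assms(2), of 0]
    by (auto elim: eventually_mono)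
  ultimately show ?thesis
  proof eventually_elim
    case (elim n)
    then have "x \<in> covered n" "y \<in> covered n" using bottom_half_covered by auto
    then have "pos n x = pos n y \<Longrightarrow> \<bar>x - y\<bar> < (1/3) ^ n"
      using offset_bounds[of x n] offset_bounds[of y n] pos_offset[of n x] pos_offset[of n y]
      by (auto simp: power_one_over abs_less_iff)
    then show ?case using elim(1) by auto
  qed
qed

section \<open>The transformation\<close>

text \<open>
  Moving one level up in tower \<open>n\<close> or in a later tower \<open>m\<close> gives the same
  point, because the upper neighbour has the same offset and \<open>offset_finer\<close> applies.
\<close>

lemma chacon_unique_aux:
  assumes "n \<le> m" "Suc k < height n" "x \<in> level n k" "Suc j < height m" "x \<in> level m j"
  shows "tower m ! Suc j + (x - tower m ! j) = tower n ! Suc k + (x - tower n ! k)"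
proof -
  have kj: "x \<in> covered n" "pos n x = k" "x \<in> covered m" "pos m x = j"
    using level_iff[of k n x] level_iff[of j m x] assms by auto
  define y where "y = tower n ! Suc k + offset n x"
  have y: "y \<in> covered n" "pos n y = Suc k" "offset n y = offset n x"
    unfolding y_def using point_covered[OF assms(2) offset_bounds[OF kj(1)]]
      pos_point[OF assms(2) offset_bounds[OF kj(1)]] offset_point[OF assms(2) offset_bounds[OF kj(1)]]
    by auto
  have "offset m y = offset m x" "int (pos m y) - int (pos m x) = 1"
    using offset_finer[OF assms(1) kj(1) y(1,3)] y(2) kj(2) by auto
  moreover then have pm: "pos m y = Suc j" using kj(4) by linarith
  ultimately have "y = tower m ! Suc j + offset m x"
    using pos_offset[of m y, symmetric] kj(4) pm by simp
  then show ?thesis unfolding y_def offset_def kj by simp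
qed

lemma chacon_eq:
  assumes "x \<in> covered n" "Suc (pos n x) < height n"
  shows "chacon x = tower n ! Suc (pos n x) + offset n x"
  unfolding chacon_def
proof (rule the_equality)
  show "\<exists>m k. Suc k < height m \<and> x \<in> level m k \<and>
      tower n ! Suc (pos n x) + offset n x = tower m ! Suc k + (x - tower m ! k)"
    using assms in_level_pos[of x n] by (auto simp: offset_def)
next
  fix y assume "\<exists>m k. Suc k < height m \<and> x \<in> level m k \<and> y = tower m ! Suc k + (x - tower m ! k)"
  then obtain m k where m: "Suc k < height m" "x \<in> level m k" "y = tower m ! Suc k + (x - tower m ! k)"
    by blast
  have l: "x \<in> level n (pos n x)" by (rule in_level_pos[OF assms(1)])
  consider "n \<le> m" | "m \<le> n" by linarith
  then show "y = tower n ! Suc (pos n x) + offset n x"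
  proof cases
    case 1 show ?thesis using chacon_unique_aux[OF 1 assms(2) l m(1,2)] m(3) by (simp add: offset_def)
  next
    case 2 show ?thesis using chacon_unique_aux[OF 2 m(1,2) assms(2) l] m(3) by (simp add: offset_def)
  qed
qed

lemma
  assumes "x \<in> covered n" "Suc (pos n x) < height n"
  shows chacon_covered: "chacon x \<in> covered n"
    and pos_chacon: "pos n (chacon x) = Suc (pos n x)"
    and offset_chacon: "offset n (chacon x) = offset n x"
  unfolding chacon_eq[OF assms]
  using point_covered[OF assms(2) offset_bounds[OF assms(1)]] pos_point[OF assms(2) offset_bounds[OF assms(1)]]
     offset_point[OF assms(2) offset_bounds[OF assms(1)]] by auto

lemma
  assumes "x \<in> covered n" "pos n x + j < height n"
  shows chacon_iter_covered: "(chacon ^^ j) x \<in> covered n"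
    and pos_chacon_iter: "pos n ((chacon ^^ j) x) = pos n x + j"
    and offset_chacon_iter: "offset n ((chacon ^^ j) x) = offset n x"
proof -
  have "(chacon ^^ j) x \<in> covered n \<and> pos n ((chacon ^^ j) x) = pos n x + j \<and>
    offset n ((chacon ^^ j) x) = offset n x" using assms(2)
    by (induction j) (auto simp: chacon_covered pos_chacon offset_chacon assms(1))
  then show "(chacon ^^ j) x \<in> covered n" "pos n ((chacon ^^ j) x) = pos n x + j"
    "offset n ((chacon ^^ j) x) = offset n x" by auto
qed

lemma chacon_iter_eqI:
  assumes "x \<in> covered n" "y \<in> covered n" "pos n y = pos n x + j" "offset n y = offset n x"
  shows "y = (chacon ^^ j) x"
proof -
  have j: "pos n x + j < height n" using pos_less[OF assms(2)] assms(3) by simp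
  show ?thesis
    by (rule point_eqI[of n]) (simp_all only: pos_chacon_iter[OF assms(1) j] offset_chacon_iter[OF assms(1) j] assms)
qed

lemma eventually_nontop:
  assumes "0 \<le> x"
  shows "eventually (\<lambda>n. x \<in> covered n \<and> pos n x + j < height n) sequentially"
  using eventually_bottom_half[OF assms, of j]
  by eventually_elim (use bottom_half_covered in auto)

lemma chacon_nonneg: "0 \<le> x \<Longrightarrow> 0 \<le> chacon x"
proof -
  assume "0 \<le> x"
  from eventually_nontop[OF this, of 1] obtain n where "x \<in> covered n" "pos n x + 1 < height n"
    unfolding eventually_sequentially by auto
  then show ?thesis using chacon_covered[of x n] by (auto intro: covered_nonneg)
qed

lemma pos_zero [simp]: "pos n 0 = 0"
proof -
  have "tower n ! 0 = 0" for n
    using height_pos by (induction n) (auto simp: tower.simps(2) Let_def nth_append height_def)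
  then show ?thesis by (intro pos_unique) (auto simp: level_def height_pos)
qed

lemma zero_covered: "0 \<in> covered n"
  by (auto simp: covered_def height_pos)

lemma eventually_pos_positive:
  assumes "0 < x"
  shows "eventually (\<lambda>n. 1 \<le> pos n x) sequentially"
  using points_separated[of x 0] assms by (auto elim: eventually_mono)

lemma chacon_positive: "0 \<le> x \<Longrightarrow> 0 < chacon x"
proof -
  assume x: "0 \<le> x"
  from eventually_nontop[OF this, of 1] obtain n where n: "x \<in> covered n" "pos n x + 1 < height n"
    unfolding eventually_sequentially by auto
  then have "pos n (chacon x) \<noteq> 0" using pos_chacon[of x n] by simp
  then have "chacon x \<noteq> 0" using pos_zero by metis
  then show ?thesis using chacon_nonneg[OF x] by simp
qed

lemma chacon_inj: "inj_on chacon {0..}"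
proof (rule inj_onI)
  fix x y :: real assume xy: "x \<in> {0..}" "y \<in> {0..}" and eq: "chacon x = chacon y"
  have x: "eventually (\<lambda>n. x \<in> covered n \<and> pos n x + 1 < height n) sequentially"
    and y: "eventually (\<lambda>n. y \<in> covered n \<and> pos n y + 1 < height n) sequentially"
    using xy by (auto simp only: atLeast_iff intro: eventually_nontop)
  have "eventually (\<lambda>n. x = y) sequentially"
    using x y
  proof eventually_elim
    case (elim n)
    then have n: "x \<in> covered n" "Suc (pos n x) < height n" "y \<in> covered n" "Suc (pos n y) < height n"
      by auto
    have "pos n x = pos n y" using eq pos_chacon[OF n(1,2)] pos_chacon[OF n(3,4)] by simp
    moreover have "offset n x = offset n y"
      using eq offset_chacon[OF n(1,2)] offset_chacon[OF n(3,4)] by simp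
    ultimately show ?case by (rule point_eqI)
  qed
  then show "x = y" by simp
qed

lemma chacon_surj:
  assumes "0 < y"
  shows "\<exists>x\<ge>0. chacon x = y"
proof -
  have "eventually (\<lambda>n. y \<in> covered n \<and> 1 \<le> pos n y) sequentially"
    using eventually_nontop[of y 0] eventually_pos_positive[OF assms] assms
    by (auto simp: eventually_conj_iff)
  then obtain n where n: "y \<in> covered n" "1 \<le> pos n y" unfolding eventually_sequentially by auto
  let ?x = "tower n ! (pos n y - 1) + offset n y"
  have k: "pos n y - 1 < height n" using pos_less[OF n(1)] by simp
  note x = point_covered[OF k offset_bounds[OF n(1)]] pos_point[OF k offset_bounds[OF n(1)]]
    offset_point[OF k offset_bounds[OF n(1)]]
  have "y = chacon ?x"
    using chacon_iter_eqI[OF x(1) n(1), of 1] x n by simp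
  then show ?thesis using covered_nonneg[OF x(1)] by metis
qed

lemma chacon_iter_inj: "inj_on (chacon ^^ j) {0..}"
proof (induction j)
  case (Suc j)
  have nn: "0 \<le> a \<Longrightarrow> 0 \<le> (chacon ^^ j) a" for a by (induction j) (auto intro: chacon_nonneg)
  show ?case
  proof (rule inj_onI)
    fix a b :: real assume "a \<in> {0..}" "b \<in> {0..}" "(chacon ^^ Suc j) a = (chacon ^^ Suc j) b"
    then show "a = b" using inj_onD[OF chacon_inj, of "(chacon ^^ j) a" "(chacon ^^ j) b"] nn
      inj_onD[OF Suc, of a b] by auto
  qed
qed simp

lemma chacon_iter_level_iff:
  assumes c: "c + j < height n" and u: "0 \<le> u"
  shows "(chacon ^^ j) u \<in> covered n \<and> pos n ((chacon ^^ j) u) = c + j \<longleftrightarrow> u \<in> covered n \<and> pos n u = c"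
proof
  assume "u \<in> covered n \<and> pos n u = c"
  then show "(chacon ^^ j) u \<in> covered n \<and> pos n ((chacon ^^ j) u) = c + j"
    using chacon_iter_covered[of u n j] pos_chacon_iter[of u n j] c by auto
next
  assume v: "(chacon ^^ j) u \<in> covered n \<and> pos n ((chacon ^^ j) u) = c + j"
  let ?v = "(chacon ^^ j) u"
  let ?u = "tower n ! c + offset n ?v"
  have c': "c < height n" using c by simp
  have ob: "0 \<le> offset n ?v" "offset n ?v < 1 / 3 ^ n" using offset_bounds[of ?v n] v by auto
  note uu = point_covered[OF c' ob] pos_point[OF c' ob] offset_point[OF c' ob]
  have "?v = (chacon ^^ j) ?u" using v uu by (intro chacon_iter_eqI[of _ n]) auto
  then have "u = ?u" using chacon_iter_inj u covered_nonneg[OF uu(1)] by (auto dest!: inj_onD)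
  then show "u \<in> covered n \<and> pos n u = c" using uu by simp
qed

section \<open>Boxes\<close>

definition tbox :: "'i set \<Rightarrow> nat \<Rightarrow> ('i \<Rightarrow> nat) \<Rightarrow> ('i \<Rightarrow> real) set" where
  "tbox I n k = (\<Pi>\<^sub>E i\<in>I. level n (k i))"

definition halves :: "'i set \<Rightarrow> nat \<Rightarrow> ('i \<Rightarrow> real) set" where
  "halves I n = (\<Pi>\<^sub>E i\<in>I. bottom_half n)"

definition posv :: "'i set \<Rightarrow> nat \<Rightarrow> ('i \<Rightarrow> real) \<Rightarrow> ('i \<Rightarrow> nat)" where
  "posv I n x = (\<lambda>i\<in>I. pos n (x i))"

definition half_index :: "'i set \<Rightarrow> nat \<Rightarrow> ('i \<Rightarrow> nat) set" where
  "half_index I n = (\<Pi>\<^sub>E i\<in>I. {..<height n div 2})"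

lemma half_index_less: "k \<in> half_index I n \<Longrightarrow> i \<in> I \<Longrightarrow> k i < height n div 2"
  by (auto simp: half_index_def PiE_iff)

lemma half_index_less_height: "k \<in> half_index I n \<Longrightarrow> i \<in> I \<Longrightarrow> k i < height n"
  using half_index_less[of k I n i] by linarith

lemma finite_half_index: "finite I \<Longrightarrow> finite (half_index I n)"
  by (auto simp: half_index_def intro!: finite_PiE)

abbreviation halfline :: "real measure" where
  "halfline \<equiv> restrict_space borel {0..}"

lemma space_halfline [simp]: "space halfline = {0..}"
  by (simp add: space_restrict_space)

lemma sets_halfline_iff: "A \<in> sets halfline \<longleftrightarrow> A \<in> sets borel \<and> A \<subseteq> {0..}"
  by (auto simp: sets_restrict_space_iff)

lemma space_powX: "space (powX I) = (\<Pi>\<^sub>E i\<in>I. {0..})"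
  by (simp add: powX_def space_PiM)

lemma space_powX_iff: "x \<in> space (powX I) \<longleftrightarrow> (\<forall>i\<in>I. 0 \<le> x i) \<and> x \<in> extensional I"
  by (auto simp: space_powX PiE_iff)

lemma level_sets: "k < height n \<Longrightarrow> level n k \<in> sets halfline"
  using level_subset_covered[of k n] by (auto simp: sets_halfline_iff level_def covered_def)

lemma bottom_half_sets: "bottom_half n \<in> sets halfline"
  unfolding bottom_half_def by (intro sets.finite_UN level_sets) auto

lemma component_measurable: "i \<in> I \<Longrightarrow> (\<lambda>x. x i) \<in> measurable (powX I) halfline"
  unfolding powX_def by (rule measurable_component_singleton)

lemma powX_measurableI:
  assumes "\<And>i. i \<in> I \<Longrightarrow> (\<lambda>x. f x i) \<in> measurable M halfline"
    "\<And>x. x \<in> space M \<Longrightarrow> f x \<in> extensional I"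
  shows "f \<in> measurable M (powX I)"
  unfolding powX_def
proof (rule measurable_PiM_single')
  have "0 \<le> f x i" if "i \<in> I" "x \<in> space M" for x i
    using measurable_space[OF assms(1)[OF that(1)] that(2)] by simp
  then show "f \<in> space M \<rightarrow> (\<Pi>\<^sub>E i\<in>I. space halfline)" using assms(2) by (auto simp: PiE_iff)
qed (rule assms(1))

lemma powX_sets_PiE: "finite I \<Longrightarrow> (\<And>i. i \<in> I \<Longrightarrow> A i \<in> sets halfline) \<Longrightarrow> (\<Pi>\<^sub>E i\<in>I. A i) \<in> sets (powX I)"
  unfolding powX_def by (rule sets_PiM_I_finite)

lemma tbox_sets: "finite I \<Longrightarrow> (\<And>i. i \<in> I \<Longrightarrow> k i < height n) \<Longrightarrow> tbox I n k \<in> sets (powX I)"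
  unfolding tbox_def by (intro powX_sets_PiE level_sets)

lemma halves_sets: "finite I \<Longrightarrow> halves I n \<in> sets (powX I)"
  unfolding halves_def by (intro powX_sets_PiE bottom_half_sets)

lemma halves_covered: "x \<in> halves I n \<Longrightarrow> i \<in> I \<Longrightarrow> x i \<in> covered n"
  by (auto simp: halves_def bottom_half_iff)

lemma halves_iff:
  "x \<in> halves I n \<longleftrightarrow> x \<in> extensional I \<and> (\<forall>i\<in>I. x i \<in> covered n \<and> pos n (x i) < height n div 2)"
  by (auto simp: halves_def bottom_half_iff PiE_iff)

lemma halves_mono: "m \<le> n \<Longrightarrow> halves I m \<subseteq> halves I n"
  unfolding halves_def using bottom_half_mono by (intro PiE_mono) auto

lemma halves_space: "halves I n \<subseteq> space (powX I)"
  using covered_nonneg[of _ n] by (auto simp: halves_iff space_powX_iff)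

lemma tbox_iff:
  assumes "\<And>i. i \<in> I \<Longrightarrow> k i < height n"
  shows "x \<in> tbox I n k \<longleftrightarrow> x \<in> extensional I \<and> (\<forall>i\<in>I. x i \<in> covered n \<and> pos n (x i) = k i)"
  using assms level_iff unfolding tbox_def PiE_iff by blast

lemma half_tbox_iff:
  assumes "k \<in> half_index I n"
  shows "x \<in> tbox I n k \<longleftrightarrow> x \<in> halves I n \<and> posv I n x = k"
proof
  assume "x \<in> tbox I n k"
  then have x: "x \<in> extensional I" "\<And>i. i \<in> I \<Longrightarrow> x i \<in> covered n" "\<And>i. i \<in> I \<Longrightarrow> pos n (x i) = k i"
    using tbox_iff[of I k n x] half_index_less_height[OF assms] by auto
  have "posv I n x = k"
    using x(3) assms by (auto simp: posv_def half_index_def PiE_iff extensional_def fun_eq_iff)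
  then show "x \<in> halves I n \<and> posv I n x = k"
    using x half_index_less[OF assms] by (auto simp: halves_iff)
next
  assume x: "x \<in> halves I n \<and> posv I n x = k"
  then have "pos n (x i) = k i" if "i \<in> I" for i using that by (auto simp: posv_def)
  then show "x \<in> tbox I n k"
    using x tbox_iff[of I k n x] half_index_less_height[OF assms] by (auto simp: halves_iff)
qed

lemma posv_half_index: "x \<in> halves I n \<Longrightarrow> posv I n x \<in> half_index I n"
  by (auto simp: posv_def half_index_def halves_iff)

lemma in_tbox_posv: "x \<in> halves I n \<Longrightarrow> x \<in> tbox I n (posv I n x)"
  by (simp add: half_tbox_iff posv_half_index)

lemma tbox_cong: "(\<And>i. i \<in> I \<Longrightarrow> k i = k' i) \<Longrightarrow> tbox I n k = tbox I n k'"
  unfolding tbox_def by (intro PiE_cong) auto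

lemma restrict_half_index:
  assumes "\<And>i. i \<in> J \<Longrightarrow> k i < height n div 2"
  shows "restrict k J \<in> half_index J n" "tbox J n (restrict k J) = tbox J n k" "tbox J n k \<subseteq> halves J n"
proof -
  show h: "restrict k J \<in> half_index J n" using assms by (auto simp: half_index_def)
  show eq: "tbox J n (restrict k J) = tbox J n k" by (rule tbox_cong) simp
  show "tbox J n k \<subseteq> halves J n" using half_tbox_iff[OF h] unfolding eq by auto
qed

lemma eventually_halves:
  assumes "finite I" "x \<in> space (powX I)"
  shows "eventually (\<lambda>n. x \<in> halves I n \<and> (\<forall>i\<in>I. pos n (x i) + j < height n div 2)) sequentially"
proof -
  have "eventually (\<lambda>n. \<forall>i\<in>I. x i \<in> bottom_half n \<and> pos n (x i) + j < height n div 2) sequentially"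
    using assms by (intro eventually_ball_finite ballI eventually_bottom_half) (auto simp: space_powX_iff)
  then show ?thesis
    by eventually_elim (use assms in \<open>auto simp: halves_def PiE_iff space_powX_iff\<close>)
qed

lemma eventually_halves_positive:
  assumes "finite I" "x \<in> space (powX I)" "K \<subseteq> I" "\<And>i. i \<in> K \<Longrightarrow> x i \<noteq> 0"
  shows "eventually (\<lambda>n. x \<in> halves I n \<and> (\<forall>i\<in>K. 1 \<le> pos n (x i))) sequentially"
proof (intro eventually_conj eventually_ball_finite ballI)
  show "eventually (\<lambda>n. x \<in> halves I n) sequentially"
    using eventually_halves[OF assms(1,2), of 0] by (rule eventually_mono) simp
  show "finite K" using assms(1,3) finite_subset by blast
  show "eventually (\<lambda>n. 1 \<le> pos n (x i)) sequentially" if "i \<in> K" for i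
    using assms(2,3) assms(4)[OF that] that
    by (intro eventually_pos_positive) (auto simp: space_powX_iff less_le)
qed

lemma ex_halves:
  assumes "finite I" "x \<in> space (powX I)"
  shows "\<exists>n\<ge>N. x \<in> halves I n \<and> (\<forall>i\<in>I. pos n (x i) + j < height n div 2)"
  using eventually_conj[OF eventually_halves[OF assms, of j] eventually_ge_at_top[of N]]
  unfolding eventually_sequentially by (meson order_refl)

lemma tbox_coarser:
  assumes "m \<le> n" "\<And>i. i \<in> I \<Longrightarrow> a i < height m" "\<And>i. i \<in> I \<Longrightarrow> b i < height n"
    "x \<in> tbox I m a" "x \<in> tbox I n b"
  shows "tbox I n b \<subseteq> tbox I m a"
proof
  fix y assume y: "y \<in> tbox I n b"
  have "y i \<in> covered m \<and> pos m (y i) = a i" if "i \<in> I" for i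
    using pos_coarser[OF assms(1), of "x i" "y i"] assms y that
      tbox_iff[of I a m x] tbox_iff[of I b n x] tbox_iff[of I b n y] by auto
  then show "y \<in> tbox I m a" using y assms tbox_iff[of I a m y] tbox_iff[of I b n y] by auto
qed

section \<open>A uniqueness criterion for measures\<close>

definition boxes :: "'i set \<Rightarrow> ('i \<Rightarrow> real) set set" where
  "boxes I = {tbox I n k |n k. \<forall>i\<in>I. k i < height n}"

lemma countable_boxes: "finite I \<Longrightarrow> countable (boxes I)"
proof -
  assume fin: "finite I"
  have "boxes I \<subseteq> (\<Union>n. tbox I n ` (\<Pi>\<^sub>E i\<in>I. {..<height n}))"
  proof
    fix B assume "B \<in> boxes I"
    then obtain n k where B: "B = tbox I n k" "\<forall>i\<in>I. k i < height n" by (auto simp: boxes_def)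
    have "tbox I n k = tbox I n (restrict k I)" by (rule tbox_cong) simp
    with B have "B = tbox I n (restrict k I)" "restrict k I \<in> (\<Pi>\<^sub>E i\<in>I. {..<height n})" by auto
    then show "B \<in> (\<Union>n. tbox I n ` (\<Pi>\<^sub>E i\<in>I. {..<height n}))" by blast
  qed
  moreover have "countable (\<Union>n. tbox I n ` (\<Pi>\<^sub>E i\<in>I. {..<height n}))"
    using fin by (intro countable_UN[OF countableI_type] countable_image countable_finite finite_PiE) auto
  ultimately show ?thesis by (rule countable_subset)
qed

lemma boxes_sets: "finite I \<Longrightarrow> B \<in> boxes I \<Longrightarrow> B \<in> sets (powX I)"
  by (auto simp: boxes_def intro: tbox_sets)

lemma half_tbox_in_boxes: "k \<in> half_index I n \<Longrightarrow> tbox I n k \<in> boxes I"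
  unfolding boxes_def using half_index_less_height[of k I n] by blast

lemma boxes_nested:
  assumes "A \<in> boxes I" "B \<in> boxes I" "x \<in> A" "x \<in> B"
  shows "A \<subseteq> B \<or> B \<subseteq> A"
proof -
  obtain m a n b where ab: "A = tbox I m a" "\<forall>i\<in>I. a i < height m"
    "B = tbox I n b" "\<forall>i\<in>I. b i < height n" using assms by (auto simp: boxes_def)
  consider "m \<le> n" | "n \<le> m" by linarith
  then show ?thesis
  proof cases
    case 1 then show ?thesis using tbox_coarser[OF 1, of I a b x] ab assms by auto
  next
    case 2 then show ?thesis using tbox_coarser[OF 2, of I b a x] ab assms by auto
  qed
qed

lemma eventually_box_small:
  assumes "finite I" "x \<in> space (powX I)" "i \<in> I" "open U" "x i \<in> U"
  shows "eventually (\<lambda>n. tbox I n (posv I n x) \<subseteq> {y. y i \<in> U}) sequentially"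
proof -
  obtain e where e: "e > 0" "ball (x i) e \<subseteq> U" using assms openE by blast
  have "(\<lambda>n. (1/3::real) ^ n) \<longlonglongrightarrow> 0" by (rule LIMSEQ_realpow_zero) auto
  then have "eventually (\<lambda>n. (1/3::real) ^ n < e) sequentially"
    using e by (intro order_tendstoD) auto
  with eventually_halves[OF assms(1,2), of 0] show ?thesis
  proof eventually_elim
    case (elim n)
    then have "x \<in> tbox I n (posv I n x)" using in_tbox_posv by blast
    then have "x i \<in> level n (pos n (x i))" using assms(3) by (auto simp: tbox_def posv_def PiE_iff)
    then have "y i \<in> ball (x i) e" if "y \<in> tbox I n (posv I n x)" for y
      using that assms(3) elim(2)
      by (force simp: tbox_def posv_def PiE_iff level_def dist_real_def power_one_over abs_less_iff)
    then show ?case using e by blast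
  qed
qed

text \<open>
  The boxes of a point shrink to it, so an open condition on one coordinate is a countable union of
  members of \<open>E\<close>. The union of \<open>E\<close> need not be the whole space: this allows
  families that avoid boxes whose image or preimage under a shift is not a box.
\<close>

lemma sigma_boxes:
  assumes fin: "finite I" and E: "E \<subseteq> boxes I"
    and ev: "\<And>x. x \<in> \<Union>E \<Longrightarrow> eventually (\<lambda>n. tbox I n (posv I n x) \<in> E) sequentially"
    and A: "A \<in> sets (powX I)"
  shows "A \<inter> \<Union>E \<in> sigma_sets (\<Union>E) (insert {} E)"
proof -
  let ?S = "sigma (\<Union>E) (insert {} E)"
  have sub: "insert {} E \<subseteq> Pow (\<Union>E)" by auto
  have sp: "space ?S = \<Union>E" and se: "sets ?S = sigma_sets (\<Union>E) (insert {} E)"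
    using sub by (auto simp: space_measure_of sets_measure_of)
  have Esp: "\<Union>E \<subseteq> space (powX I)" using E boxes_sets[OF fin] sets.sets_into_space by blast
  have cE: "countable E" using countable_boxes[OF fin] E by (rule countable_subset[rotated])
  have "(\<lambda>x. x) \<in> measurable ?S (powX I)"
  proof (rule powX_measurableI)
    fix i assume i: "i \<in> I"
    have "(\<lambda>x. x i) \<in> borel_measurable ?S"
    proof (rule borel_measurableI)
      fix U :: "real set" assume U: "open U"
      have "(\<lambda>x. x i) -` U \<inter> space ?S = \<Union>{B \<in> E. B \<subseteq> {y. y i \<in> U}}"
      proof (intro equalityI subsetI)
        fix x assume x: "x \<in> (\<lambda>x. x i) -` U \<inter> space ?S"
        then have xE: "x \<in> \<Union>E" and xs: "x \<in> space (powX I)" using sp Esp by auto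
        have "eventually (\<lambda>n. (tbox I n (posv I n x) \<in> E \<and> tbox I n (posv I n x) \<subseteq> {y. y i \<in> U})
            \<and> x \<in> halves I n \<and> (\<forall>i\<in>I. pos n (x i) + 0 < height n div 2)) sequentially"
          using x by (intro eventually_conj ev[OF xE] eventually_box_small[OF fin xs i U]
            eventually_halves[OF fin xs]) auto
        then obtain n where "tbox I n (posv I n x) \<in> E" "tbox I n (posv I n x) \<subseteq> {y. y i \<in> U}"
          "x \<in> halves I n" unfolding eventually_sequentially by blast
        then show "x \<in> \<Union>{B \<in> E. B \<subseteq> {y. y i \<in> U}}" using in_tbox_posv by blast
      qed (auto simp: sp)
      also have "\<dots> \<in> sets ?S" unfolding se
        using sets.countable_Union[of "{B \<in> E. B \<subseteq> {y. y i \<in> U}}" ?S] countable_subset[OF _ cE] se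
        by auto
      finally show "(\<lambda>x. x i) -` U \<inter> space ?S \<in> sets ?S" .
    qed
    then show "(\<lambda>x. x i) \<in> measurable ?S halfline"
      using i Esp sp by (intro measurable_restrict_space2) (auto simp: space_powX_iff)
  qed (use sp Esp in \<open>auto simp: space_powX_iff\<close>)
  from measurable_sets[OF this A] show ?thesis by (simp add: sp se)
qed

text \<open>
  Boxes that meet are nested, so \<open>E\<close> together with the empty set is stable under
  intersection, and it generates the trace of the Borel sets on its union.
\<close>

lemma tbox_measure_unique:
  assumes fin: "finite I" and M: "sets M = sets (powX I)" and N: "sets N = sets (powX I)"
    and E: "E \<subseteq> boxes I"
    and ev: "\<And>x. x \<in> \<Union>E \<Longrightarrow> eventually (\<lambda>n. tbox I n (posv I n x) \<in> E) sequentially"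
    and AE: "AE x in M. x \<in> \<Union>E" "AE x in N. x \<in> \<Union>E"
    and eq: "\<And>B. B \<in> E \<Longrightarrow> emeasure M B = emeasure N B"
    and finM: "\<And>B. B \<in> E \<Longrightarrow> emeasure M B \<noteq> \<infinity>"
  shows "M = N"
proof -
  let ?W = "\<Union>E" and ?E = "insert {} E"
  have cE: "countable E" using countable_boxes[OF fin] E by (rule countable_subset[rotated])
  have W: "?W \<in> sets (powX I)" using E boxes_sets[OF fin] by (intro sets.countable_Union cE) auto
  have WM: "?W \<inter> space M \<in> sets M" "?W \<inter> space N \<in> sets N" using W M N by auto
  have Wsp: "?W \<subseteq> space M" "?W \<subseteq> space N"
    using sets.sets_into_space[OF W] sets_eq_imp_space_eq[OF M] sets_eq_imp_space_eq[OF N] by auto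
  have gen: "sets (restrict_space K ?W) = sigma_sets ?W ?E" if K: "sets K = sets (powX I)" for K
  proof (intro equalityI subsetI)
    have Wsp': "?W \<inter> space K = ?W" using sets.sets_into_space[OF W] sets_eq_imp_space_eq[OF K] by auto
    fix A assume "A \<in> sets (restrict_space K ?W)"
    then obtain A' where "A = ?W \<inter> A'" "A' \<in> sets (powX I)" by (auto simp: sets_restrict_space K)
    then show "A \<in> sigma_sets ?W ?E" using sigma_boxes[OF fin E ev, of A'] by (simp add: Int_commute)
  next
    have Wsp': "?W \<inter> space K = ?W" using sets.sets_into_space[OF W] sets_eq_imp_space_eq[OF K] by auto
    have sp: "space (restrict_space K ?W) = ?W" using Wsp' by (simp add: space_restrict_space Int_commute)
    have "B \<in> sets (restrict_space K ?W)" if "B \<in> ?E" for B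
    proof -
      have "B \<in> sets (powX I)" "B \<subseteq> ?W" using that E boxes_sets[OF fin] by auto
      then show ?thesis using K Wsp' W by (auto simp: sets_restrict_space_iff)
    qed
    then have "?E \<subseteq> sets (restrict_space K ?W)" by blast
    then have "sigma_sets ?W ?E \<subseteq> sets (restrict_space K ?W)"
      using sets.sigma_sets_subset[of ?E "restrict_space K ?W"] by (simp only: sp)
    then show "A \<in> sets (restrict_space K ?W)" if "A \<in> sigma_sets ?W ?E" for A using that by blast
  qed
  have em: "emeasure (restrict_space K ?W) B = emeasure K B" 
    if K: "sets K = sets (powX I)" and B: "B \<subseteq> ?W" for K B
    using W sets_eq_imp_space_eq[OF K] K B by (intro emeasure_restrict_space) (auto dest: sets.sets_into_space)
  have R: "restrict_space M ?W = restrict_space N ?W"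
  proof (rule measure_eqI_generator_eq_countable[where E = ?E and \<Omega> = ?W and A = ?E])
    show "Int_stable ?E"
    proof (rule Int_stableI)
      fix A B assume "A \<in> ?E" "B \<in> ?E"
      then show "A \<inter> B \<in> ?E"
      proof (cases "A \<inter> B = {}")
        case False
        then obtain x where "x \<in> A" "x \<in> B" by blast
        then have "A \<in> boxes I" "B \<in> boxes I" using \<open>A \<in> ?E\<close> \<open>B \<in> ?E\<close> E by auto
        from boxes_nested[OF this \<open>x \<in> A\<close> \<open>x \<in> B\<close>] show ?thesis
          using \<open>A \<in> ?E\<close> \<open>B \<in> ?E\<close> by (auto simp: Int_absorb1 Int_absorb2)
      qed simp
    qed
    show "countable ?E" using cE by simp
    show "emeasure (restrict_space M ?W) a \<noteq> \<infinity>" if "a \<in> ?E" for a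
      using that finM[of a] em[OF M, of a] Union_upper[of a E] by (cases "a = {}") auto
    show "emeasure (restrict_space M ?W) X = emeasure (restrict_space N ?W) X" if "X \<in> ?E" for X
      using that eq[of X] em[OF M, of X] em[OF N, of X] Union_upper[of X E] by (cases "X = {}") auto
  qed (auto simp: gen[OF M] gen[OF N])
  show ?thesis
  proof (rule measure_eqI)
    show "sets M = sets N" using M N by simp
    fix A assume A: "A \<in> sets M"
    have "emeasure M A = emeasure M (A \<inter> ?W)"
      using AE(1) A W M by (intro emeasure_eq_AE) auto
    also have "\<dots> = emeasure (restrict_space N ?W) (A \<inter> ?W)" unfolding R[symmetric] by (rule em[OF M, symmetric]) auto
    also have "\<dots> = emeasure N (A \<inter> ?W)" by (rule em[OF N]) auto
    also have "\<dots> = emeasure N A"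
      using AE(2) A W M N by (intro emeasure_eq_AE) auto
    finally show "emeasure M A = emeasure N A" .
  qed
qed

section \<open>Measurability of the partial shifts\<close>

text \<open>
  Both \<open>chacon\<close> and its inverse are translations on suitable levels, and countably many
  levels suffice.
\<close>

lemma measurable_by_levels:
  assumes f: "\<And>x. 0 \<le> x \<Longrightarrow> 0 \<le> f x"
    and piece: "\<And>x. x \<in> V \<Longrightarrow> \<exists>n k c. k < height n \<and> x \<in> level n k \<and> (\<forall>y\<in>level n k. f y = y + c)"
    and V: "V \<subseteq> {0..}" "countable ({0..} - V)"
  shows "f \<in> measurable halfline halfline"
proof -
  let ?C = "{level n k |n k. k < height n \<and> (\<exists>c. \<forall>y\<in>level n k. f y = y + c)} \<union> (\<lambda>x. {x}) ` ({0..} - V)"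
  have "f \<in> borel_measurable halfline"
  proof (rule measurable_piecewise_restrict[of ?C])
    have "countable ((\<lambda>(n, k). level n k) ` UNIV)" by (intro countable_image) auto
    then have "countable {level n k |n k. k < height n \<and> (\<exists>c. \<forall>y\<in>level n k. f y = y + c)}"
      by (rule countable_subset[rotated]) auto
    then show "countable ?C" using V by auto
    show "space halfline \<subseteq> \<Union>?C"
    proof
      fix x assume x: "x \<in> space halfline"
      show "x \<in> \<Union>?C"
      proof (cases "x \<in> V")
        case True
        then show ?thesis using piece[OF True] by blast
      next
        case False
        then have "{x} \<in> ?C" using x by auto
        then show ?thesis by blast
      qed
    qed
    fix W assume W: "W \<in> ?C"
    then show "W \<inter> space halfline \<in> sets halfline"
    proof
      assume "W \<in> {level n k |n k. k < height n \<and> (\<exists>c. \<forall>y\<in>level n k. f y = y + c)}"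
      then obtain n k where "W = level n k" "k < height n" by blast
      then show ?thesis using level_sets[of k n] sets.Int_space_eq2 by metis
    qed (auto simp: sets_halfline_iff)
    from W show "f \<in> borel_measurable (restrict_space halfline W)"
    proof
      assume "W \<in> {level n k |n k. k < height n \<and> (\<exists>c. \<forall>y\<in>level n k. f y = y + c)}"
      then obtain n k c where c: "W = level n k" "k < height n" "\<forall>y\<in>level n k. f y = y + c" by blast
      have "(\<lambda>y. y + c) \<in> borel_measurable (restrict_space halfline W)"
        by (intro measurable_restrict_space1) (auto intro!: borel_measurable_add measurable_restrict_space1)
      then show ?thesis using c by (subst measurable_cong[where g = "\<lambda>y. y + c"]) (auto simp: space_restrict_space)
    next
      assume "W \<in> (\<lambda>x. {x}) ` ({0..} - V)"
      then obtain x where x: "W = {x}" by auto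
      then show ?thesis
        by (subst measurable_cong[where g = "\<lambda>y. f x"]) (auto simp: space_restrict_space)
    qed
  qed
  then show ?thesis using f by (intro measurable_restrict_space2) auto
qed

lemma chacon_measurable: "chacon \<in> measurable halfline halfline"
proof (rule measurable_by_levels[where V = "{0..}"])
  fix x :: real assume "x \<in> {0..}"
  then have "eventually (\<lambda>n. x \<in> covered n \<and> pos n x + 1 < height n) sequentially"
    by (intro eventually_nontop) auto
  then obtain n where n: "x \<in> covered n" "Suc (pos n x) < height n"
    unfolding eventually_sequentially by auto
  have "chacon y = y + (tower n ! Suc (pos n x) - tower n ! pos n x)" if "y \<in> level n (pos n x)" for y
    using chacon_eq[of y n] level_iff[of "pos n x" n y] that n by (auto simp: offset_def)
  then show "\<exists>n k c. k < height n \<and> x \<in> level n k \<and> (\<forall>y\<in>level n k. chacon y = y + c)"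
    using in_level_pos[OF n(1)] pos_less[OF n(1)] by blast
qed (auto intro: chacon_nonneg)

text \<open>
  The point 0 has no preimage; its value 0 only serves to stay on the half-line.
\<close>

definition chacon_inv :: "real \<Rightarrow> real" where
  "chacon_inv y = (if y > 0 then inv_into {0..} chacon y else 0)"

lemma chacon_inv_chacon: "0 \<le> x \<Longrightarrow> chacon_inv (chacon x) = x"
  using chacon_positive[of x] chacon_inj by (simp add: chacon_inv_def inv_into_f_f)

lemma chacon_chacon_inv:
  assumes "0 < y" shows "chacon (chacon_inv y) = y"
proof -
  have "y \<in> chacon ` {0..}" using chacon_surj[OF assms] by auto
  from f_inv_into_f[OF this] assms show ?thesis by (simp add: chacon_inv_def)
qed

lemma chacon_inv_nonneg: "0 \<le> chacon_inv y"
proof (cases "0 < y")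
  case True
  then have "y \<in> chacon ` {0..}" using chacon_surj[OF True] by auto
  from inv_into_into[OF this] True show ?thesis by (simp add: chacon_inv_def)
qed (simp add: chacon_inv_def)

lemma chacon_inv_measurable: "chacon_inv \<in> measurable halfline halfline"
proof (rule measurable_by_levels[where V = "{0<..}"])
  fix y :: real assume y: "y \<in> {0<..}"
  have "eventually (\<lambda>n. y \<in> covered n \<and> 1 \<le> pos n y) sequentially"
    using eventually_nontop[of y 0] eventually_pos_positive[of y] y by (auto simp: eventually_conj_iff)
  then obtain n where n: "y \<in> covered n" "1 \<le> pos n y" unfolding eventually_sequentially by auto
  have "chacon_inv u = u + (tower n ! (pos n y - 1) - tower n ! pos n y)" if "u \<in> level n (pos n y)" for u
  proof -
    have u: "u \<in> covered n" "pos n u = pos n y" using that level_iff[OF pos_less[OF n(1)]] by auto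
    let ?x = "tower n ! (pos n y - 1) + offset n u"
    have k: "pos n y - 1 < height n" using pos_less[OF n(1)] by simp
    note x = point_covered[OF k offset_bounds[OF u(1)]] pos_point[OF k offset_bounds[OF u(1)]]
      offset_point[OF k offset_bounds[OF u(1)]]
    have "u = chacon ?x" using chacon_iter_eqI[OF x(1) u(1), of 1] x n u(2) by simp
    then have "chacon_inv u = ?x" using chacon_inv_chacon[OF covered_nonneg[OF x(1)]] by metis
    then show ?thesis using u by (simp add: offset_def)
  qed
  then show "\<exists>n k c. k < height n \<and> y \<in> level n k \<and> (\<forall>u\<in>level n k. chacon_inv u = u + c)"
    using in_level_pos[OF n(1)] pos_less[OF n(1)] by blast
next
  have "{0..} - {0<..} = {0::real}" by auto
  then show "countable ({0..} - {0<..} :: real set)" by simp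
qed (auto simp: chacon_inv_nonneg)

text \<open>
  The transformation acting on the coordinates in \<open>K\<close> only. Invariance of
  \<open>\<sigma>\<close> under such a map is what splits it into a product.
\<close>

definition shift :: "'i set \<Rightarrow> 'i set \<Rightarrow> ('i \<Rightarrow> real) \<Rightarrow> ('i \<Rightarrow> real)" where
  "shift I K x = (\<lambda>i\<in>I. if i \<in> K then chacon (x i) else x i)"

lemma chacon_pow_eq_shift: "chacon_pow I = shift I I"
  by (auto simp: chacon_pow_def shift_def fun_eq_iff)

lemma shift_measurable: "shift I K \<in> measurable (powX I) (powX I)"
proof (rule powX_measurableI)
  fix i assume i: "i \<in> I"
  note c = component_measurable[OF i]
  show "(\<lambda>x. shift I K x i) \<in> measurable (powX I) halfline"
    using c measurable_compose[OF c chacon_measurable] i by (cases "i \<in> K") (auto simp: shift_def)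
qed (auto simp: shift_def)

lemma shift_space: "x \<in> space (powX I) \<Longrightarrow> shift I K x \<in> space (powX I)"
  using measurable_space[OF shift_measurable] .

lemma shift_iter_measurable: "shift I K ^^ j \<in> measurable (powX I) (powX I)"
  by (rule measurable_compose_n[OF shift_measurable])

lemma shift_iter_space: "x \<in> space (powX I) \<Longrightarrow> (shift I K ^^ j) x \<in> space (powX I)"
  using measurable_space[OF shift_iter_measurable] .

lemma shift_iter:
  assumes "x \<in> extensional I"
  shows "(shift I K ^^ j) x = (\<lambda>i\<in>I. if i \<in> K then (chacon ^^ j) (x i) else x i)"
proof (induction j)
  case 0
  then show ?case using assms by (auto simp: fun_eq_iff extensional_def)
next
  case (Suc j)
  then show ?case by (auto simp: shift_def fun_eq_iff)
qed

lemma shift_inj: "inj_on (shift I K) (space (powX I))"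
proof (rule inj_onI)
  fix x y assume xy: "x \<in> space (powX I)" "y \<in> space (powX I)" "shift I K x = shift I K y"
  show "x = y"
  proof (rule extensionalityI[of _ I])
    fix i assume i: "i \<in> I"
    then have "(if i \<in> K then chacon (x i) else x i) = (if i \<in> K then chacon (y i) else y i)"
      using fun_cong[OF xy(3), of i] by (simp add: shift_def)
    then show "x i = y i" using chacon_inj xy(1,2) i
      by (auto simp: space_powX_iff dest: inj_onD split: if_splits)
  qed (use xy in \<open>auto simp: space_powX_iff\<close>)
qed

lemma shift_iter_inj: "inj_on (shift I K ^^ j) (space (powX I))"
proof (induction j)
  case (Suc j)
  show ?case
  proof (rule inj_onI)
    fix x y assume "x \<in> space (powX I)" "y \<in> space (powX I)" "(shift I K ^^ Suc j) x = (shift I K ^^ Suc j) y"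
    then show "x = y" using Suc inj_onD[OF shift_inj[of I K], of "(shift I K ^^ j) x" "(shift I K ^^ j) y"]
      shift_iter_space[where I = I and K = K and j = j] by (auto dest: inj_onD)
  qed
qed simp

text \<open>
  The image is the preimage under the coordinatewise inverse, restricted to the points whose
  coordinates in \<open>K\<close> are positive. Images are needed because backward orbits also count.
\<close>

lemma shift_image_sets:
  assumes "finite I" "A \<in> sets (powX I)"
  shows "shift I K ` A \<in> sets (powX I)"
proof -
  let ?g = "\<lambda>y. \<lambda>i\<in>I. if i \<in> K then chacon_inv (y i) else y i"
  have g: "?g \<in> measurable (powX I) (powX I)"
  proof (rule powX_measurableI)
    fix i assume i: "i \<in> I"
    note c = component_measurable[OF i]
    show "(\<lambda>y. ?g y i) \<in> measurable (powX I) halfline"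
      using c measurable_compose[OF c chacon_inv_measurable] i by (cases "i \<in> K") auto
  qed auto
  have As: "A \<subseteq> space (powX I)" using assms(2) by (rule sets.sets_into_space)
  have P: "(\<Pi>\<^sub>E i\<in>I. if i \<in> K then {0<..} else {0..}) \<in> sets (powX I)"
    by (intro powX_sets_PiE assms) (auto simp: sets_halfline_iff)
  have "shift I K ` A = (?g -` A \<inter> space (powX I)) \<inter> (\<Pi>\<^sub>E i\<in>I. if i \<in> K then {0<..} else {0..})"
  proof (intro equalityI subsetI)
    fix y assume "y \<in> shift I K ` A"
    then obtain x where x: "x \<in> A" "y = shift I K x" by blast
    then have xs: "x \<in> space (powX I)" using As by blast
    have "?g y = x"
      using xs unfolding x(2) by (auto simp: shift_def space_powX_iff extensional_def fun_eq_iff chacon_inv_chacon)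
    moreover have "y \<in> (\<Pi>\<^sub>E i\<in>I. if i \<in> K then {0<..} else {0..})"
      using xs unfolding x(2) by (auto simp: shift_def space_powX_iff chacon_positive)
    ultimately show "y \<in> (?g -` A \<inter> space (powX I)) \<inter> (\<Pi>\<^sub>E i\<in>I. if i \<in> K then {0<..} else {0..})"
      using x(1) shift_space[OF xs, of K] unfolding x(2)[symmetric] by simp
  next
    fix y assume y: "y \<in> (?g -` A \<inter> space (powX I)) \<inter> (\<Pi>\<^sub>E i\<in>I. if i \<in> K then {0<..} else {0..})"
    have "shift I K (?g y) i = y i" for i
    proof (cases "i \<in> I")
      case True
      then have "y i \<in> (if i \<in> K then {0<..} else {0..})" using y by (auto simp: PiE_iff)
      then show ?thesis using True by (auto simp: shift_def chacon_chacon_inv)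
    next
      case False
      then show ?thesis using y by (auto simp: shift_def PiE_iff extensional_def)
    qed
    then have "y = shift I K (?g y)" by auto
    then show "y \<in> shift I K ` A" using y by blast
  qed
  also have "\<dots> \<in> sets (powX I)" using measurable_sets[OF g assms(2)] P by blast
  finally show ?thesis .
qed

lemma shift_iter_image_sets:
  assumes "finite I" "A \<in> sets (powX I)"
  shows "(shift I K ^^ j) ` A \<in> sets (powX I)"
proof (induction j)
  case (Suc j)
  have "(shift I K ^^ Suc j) ` A = shift I K ` ((shift I K ^^ j) ` A)" by (simp add: image_comp)
  then show ?case using shift_image_sets[OF assms(1) Suc] by simp
qed (use assms in simp)

section \<open>Crossings\<close>

text \<open>
  The points of the orbit of \<open>x\<close> met while all coordinates remain in the bottom half of
  tower \<open>n\<close>: they have the offsets of \<open>x\<close>, and all positions differ from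
  those of \<open>x\<close> by the same integer. Defined by positions rather than by iteration, the
  orbit is two-sided without any choice of an inverse. The set is empty when \<open>x\<close> has a
  coordinate outside the bottom half.
\<close>

definition crossing :: "'i set \<Rightarrow> nat \<Rightarrow> ('i \<Rightarrow> real) \<Rightarrow> ('i \<Rightarrow> real) set" where
  "crossing I n x = {y. x \<in> halves I n \<and> y \<in> halves I n \<and>
     (\<exists>z::int. \<forall>i\<in>I. offset n (y i) = offset n (x i) \<and> int (pos n (y i)) = int (pos n (x i)) + z)}"

lemma crossing_halves: "y \<in> crossing I n x \<Longrightarrow> y \<in> halves I n" "y \<in> crossing I n x \<Longrightarrow> x \<in> halves I n"
  by (auto simp: crossing_def)

lemma crossingE:
  assumes "y \<in> crossing I n x"
  obtains z where "\<And>i. i \<in> I \<Longrightarrow> offset n (y i) = offset n (x i)"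
    "\<And>i. i \<in> I \<Longrightarrow> int (pos n (y i)) = int (pos n (x i)) + z"
  using assms by (auto simp: crossing_def)

lemma crossingI:
  assumes "x \<in> halves I n" "y \<in> halves I n" "\<And>i. i \<in> I \<Longrightarrow> offset n (y i) = offset n (x i)"
    "\<And>i. i \<in> I \<Longrightarrow> int (pos n (y i)) = int (pos n (x i)) + z"
  shows "y \<in> crossing I n x"
  using assms by (auto simp: crossing_def)

lemma crossing_refl: "x \<in> halves I n \<Longrightarrow> x \<in> crossing I n x"
  by (rule crossingI[where z = 0]) auto

lemma crossing_sym: "y \<in> crossing I n x \<Longrightarrow> x \<in> crossing I n y"
proof -
  assume y: "y \<in> crossing I n x"
  then obtain z where "\<And>i. i \<in> I \<Longrightarrow> offset n (y i) = offset n (x i)"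
    "\<And>i. i \<in> I \<Longrightarrow> int (pos n (y i)) = int (pos n (x i)) + z" by (rule crossingE) blast
  then show ?thesis using crossing_halves[OF y] by (intro crossingI[where z = "- z"]) auto
qed

lemma crossing_trans:
  assumes y: "y \<in> crossing I n x" and w: "w \<in> crossing I n y"
  shows "w \<in> crossing I n x"
proof -
  obtain z where z: "\<And>i. i \<in> I \<Longrightarrow> offset n (y i) = offset n (x i)"
    "\<And>i. i \<in> I \<Longrightarrow> int (pos n (y i)) = int (pos n (x i)) + z" using y by (rule crossingE) blast
  obtain z' where z': "\<And>i. i \<in> I \<Longrightarrow> offset n (w i) = offset n (y i)"
    "\<And>i. i \<in> I \<Longrightarrow> int (pos n (w i)) = int (pos n (y i)) + z'" using w by (rule crossingE) blast
  show ?thesis using crossing_halves[OF y] crossing_halves[OF w] z z'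
    by (intro crossingI[where z = "z + z'"]) auto
qed

lemma crossing_eq: "y \<in> crossing I n x \<Longrightarrow> crossing I n y = crossing I n x"
  using crossing_sym crossing_trans by blast

lemma crossing_mono:
  assumes "m \<le> n" shows "crossing I m x \<subseteq> crossing I n x"
proof
  fix y assume y: "y \<in> crossing I m x"
  then obtain z where z: "\<And>i. i \<in> I \<Longrightarrow> offset m (y i) = offset m (x i)"
    "\<And>i. i \<in> I \<Longrightarrow> int (pos m (y i)) = int (pos m (x i)) + z" by (rule crossingE) blast
  have "offset n (y i) = offset n (x i) \<and> int (pos n (y i)) - int (pos n (x i)) = z" if "i \<in> I" for i
    using offset_finer[OF assms, of "x i" "y i"] z[OF that] halves_covered[OF _ that]
      crossing_halves[OF y] by auto
  then show "y \<in> crossing I n x"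
    using crossing_halves[OF y] halves_mono[OF assms, of I] by (intro crossingI[where z = z]) force+
qed

lemma crossing_posv_inj: "inj_on (posv I n) (crossing I n x)"
proof (rule inj_onI)
  fix u v assume u: "u \<in> crossing I n x" and v: "v \<in> crossing I n x" and eq: "posv I n u = posv I n v"
  show "u = v"
  proof (rule extensionalityI[of _ I])
    fix i assume i: "i \<in> I"
    have "pos n (u i) = pos n (v i)" using fun_cong[OF eq, of i] i by (simp add: posv_def)
    moreover have "offset n (u i) = offset n (v i)"
      using u v i by (auto elim!: crossingE)
    ultimately show "u i = v i" by (rule point_eqI)
  qed (use u v crossing_halves in \<open>auto simp: halves_iff\<close>)
qed

lemma finite_crossing: "finite I \<Longrightarrow> finite (crossing I n x)"
proof (rule finite_imageD[OF _ crossing_posv_inj])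
  assume "finite I"
  moreover have "posv I n ` crossing I n x \<subseteq> half_index I n"
    using posv_half_index crossing_halves by blast
  ultimately show "finite (posv I n ` crossing I n x)" using finite_half_index finite_subset by blast
qed

lemma halves_extensional: "x \<in> halves I n \<Longrightarrow> x \<in> extensional I"
  by (simp add: halves_iff)

lemma chacon_pow_iter:
  assumes "x \<in> extensional I"
  shows "(chacon_pow I ^^ j) x = (\<lambda>i\<in>I. (chacon ^^ j) (x i))"
  unfolding chacon_pow_eq_shift shift_iter[OF assms] by (auto simp: fun_eq_iff)

lemma chacon_pow_iter_crossing:
  assumes "x \<in> halves I n" "\<And>i. i \<in> I \<Longrightarrow> pos n (x i) + j < height n div 2"
  shows "(chacon_pow I ^^ j) x \<in> crossing I n x"
proof -
  have c: "x i \<in> covered n" "pos n (x i) + j < height n" if "i \<in> I" for i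
    using assms(1) assms(2)[OF that] that by (auto simp: halves_iff)
  show ?thesis
    unfolding chacon_pow_iter[OF halves_extensional[OF assms(1)]]
    using assms chacon_iter_covered[OF c] pos_chacon_iter[OF c] offset_chacon_iter[OF c]
    by (intro crossingI[where z = "int j"]) (auto simp: halves_iff)
qed

lemma crossing_forward:
  assumes y: "y \<in> crossing I n x" and z: "\<And>i. i \<in> I \<Longrightarrow> int (pos n (y i)) = int (pos n (x i)) + int j"
  shows "y = (chacon_pow I ^^ j) x"
proof -
  note h = crossing_halves[OF y]
  show ?thesis unfolding chacon_pow_iter[OF halves_extensional[OF h(2)]]
  proof (rule extensionalityI[of _ I])
    fix i assume i: "i \<in> I"
    have o: "offset n (y i) = offset n (x i)" using y i by (auto elim!: crossingE)
    have "pos n (y i) = pos n (x i) + j" using z[OF i] by linarith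
    then have "y i = (chacon ^^ j) (x i)"
      by (rule chacon_iter_eqI[OF halves_covered[OF h(2) i] halves_covered[OF h(1) i] _ o])
    then show "y i = (\<lambda>i\<in>I. (chacon ^^ j) (x i)) i" using i by simp
  qed (use h in \<open>auto simp: halves_iff\<close>)
qed

lemma crossing_orbit:
  assumes y: "y \<in> crossing I n x"
  shows "\<exists>j. y = (chacon_pow I ^^ j) x \<or> x = (chacon_pow I ^^ j) y"
proof -
  obtain z where z: "\<And>i. i \<in> I \<Longrightarrow> offset n (y i) = offset n (x i)"
    "\<And>i. i \<in> I \<Longrightarrow> int (pos n (y i)) = int (pos n (x i)) + z" using y by (rule crossingE) blast
  show ?thesis
  proof (cases "0 \<le> z")
    case True
    then have "y = (chacon_pow I ^^ nat z) x" using z by (intro crossing_forward[OF y]) auto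
    then show ?thesis by blast
  next
    case False
    then have "x = (chacon_pow I ^^ nat (- z)) y" using z by (intro crossing_forward[OF crossing_sym[OF y]]) auto
    then show ?thesis by blast
  qed
qed

text \<open>
  When one coordinate is at the bottom, nothing precedes \<open>x\<close> in its crossing, and the
  crossing ends when the highest coordinate reaches the top of the bottom half.
\<close>

lemma crossing_from_bottom:
  assumes x: "x \<in> halves I n" and fin: "finite I" and i0: "i0 \<in> I" "pos n (x i0) = 0"
  shows "bij_betw (\<lambda>j. (chacon_pow I ^^ j) x) {..<height n div 2 - Max (posv I n x ` I)} (crossing I n x)"
proof (rule bij_betwI')
  let ?L = "height n div 2 - Max (posv I n x ` I)"
  have Lp: "pos n (x i) + j < height n div 2" if "i \<in> I" "j < ?L" for i j
  proof -
    have "posv I n x i \<le> Max (posv I n x ` I)" using fin that by (intro Max_ge) auto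
    then show ?thesis using that by (simp add: posv_def)
  qed
  fix j j' assume j: "j \<in> {..<?L}" "j' \<in> {..<?L}"
  have p0: "pos n (((chacon_pow I ^^ a) x) i0) = a" if "a < ?L" for a
    unfolding chacon_pow_iter[OF halves_extensional[OF x]]
    using pos_chacon_iter[of "x i0" n a] Lp[OF i0(1) that] halves_covered[OF x i0(1)] i0 by simp
  show "((chacon_pow I ^^ j) x = (chacon_pow I ^^ j') x) = (j = j')"
    using p0[of j] p0[of j'] j by (metis lessThan_iff)
next
  let ?L = "height n div 2 - Max (posv I n x ` I)"
  have Lp: "pos n (x i) + j < height n div 2" if "i \<in> I" "j < ?L" for i j
  proof -
    have "posv I n x i \<le> Max (posv I n x ` I)" using fin that by (intro Max_ge) auto
    then show ?thesis using that by (simp add: posv_def)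
  qed
  fix j assume "j \<in> {..<?L}"
  then show "(chacon_pow I ^^ j) x \<in> crossing I n x" by (intro chacon_pow_iter_crossing x Lp) auto
next
  let ?L = "height n div 2 - Max (posv I n x ` I)"
  fix y assume y: "y \<in> crossing I n x"
  obtain z where z: "\<And>i. i \<in> I \<Longrightarrow> offset n (y i) = offset n (x i)"
    "\<And>i. i \<in> I \<Longrightarrow> int (pos n (y i)) = int (pos n (x i)) + z" using y by (rule crossingE) blast
  have z0: "0 \<le> z" using z(2)[OF i0(1)] i0(2) by simp
  have "Max (posv I n x ` I) \<in> posv I n x ` I" using fin i0 by (intro Max_in) auto
  then obtain i1 where i1: "i1 \<in> I" "Max (posv I n x ` I) = pos n (x i1)" by (auto simp: posv_def)
  have "pos n (y i1) < height n div 2" using crossing_halves[OF y] i1 by (auto simp: halves_iff)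
  then have "nat z < ?L" using z(2)[OF i1(1)] i1(2) z0 by linarith
  moreover have "y = (chacon_pow I ^^ nat z) x" using z z0 by (intro crossing_forward[OF y]) auto
  ultimately show "\<exists>j\<in>{..<?L}. y = (chacon_pow I ^^ j) x" by blast
qed

text \<open>
  Replacing the offsets of \<open>x\<close> by those of \<open>x'\<close> maps one crossing onto the
  other without changing the positions. Hence conditions on such sums define unions of boxes, which
  are measurable.
\<close>

lemma crossing_sum_box:
  fixes f :: "('i \<Rightarrow> real) \<Rightarrow> real"
  assumes x: "x \<in> halves I n" "x' \<in> halves I n" "posv I n x = posv I n x'"
    and f: "\<And>y y'. y \<in> halves I n \<Longrightarrow> y' \<in> halves I n \<Longrightarrow> posv I n y = posv I n y' \<Longrightarrow> f y = f y'"
  shows "sum f (crossing I n x) = sum f (crossing I n x')"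
proof -
  define T where "T a y = (\<lambda>i\<in>I. tower n ! pos n (y i) + offset n (a i))" for a y :: "'i \<Rightarrow> real"
  have T: "T a y \<in> crossing I n a \<and> posv I n (T a y) = posv I n y"
    if a: "a \<in> halves I n" "b \<in> halves I n" "posv I n a = posv I n b" and y: "y \<in> crossing I n b" for a b y
  proof -
    obtain z where z: "\<And>i. i \<in> I \<Longrightarrow> offset n (y i) = offset n (b i)"
      "\<And>i. i \<in> I \<Longrightarrow> int (pos n (y i)) = int (pos n (b i)) + z" using y by (rule crossingE) blast
    have ab: "pos n (a i) = pos n (b i)" if "i \<in> I" for i
      using fun_cong[OF a(3), of i] that by (simp add: posv_def)
    have c: "pos n (y i) < height n" "0 \<le> offset n (a i)" "offset n (a i) < 1 / 3 ^ n" if "i \<in> I" for i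
      using pos_less[OF halves_covered[OF crossing_halves(1)[OF y] that]]
        offset_bounds[OF halves_covered[OF a(1) that]] by auto
    have p: "T a y i \<in> covered n" "pos n (T a y i) = pos n (y i)" "offset n (T a y i) = offset n (a i)"
      if "i \<in> I" for i
      using point_covered[OF c[OF that]] pos_point[OF c[OF that]] offset_point[OF c[OF that]] that
      by (auto simp: T_def)
    have "T a y \<in> halves I n"
      using p crossing_halves(1)[OF y] by (auto simp: halves_iff T_def)
    then have "T a y \<in> crossing I n a" using p z ab a by (intro crossingI[where z = z]) auto
    moreover have "posv I n (T a y) = posv I n y" using p by (auto simp: posv_def fun_eq_iff)
    ultimately show ?thesis by blast
  qed
  have TT: "T a (T b y) = y" if a: "a \<in> halves I n" "b \<in> halves I n" "posv I n a = posv I n b" 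
     and y: "y \<in> crossing I n a" for a b y
    using crossing_posv_inj[of I n a] T[of a b "T b y"] T[of b a y] a y by (auto dest: inj_onD)
  show ?thesis
  proof (rule sum.reindex_bij_witness[where i = "T x" and j = "T x'"])
    fix a assume a: "a \<in> crossing I n x"
    show "T x (T x' a) = a" using TT[OF x a] .
    show Ta: "T x' a \<in> crossing I n x'" using T[OF x(2,1) x(3)[symmetric] a] by blast
    show "f (T x' a) = f a"
      using T[OF x(2,1) x(3)[symmetric] a] crossing_halves(1)[OF a] crossing_halves(1)[OF Ta] by (intro f) auto
  next
    fix b assume b: "b \<in> crossing I n x'"
    show "T x' (T x b) = b" using TT[OF x(2,1) x(3)[symmetric] b] .
    show "T x b \<in> crossing I n x" using T[OF x b] by blast
  qed
qed

lemma box_invariant_sets: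
  assumes fin: "finite I"
    and P: "\<And>x y. P x \<Longrightarrow> x \<in> halves I n \<Longrightarrow> y \<in> halves I n \<Longrightarrow> posv I n x = posv I n y \<Longrightarrow> P y"
  shows "{x \<in> halves I n. P x} \<in> sets (powX I)"
proof -
  have "{x \<in> halves I n. P x} = (\<Union>k\<in>{k \<in> half_index I n. \<exists>x\<in>tbox I n k. P x}. tbox I n k)"
  proof (intro equalityI subsetI)
    fix x assume "x \<in> {x \<in> halves I n. P x}"
    then show "x \<in> (\<Union>k\<in>{k \<in> half_index I n. \<exists>x\<in>tbox I n k. P x}. tbox I n k)"
      using posv_half_index[of x I n] in_tbox_posv[of x I n] by blast
  next
    fix x assume "x \<in> (\<Union>k\<in>{k \<in> half_index I n. \<exists>x\<in>tbox I n k. P x}. tbox I n k)"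
    then obtain k y where "k \<in> half_index I n" "x \<in> tbox I n k" "y \<in> tbox I n k" "P y" by blast
    then show "x \<in> {x \<in> halves I n. P x}" using P[of y x] half_tbox_iff[of k I n] by auto
  qed
  also have "\<dots> \<in> sets (powX I)"
    using finite_half_index[OF fin] half_index_less_height
    by (intro sets.finite_UN tbox_sets fin) (auto intro: half_index_less_height)
  finally show ?thesis .
qed

section \<open>A laminar covering lemma\<close>

text \<open>
  The maximal members of a laminar family are disjoint and have the same union. The induction removes
  the members that are not maximal one by one.
\<close>

lemma laminar_sum_nonneg:
  fixes f :: "'a \<Rightarrow> real"
  assumes "finite \<U>" "\<And>U. U \<in> \<U> \<Longrightarrow> finite U" "\<And>U. U \<in> \<U> \<Longrightarrow> 0 \<le> sum f U"
    and "\<And>U V. U \<in> \<U> \<Longrightarrow> V \<in> \<U> \<Longrightarrow> U \<inter> V = {} \<or> U \<subseteq> V \<or> V \<subseteq> U"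
  shows "0 \<le> sum f (\<Union>\<U>)"
  using assms
proof (induction "card \<U>" arbitrary: \<U> rule: less_induct)
  case less
  show ?case
  proof (cases "\<exists>U\<in>\<U>. \<exists>V\<in>\<U>. U \<noteq> V \<and> U \<subseteq> V")
    case True
    then obtain U V where UV: "U \<in> \<U>" "V \<in> \<U>" "U \<noteq> V" "U \<subseteq> V" by blast
    then have "\<Union>(\<U> - {U}) = \<Union>\<U>" by blast
    moreover have "0 \<le> sum f (\<Union>(\<U> - {U}))"
      using less.prems UV card_Diff1_less[OF less.prems(1) UV(1)] by (intro less.hyps) auto
    ultimately show ?thesis by simp
  next
    case False
    then have "\<forall>U\<in>\<U>. \<forall>V\<in>\<U>. U \<noteq> V \<longrightarrow> U \<inter> V = {}" using less.prems(4) by blast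
    then have "sum f (\<Union>\<U>) = sum (sum f) \<U>" using less.prems(2) by (simp add: sum.Union_disjoint)
    then show ?thesis using less.prems(3) by (simp add: sum_nonneg)
  qed
qed

section \<open>Invariant measures\<close>

locale invariant_power =
  fixes I :: "'i set" and \<sigma> :: "('i \<Rightarrow> real) measure"
  assumes finite_I: "finite I" and I_nonempty: "I \<noteq> {}"
    and sets_\<sigma>: "sets \<sigma> = sets (powX I)"
    and invariant: "invariant_measure \<sigma> (chacon_pow I)"
    and bdd_finite: "boundedly_finite I \<sigma>"
begin

abbreviation "S \<equiv> chacon_pow I"

lemma space_\<sigma>: "space \<sigma> = space (powX I)"
  by (rule sets_eq_imp_space_eq[OF sets_\<sigma>])

lemma S_space: "x \<in> space (powX I) \<Longrightarrow> S x \<in> space (powX I)"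
  unfolding chacon_pow_eq_shift by (rule shift_space)

lemma S_iter_measurable: "(S ^^ j) \<in> measurable \<sigma> \<sigma>"
  using shift_iter_measurable[where I = I and K = I and j = j] sets_\<sigma> measurable_cong_sets[OF sets_\<sigma> sets_\<sigma>]
  unfolding chacon_pow_eq_shift by auto

lemma emeasure_S_iter: "A \<in> sets \<sigma> \<Longrightarrow> emeasure \<sigma> ((S ^^ j) -` A \<inter> space \<sigma>) = emeasure \<sigma> A"
proof (induction j)
  case (Suc j)
  let ?B = "(S ^^ j) -` A \<inter> space \<sigma>"
  have B: "?B \<in> sets \<sigma>" using measurable_sets[OF S_iter_measurable Suc.prems] .
  have "(S ^^ Suc j) -` A \<inter> space \<sigma> = S -` ?B \<inter> space \<sigma>"
    using S_space space_\<sigma> by (auto simp: funpow_swap1)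
  then show ?case using B Suc invariant unfolding invariant_measure_def by metis
qed (use sets.sets_into_space in \<open>auto simp: Int_absorb2 Int_absorb1\<close>)

lemma distr_S_iter: "distr \<sigma> \<sigma> (S ^^ j) = \<sigma>"
  by (rule measure_eqI) (auto simp: emeasure_distr S_iter_measurable emeasure_S_iter)

lemma halves_measurable: "halves I n \<in> sets \<sigma>"
  using halves_sets[OF finite_I] sets_\<sigma> by simp

lemma emeasure_halves_finite: "emeasure \<sigma> (halves I n) < \<infinity>"
proof -
  have "\<bar>x i\<bar> \<le> real (height n) / 3 ^ n" if "x \<in> halves I n" "i \<in> I" for x i
    using halves_covered[OF that] by (auto simp: covered_def)
  then show ?thesis using bdd_finite halves_measurable unfolding boundedly_finite_def by blast
qed

lemma half_box_measurable: "k \<in> half_index I n \<Longrightarrow> tbox I n k \<in> sets \<sigma>"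
  unfolding sets_\<sigma> by (rule tbox_sets[OF finite_I]) (rule half_index_less_height)

lemma half_box_finite: "k \<in> half_index I n \<Longrightarrow> emeasure \<sigma> (tbox I n k) < \<infinity>"
proof -
  assume k: "k \<in> half_index I n"
  have "tbox I n k \<subseteq> halves I n" using half_tbox_iff[OF k] by auto
  then have "emeasure \<sigma> (tbox I n k) \<le> emeasure \<sigma> (halves I n)"
    by (intro emeasure_mono halves_measurable)
  then show ?thesis using emeasure_halves_finite by (rule le_less_trans)
qed

text \<open>
  The preimage of a box under an iterate is the box of the same diagonal that many steps below it. So
  all boxes of a diagonal have the same mass.
\<close>

lemma S_iter_box:
  assumes "\<And>i. i \<in> I \<Longrightarrow> b i + j < height n" and x: "x \<in> space (powX I)"
  shows "(S ^^ j) x \<in> tbox I n (\<lambda>i\<in>I. b i + j) \<longleftrightarrow> x \<in> tbox I n b"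
proof -
  have bj: "(\<lambda>i\<in>I. b i + j) i < height n" and b: "b i < height n" if "i \<in> I" for i
    using assms(1)[OF that] that by auto
  have xe: "x \<in> extensional I" using x by (simp add: space_powX_iff)
  have L: "(S ^^ j) x \<in> tbox I n (\<lambda>i\<in>I. b i + j) \<longleftrightarrow>
      (\<forall>i\<in>I. (chacon ^^ j) (x i) \<in> covered n \<and> pos n ((chacon ^^ j) (x i)) = b i + j)"
    using tbox_iff[of I "\<lambda>i\<in>I. b i + j" n, OF bj] chacon_pow_iter[OF xe] by simp
  have R: "x \<in> tbox I n b \<longleftrightarrow> (\<forall>i\<in>I. x i \<in> covered n \<and> pos n (x i) = b i)"
    using tbox_iff[of I b n, OF b] xe by simp
  show ?thesis
    unfolding L R using chacon_iter_level_iff[OF assms(1)] x by (auto simp: space_powX_iff)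
qed

text \<open>
  Each box of $C_n^I$ is reached from the bottom box of its diagonal in a unique number of steps. By
  invariance the integral over the box equals the integral, over the bottom box, of the translated
  function; adding up along a diagonal gives the integral over the bottom box of the sums of
  \<open>g\<close> over the crossings.
\<close>

lemma averaging:
  fixes g :: "('i \<Rightarrow> real) \<Rightarrow> real"
  assumes g: "g \<in> borel_measurable \<sigma>" and bd: "\<And>x. \<bar>g x\<bar> \<le> c"
    and pos: "\<And>x. x \<in> halves I n \<Longrightarrow> 0 \<le> sum g (crossing I n x)"
  shows "0 \<le> (\<integral>x. indicator (halves I n) x * g x \<partial>\<sigma>)"
proof -
  let ?G = "\<lambda>k x. indicator (tbox I n k) x * g x"
  \<comment> \<open>The diagonals are indexed by their bottom boxes; \<open>L b\<close> is the number of boxes of the diagonal of \<open>b\<close>.\<close>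
  define Bs where "Bs = {b \<in> half_index I n. \<exists>i\<in>I. b i = 0}"
  define L where "L b = height n div 2 - Max (b ` I)" for b :: "'i \<Rightarrow> nat"
  have Lp: "b i + j < height n div 2" if "j < L b" "i \<in> I" for b i j
  proof -
    have "b i \<le> Max (b ` I)" using that finite_I by auto
    then show ?thesis using that unfolding L_def by linarith
  qed
  have int: "integrable \<sigma> (\<lambda>x. indicator A x * g x)" if "A \<in> sets \<sigma>" "emeasure \<sigma> A < \<infinity>" for A
  proof -
    have "integrable \<sigma> (\<lambda>x. c * indicator A x)" using that by (intro integrable_mult_right) (auto simp: integrable_indicator_iff)
    moreover have "norm (indicator A x * g x) \<le> norm (c * indicator A x :: real)" for x
      using bd[of x] by (auto simp: indicator_def)
    ultimately show ?thesis
      using that g by (elim Bochner_Integration.integrable_bound) auto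
  qed
  have disj: "indicator (halves I n) x * g x = (\<Sum>k\<in>half_index I n. ?G k x)" for x
  proof (cases "x \<in> halves I n")
    case True
    have "(\<Sum>k\<in>half_index I n. ?G k x) = (\<Sum>k\<in>{posv I n x}. ?G k x)"
      using True finite_half_index[OF finite_I] posv_half_index[OF True]
      by (intro sum.mono_neutral_right) (auto simp: indicator_def half_tbox_iff)
    then show ?thesis using True in_tbox_posv[OF True] by simp
  next
    case False
    then have "?G k x = 0" if "k \<in> half_index I n" for k using half_tbox_iff[OF that] by (auto simp: indicator_def)
    then have "(\<Sum>k\<in>half_index I n. ?G k x) = 0" by (intro sum.neutral) blast
    then show ?thesis using False by simp
  qed
  have shiftk: "(\<integral>x. ?G (\<lambda>i\<in>I. b i + j) x \<partial>\<sigma>) = (\<integral>x. indicator (tbox I n b) x * g ((S ^^ j) x) \<partial>\<sigma>)"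
    and shifti: "integrable \<sigma> (\<lambda>x. indicator (tbox I n b) x * g ((S ^^ j) x))"
    if "b \<in> Bs" "j < L b" for b j
  proof -
    let ?k = "\<lambda>i\<in>I. b i + j"
    have k: "?k \<in> half_index I n" using Lp[OF that(2)] by (auto simp: half_index_def)
    have bh: "b i + j < height n" if "i \<in> I" for i using Lp[OF \<open>j < L b\<close> that] by linarith
    have m: "?G ?k \<in> borel_measurable \<sigma>" using g half_box_measurable[OF k] by measurable
    have eq: "?G ?k ((S ^^ j) x) = indicator (tbox I n b) x * g ((S ^^ j) x)" if "x \<in> space \<sigma>" for x
      using S_iter_box[of b j n x, OF bh] that space_\<sigma> by (auto simp: indicator_def)
    have "(\<integral>x. ?G ?k x \<partial>\<sigma>) = (\<integral>x. ?G ?k x \<partial>(distr \<sigma> \<sigma> (S ^^ j)))" by (simp add: distr_S_iter)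
    also have "\<dots> = (\<integral>x. ?G ?k ((S ^^ j) x) \<partial>\<sigma>)" by (rule integral_distr[OF S_iter_measurable m])
    also have "\<dots> = (\<integral>x. indicator (tbox I n b) x * g ((S ^^ j) x) \<partial>\<sigma>)"
      by (rule Bochner_Integration.integral_cong) (auto simp: eq)
    finally show "(\<integral>x. ?G ?k x \<partial>\<sigma>) = (\<integral>x. indicator (tbox I n b) x * g ((S ^^ j) x) \<partial>\<sigma>)" .
    have "integrable (distr \<sigma> \<sigma> (S ^^ j)) (?G ?k)"
      unfolding distr_S_iter by (intro int half_box_measurable half_box_finite k)
    then have "integrable \<sigma> (\<lambda>x. ?G ?k ((S ^^ j) x))"
      using integrable_distr_eq[OF S_iter_measurable m] by blast
    then show "integrable \<sigma> (\<lambda>x. indicator (tbox I n b) x * g ((S ^^ j) x))"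
      by (subst Bochner_Integration.integrable_cong[OF refl eq[symmetric]])
  qed
  have reindex: "(\<Sum>k\<in>half_index I n. F k) = (\<Sum>b\<in>Bs. \<Sum>j<L b. F (\<lambda>i\<in>I. b i + j))" for F :: "('i \<Rightarrow> nat) \<Rightarrow> real"
  proof -
    have finB: "finite Bs" unfolding Bs_def using finite_half_index[OF finite_I] by auto
    have "(\<Sum>b\<in>Bs. \<Sum>j<L b. F (\<lambda>i\<in>I. b i + j)) = (\<Sum>(b, j)\<in>Sigma Bs (\<lambda>b. {..<L b}). F (\<lambda>i\<in>I. b i + j))"
      using finB by (intro sum.Sigma) auto
    also have "\<dots> = (\<Sum>k\<in>half_index I n. F k)"
    proof (rule sum.reindex_bij_witness[where
          i = "\<lambda>k. (\<lambda>i\<in>I. k i - Min (k ` I), Min (k ` I))" and j = "\<lambda>(b, j). \<lambda>i\<in>I. b i + j"])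
      fix p assume p: "p \<in> Sigma Bs (\<lambda>b. {..<L b})"
      obtain b j where bj: "p = (b, j)" "b \<in> Bs" "j < L b" using p by auto
      obtain i0 where i0: "i0 \<in> I" "b i0 = 0" using bj(2) by (auto simp: Bs_def)
      have be: "b \<in> extensional I" using bj(2) by (auto simp: Bs_def half_index_def PiE_iff)
      have "Min ((\<lambda>i\<in>I. b i + j) ` I) = j"
        using i0 finite_I by (intro Min_eqI) (auto intro!: image_eqI[of _ _ i0])
      then show "(\<lambda>k. (\<lambda>i\<in>I. k i - Min (k ` I), Min (k ` I))) ((\<lambda>(b, j). \<lambda>i\<in>I. b i + j) p) = p"
        using be unfolding bj(1) by (auto simp: fun_eq_iff extensional_def)
      show "(\<lambda>(b, j). \<lambda>i\<in>I. b i + j) p \<in> half_index I n"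
        using Lp[OF bj(3)] unfolding bj(1) by (auto simp: half_index_def)
      show "F ((\<lambda>(b, j). \<lambda>i\<in>I. b i + j) p) = (case p of (b, j) \<Rightarrow> F (\<lambda>i\<in>I. b i + j))"
        unfolding bj(1) by simp
    next
      fix k assume k: "k \<in> half_index I n"
      let ?m = "Min (k ` I)" and ?b = "\<lambda>i\<in>I. k i - Min (k ` I)"
      have m: "?m \<le> k i" if "i \<in> I" for i using finite_I that by auto
      have ke: "k \<in> extensional I" using k by (auto simp: half_index_def PiE_iff)
      show "(\<lambda>(b, j). \<lambda>i\<in>I. b i + j) (?b, ?m) = k"
        using m ke by (auto simp: fun_eq_iff extensional_def)
      have "?m \<in> k ` I" using finite_I I_nonempty by (intro Min_in) auto
      then obtain i0 where i0: "i0 \<in> I" "k i0 = ?m" by auto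
      have "?b i < height n div 2" if "i \<in> I" for i using half_index_less[OF k that] that by simp
      then have "?b \<in> half_index I n" unfolding half_index_def by (simp add: PiE_iff)
      moreover have "?b i0 = 0" using i0 by simp
      ultimately have bB: "?b \<in> Bs" unfolding Bs_def using i0(1) by blast
      have "Max (?b ` I) \<in> ?b ` I" using finite_I I_nonempty by (intro Max_in) auto
      then obtain i1 where i1: "i1 \<in> I" "Max (?b ` I) = k i1 - ?m" by auto
      have "?m < L ?b" unfolding L_def i1(2) using half_index_less[OF k i1(1)] m[OF i1(1)] by linarith
      then show "(?b, ?m) \<in> Sigma Bs (\<lambda>b. {..<L b})" using bB by simp
    qed
    finally show ?thesis by simp
  qed
  have "(\<integral>x. indicator (halves I n) x * g x \<partial>\<sigma>) = (\<Sum>k\<in>half_index I n. (\<integral>x. ?G k x \<partial>\<sigma>))"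
    unfolding disj using half_box_measurable half_box_finite by (intro Bochner_Integration.integral_sum int) auto
  also have "\<dots> = (\<Sum>b\<in>Bs. \<Sum>j<L b. (\<integral>x. ?G (\<lambda>i\<in>I. b i + j) x \<partial>\<sigma>))" by (rule reindex)
  also have "\<dots> = (\<Sum>b\<in>Bs. \<Sum>j<L b. (\<integral>x. indicator (tbox I n b) x * g ((S ^^ j) x) \<partial>\<sigma>))"
    by (intro sum.cong refl shiftk) auto
  also have "\<dots> = (\<Sum>b\<in>Bs. (\<integral>x. (\<Sum>j<L b. indicator (tbox I n b) x * g ((S ^^ j) x)) \<partial>\<sigma>))"
    by (intro sum.cong refl Bochner_Integration.integral_sum[symmetric] shifti) auto
  finally have eq: "(\<integral>x. indicator (halves I n) x * g x \<partial>\<sigma>) =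
      (\<Sum>b\<in>Bs. (\<integral>x. (\<Sum>j<L b. indicator (tbox I n b) x * g ((S ^^ j) x)) \<partial>\<sigma>))" .
  show ?thesis unfolding eq
  proof (rule sum_nonneg, rule integral_nonneg_AE, rule AE_I2)
    fix b x assume b: "b \<in> Bs"
    show "0 \<le> (\<Sum>j<L b. indicator (tbox I n b) x * g ((S ^^ j) x))"
    proof (cases "x \<in> tbox I n b")
      case True
      have bh: "b \<in> half_index I n" using b by (simp add: Bs_def)
      have x: "x \<in> halves I n" "posv I n x = b" using half_tbox_iff[OF bh] True by auto
      obtain i0 where i0: "i0 \<in> I" "b i0 = 0" using b by (auto simp: Bs_def)
      then have "pos n (x i0) = 0" using x by (auto simp: posv_def)
      from crossing_from_bottom[OF x(1) finite_I i0(1) this]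
      have "(\<Sum>j<L b. g ((S ^^ j) x)) = sum g (crossing I n x)"
        unfolding L_def x(2) by (rule sum.reindex_bij_betw)
      then show ?thesis using pos[OF x(1)] True by simp
    qed simp
  qed
qed

end

section \<open>The ergodic theorem along crossings\<close>

lemma tbox_posv_eq:
  assumes "m \<le> p" "\<And>i. i \<in> I \<Longrightarrow> a i < height m" "y \<in> halves I p" "y' \<in> halves I p"
    "posv I p y = posv I p y'" "y \<in> tbox I m a"
  shows "y' \<in> tbox I m a"
proof -
  have "tbox I p (posv I p y) \<subseteq> tbox I m a"
    by (rule tbox_coarser[OF assms(1,2) _ assms(6) in_tbox_posv[OF assms(3)]])
      (use half_index_less_height[OF posv_half_index[OF assms(3)]] in auto)
  then show ?thesis using in_tbox_posv[OF assms(4)] assms(5) by auto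
qed

definition visits :: "'i set \<Rightarrow> nat \<Rightarrow> ('i \<Rightarrow> real) \<Rightarrow> ('i \<Rightarrow> real) set \<Rightarrow> real" where
  "visits I n x A = real (card (crossing I n x \<inter> A))"

lemma visits_nonneg: "0 \<le> visits I n x A"
  by (simp add: visits_def)

lemma visits_eq_sum: "finite I \<Longrightarrow> visits I n x A = sum (indicator A) (crossing I n x)"
  using finite_crossing[of I n x] by (simp add: visits_def indicator_def sum.If_cases)

lemma visits_mono: "finite I \<Longrightarrow> m \<le> n \<Longrightarrow> visits I m x A \<le> visits I n x A"
  unfolding visits_def using finite_crossing[of I n x] crossing_mono[of m n I x]
  by (intro of_nat_mono card_mono) auto

lemma visits_ge_1: "finite I \<Longrightarrow> x \<in> halves I n \<Longrightarrow> x \<in> A \<Longrightarrow> 1 \<le> visits I n x A"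
  unfolding visits_def using finite_crossing[of I n x] crossing_refl[of x I n]
  by (simp add: Suc_le_eq card_gt_0_iff) blast

context invariant_power
begin

text \<open>
  Within a crossing of order \<open>M\<close>, the crossings of orders between \<open>m\<close> and
  \<open>M\<close> with positive sums form a laminar family, whose union is the part of the crossing
  lying in the set in question. So all sums of \<open>f\<close> restricted to that set over crossings
  of order \<open>M\<close> are nonnegative, and \<open>averaging\<close> applies.
\<close>

lemma maximal_inequality:
  fixes f :: "('i \<Rightarrow> real) \<Rightarrow> real"
  assumes f: "f \<in> borel_measurable \<sigma>" and bd: "\<And>x. \<bar>f x\<bar> \<le> c"
    and step: "\<And>n y y'. m \<le> n \<Longrightarrow> y \<in> halves I n \<Longrightarrow> y' \<in> halves I n \<Longrightarrow> posv I n y = posv I n y' \<Longrightarrow> f y = f y'"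
  shows "{x \<in> halves I M. \<exists>n\<in>{m..M}. 0 < sum f (crossing I n x)} \<in> sets \<sigma>" (is "?D \<in> _")
    and "0 \<le> (\<integral>x. indicator {x \<in> halves I M. \<exists>n\<in>{m..M}. 0 < sum f (crossing I n x)} x * f x \<partial>\<sigma>)"
proof -
  have pos_set: "{x \<in> halves I n. 0 < sum f (crossing I n x)} \<in> sets \<sigma>" if "m \<le> n" for n
    unfolding sets_\<sigma>
    by (rule box_invariant_sets[OF finite_I]) (use crossing_sum_box[of _ I n _ f] step[OF that] in metis)
  have "?D = halves I M \<inter> (\<Union>n\<in>{m..M}. {x \<in> halves I n. 0 < sum f (crossing I n x)})"
  proof (intro equalityI subsetI)
    fix x assume "x \<in> ?D"
    then obtain n where n: "x \<in> halves I M" "n \<in> {m..M}" "0 < sum f (crossing I n x)" by blast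
    then have "crossing I n x \<noteq> {}" by auto
    then have "x \<in> halves I n" using crossing_halves by blast
    then show "x \<in> halves I M \<inter> (\<Union>n\<in>{m..M}. {x \<in> halves I n. 0 < sum f (crossing I n x)})" using n by blast
  qed auto
  also have "\<dots> \<in> sets \<sigma>" using pos_set halves_measurable by (intro sets.Int sets.finite_UN) auto
  finally show D: "?D \<in> sets \<sigma>" .
  have "0 \<le> (\<integral>x. indicator (halves I M) x * (indicator ?D x * f x) \<partial>\<sigma>)"
  proof (rule averaging)
    show "(\<lambda>x. indicator ?D x * f x) \<in> borel_measurable \<sigma>" using D f by measurable
    have "0 \<le> c" using bd[of undefined] by simp
    then show "\<bar>indicator ?D x * f x\<bar> \<le> c" for x using bd[of x] by (auto simp: indicator_def)
    fix x assume x: "x \<in> halves I M"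
    let ?Q = "crossing I M x"
    let ?U = "(\<lambda>(n, y). crossing I n y) ` {(n, y) \<in> {m..M} \<times> ?Q. 0 < sum f (crossing I n y)}"
    have finQ: "finite ?Q" by (rule finite_crossing[OF finite_I])
    have eq: "\<Union>?U = ?Q \<inter> ?D"
    proof (intro equalityI subsetI)
      fix w assume "w \<in> \<Union>?U"
      then obtain n y where n: "n \<in> {m..M}" "y \<in> ?Q" "0 < sum f (crossing I n y)" "w \<in> crossing I n y" by auto
      have "w \<in> crossing I M y" using crossing_mono[of n M I y] n by auto
      then have wQ: "w \<in> ?Q" using crossing_eq[OF n(2)] by simp
      moreover have "0 < sum f (crossing I n w)" using n crossing_eq[OF n(4)] by simp
      ultimately show "w \<in> ?Q \<inter> ?D" using n(1) crossing_halves(1)[OF wQ] by blast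
    next
      fix w assume w: "w \<in> ?Q \<inter> ?D"
      then obtain n where n: "n \<in> {m..M}" "0 < sum f (crossing I n w)" by blast
      then have "crossing I n w \<noteq> {}" by auto
      then have "w \<in> halves I n" using crossing_halves by blast
      then have "w \<in> crossing I n w" by (rule crossing_refl)
      then show "w \<in> \<Union>?U" using n w by auto
    qed
    have "(\<Sum>y\<in>?Q. indicator ?D y * f y) = sum f (?Q \<inter> ?D)"
      using finQ by (simp add: indicator_def sum.If_cases if_distrib[where f = "\<lambda>z. z * _"] cong: if_cong)
    also have "\<dots> = sum f (\<Union>?U)" using eq by simp
    finally have sum_eq: "(\<Sum>y\<in>?Q. indicator ?D y * f y) = sum f (\<Union>?U)" .
    have "0 \<le> sum f (\<Union>?U)"
    proof (rule laminar_sum_nonneg)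
      have "finite {(n, y) \<in> {m..M} \<times> ?Q. 0 < sum f (crossing I n y)}"
        by (rule finite_subset[of _ "{m..M} \<times> ?Q"]) (use finQ in auto)
      then show "finite ?U" by (rule finite_imageI)
      show "finite U" if "U \<in> ?U" for U using that finite_crossing[OF finite_I] by auto
      show "0 \<le> sum f U" if "U \<in> ?U" for U using that by auto
      have lam: "crossing I n y \<inter> crossing I n' y' = {} \<or> crossing I n y \<subseteq> crossing I n' y'" if "n \<le> n'" for n n' y y'
      proof (cases "crossing I n y \<inter> crossing I n' y' = {}")
        case False
        then obtain w where "w \<in> crossing I n y" "w \<in> crossing I n' y'" by blast
        then show ?thesis using crossing_eq[of w I n y] crossing_eq[of w I n' y'] crossing_mono[OF that, of I w] by auto
      qed simp
      fix U V assume "U \<in> ?U" "V \<in> ?U"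
      then obtain n y n' y' where "U = crossing I n y" "V = crossing I n' y'" by auto
      then show "U \<inter> V = {} \<or> U \<subseteq> V \<or> V \<subseteq> U"
        using lam[of n n' y y'] lam[of n' n y' y] linear[of n n'] by (auto simp: Int_commute)
    qed
    then show "0 \<le> (\<Sum>y\<in>?Q. indicator ?D y * f y)" using sum_eq by simp
  qed
  also have "(\<integral>x. indicator (halves I M) x * (indicator ?D x * f x) \<partial>\<sigma>) = (\<integral>x. indicator ?D x * f x \<partial>\<sigma>)"
    by (rule Bochner_Integration.integral_cong) (auto simp: indicator_def)
  finally show "0 \<le> (\<integral>x. indicator ?D x * f x \<partial>\<sigma>)" .
qed

lemma eventually_crossing_S:
  assumes "x \<in> space \<sigma>"
  shows "eventually (\<lambda>n. crossing I n (S x) = crossing I n x) sequentially"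
  using eventually_halves[OF finite_I, of x 1] assms unfolding space_\<sigma>
proof (simp, elim eventually_mono)
  fix n assume "x \<in> halves I n \<and> (\<forall>i\<in>I. Suc (pos n (x i)) < height n div 2)"
  then have "(S ^^ 1) x \<in> crossing I n x" by (intro chacon_pow_iter_crossing) auto
  then show "crossing I n (S x) = crossing I n x" using crossing_eq[of "S x" I n x] by simp
qed

end

locale ergodic_power = invariant_power I \<sigma> for I :: "'i set" and \<sigma> +
  assumes erg: "ergodic \<sigma> (chacon_pow I)"
begin

text \<open>
  The set where the sums are positive infinitely often is invariant, since \<open>x\<close> and its
  image eventually have the same crossings. If it had full measure, the sets of the maximal inequality
  would exhaust the space and the integral of \<open>f\<close> would be nonnegative.
\<close>

lemma eventually_nonpos:
  fixes f :: "('i \<Rightarrow> real) \<Rightarrow> real"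
  assumes f: "f \<in> borel_measurable \<sigma>" and bd: "\<And>x. \<bar>f x\<bar> \<le> c"
    and step: "\<And>n y y'. m \<le> n \<Longrightarrow> y \<in> halves I n \<Longrightarrow> y' \<in> halves I n \<Longrightarrow> posv I n y = posv I n y' \<Longrightarrow> f y = f y'"
    and supp: "\<And>x. x \<notin> halves I m \<Longrightarrow> f x = 0"
    and neg: "(\<integral>x. f x \<partial>\<sigma>) < 0"
  shows "AE x in \<sigma>. eventually (\<lambda>n. sum f (crossing I n x) \<le> 0) sequentially"
proof -
  let ?P = "\<lambda>n. {x \<in> halves I n. 0 < sum f (crossing I n x)}"
  define A where "A = (\<Inter>N. \<Union>n\<in>{max N m..}. ?P n)"
  let ?D = "\<lambda>M. {x \<in> halves I M. \<exists>n\<in>{m..M}. 0 < sum f (crossing I n x)}"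
  have pos_set: "?P n \<in> sets \<sigma>" if "m \<le> n" for n
    unfolding sets_\<sigma>
    by (rule box_invariant_sets[OF finite_I]) (use crossing_sum_box[of _ I n _ f] step[OF that] in metis)
  have "(\<Union>n\<in>{max N m..}. ?P n) \<in> sets \<sigma>" for N
    using pos_set by (intro sets.countable_UN') auto
  then have A_sets: "A \<in> sets \<sigma>" unfolding A_def by (intro sets.countable_INT) auto
  have sub: "?P n \<subseteq> space \<sigma>" for n using halves_space space_\<sigma> by auto
  then have A_sub: "A \<subseteq> space \<sigma>" unfolding A_def by blast
  have A_iff: "x \<in> A \<longleftrightarrow> (\<exists>\<^sub>\<infinity>n. 0 < sum f (crossing I n x))" for x
  proof -
    have "x \<in> halves I n" if "0 < sum f (crossing I n x)" for n
    proof -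
      have "crossing I n x \<noteq> {}" using that by auto
      then show ?thesis using crossing_halves by blast
    qed
    then have "x \<in> A \<longleftrightarrow> (\<forall>N. \<exists>n\<ge>max N m. 0 < sum f (crossing I n x))"
      unfolding A_def by (simp add: Bex_def) blast
    also have "\<dots> \<longleftrightarrow> (\<exists>\<^sub>\<infinity>n. 0 < sum f (crossing I n x))"
      unfolding INFM_nat_le by (meson max.bounded_iff order_refl max.cobounded1)
    finally show ?thesis .
  qed
  have inv: "S -` A \<inter> space \<sigma> = A"
  proof -
    have "S x \<in> A \<longleftrightarrow> x \<in> A" if x: "x \<in> space \<sigma>" for x
    proof -
      have "eventually (\<lambda>n. (0 < sum f (crossing I n (S x))) = (0 < sum f (crossing I n x))) sequentially"
        using eventually_crossing_S[OF x] by eventually_elim simp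
      then have "eventually (\<lambda>n. (\<not> 0 < sum f (crossing I n (S x))) = (\<not> 0 < sum f (crossing I n x))) sequentially"
        by (rule eventually_mono) simp
      then show ?thesis unfolding A_iff cofinite_eq_sequentially frequently_def
        using eventually_subst by fast
    qed
    then show ?thesis using A_sub by auto
  qed
  have "emeasure \<sigma> (space \<sigma> - A) \<noteq> 0"
  proof
    assume "emeasure \<sigma> (space \<sigma> - A) = 0"
    then have AE_A: "AE x in \<sigma>. x \<in> A" using A_sets by (intro AE_I[of _ _ "space \<sigma> - A"]) auto
    have c0: "0 \<le> c" using bd[of undefined] by simp
    have int: "integrable \<sigma> f"
    proof -
      have "integrable \<sigma> (\<lambda>x. c * indicator (halves I m) x)"
        using halves_measurable emeasure_halves_finite by (intro integrable_mult_right) (auto simp: integrable_indicator_iff)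
      moreover have "norm (f x) \<le> norm (c * indicator (halves I m) x :: real)" for x
        using bd[of x] supp[of x] by (auto simp: indicator_def)
      ultimately show ?thesis using f by (elim Bochner_Integration.integrable_bound) auto
    qed
    have "(\<lambda>M. \<integral>x. indicator (?D M) x * f x \<partial>\<sigma>) \<longlonglongrightarrow> (\<integral>x. f x \<partial>\<sigma>)"
    proof (rule integral_dominated_convergence[where w = "\<lambda>x. \<bar>f x\<bar>"])
      show "(\<lambda>x. indicator (?D M) x * f x) \<in> borel_measurable \<sigma>" for M
        using maximal_inequality(1)[where m = m and M = M, OF f bd step] f by measurable
      show "AE x in \<sigma>. (\<lambda>M. indicator (?D M) x * f x) \<longlonglongrightarrow> f x"
        using AE_A
      proof eventually_elim
        case (elim x)
        then obtain n where n: "n \<ge> m" "x \<in> ?P n" unfolding A_def by (auto dest: spec[of _ 0])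
        have "x \<in> ?D M" if "M \<ge> n" for M using n halves_mono[OF that, of I] that by auto
        then have "eventually (\<lambda>M. indicator (?D M) x * f x = f x) sequentially"
          unfolding eventually_sequentially by (intro exI[of _ n]) auto
        then show ?case by (rule tendsto_eventually)
      qed
      show "AE x in \<sigma>. norm (indicator (?D M) x * f x) \<le> \<bar>f x\<bar>" for M by (auto simp: indicator_def)
    qed (use f int in auto)
    then have "0 \<le> (\<integral>x. f x \<partial>\<sigma>)"
      using maximal_inequality(2)[where m = m, OF f bd step] by (intro LIMSEQ_le_const) auto
    then show False using neg by simp
  qed
  then have "emeasure \<sigma> A = 0" using erg A_sets inv unfolding ergodic_def by blast
  then have "AE x in \<sigma>. x \<notin> A" using A_sets by (intro AE_I[of _ _ A]) auto
  then show ?thesis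
    unfolding A_iff by (rule AE_mp) (auto simp: frequently_def not_less cofinite_eq_sequentially)
qed

text \<open>
  The last clause is \<open>eventually_nonpos\<close> for the functions $1_A - q 1_B$; rational
  \<open>q\<close> keeps the number of exceptional null sets countable.
\<close>

definition generic :: "('i \<Rightarrow> real) \<Rightarrow> bool" where
  "generic x \<longleftrightarrow> x \<in> space \<sigma> \<and> (\<forall>i\<in>I. x i \<noteq> 0) \<and>
     (\<forall>n. \<forall>k\<in>half_index I n. x \<in> tbox I n k \<longrightarrow> 0 < measure \<sigma> (tbox I n k)) \<and>
     (\<forall>m n. \<forall>a\<in>half_index I m. \<forall>b\<in>half_index I n. \<forall>q::rat.
        measure \<sigma> (tbox I m a) < of_rat q * measure \<sigma> (tbox I n b) \<longrightarrow>
        eventually (\<lambda>p. visits I p x (tbox I m a) \<le> of_rat q * visits I p x (tbox I n b)) sequentially)"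

text \<open>
  The points with a coordinate equal to 0 have no preimage, and a set has the same mass as its
  preimage.
\<close>

lemma AE_nonzero:
  assumes "i \<in> I" shows "AE x in \<sigma>. x i \<noteq> 0"
proof -
  let ?Z = "{x \<in> space \<sigma>. x i = 0}"
  have Z: "?Z \<in> sets \<sigma>"
  proof -
    have "(\<lambda>x. x i) -` {0} \<inter> space (powX I) \<in> sets (powX I)"
      using measurable_sets[OF component_measurable[OF assms], of "{0}"] by (auto simp: sets_halfline_iff)
    moreover have "(\<lambda>x. x i) -` {0} \<inter> space (powX I) = ?Z" using space_\<sigma> by auto
    ultimately show ?thesis using sets_\<sigma> by simp
  qed
  have "S -` ?Z \<inter> space \<sigma> = {}"
  proof -
    have "S x i \<noteq> 0" if "x \<in> space \<sigma>" for x
      using that assms chacon_positive[of "x i"] by (simp add: chacon_pow_def space_\<sigma> space_powX_iff)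
    then show ?thesis by auto
  qed
  then have "emeasure \<sigma> ?Z = 0" using emeasure_S_iter[OF Z, of 1] by simp
  then show ?thesis using Z by (intro AE_I[of _ _ ?Z]) auto
qed

lemma AE_generic: "AE x in \<sigma>. generic x"
proof -
  have 1: "AE x in \<sigma>. \<forall>i\<in>I. x i \<noteq> 0"
    by (rule AE_finite_allI[OF finite_I AE_nonzero])
  have 2: "AE x in \<sigma>. \<forall>n. \<forall>k\<in>half_index I n. x \<in> tbox I n k \<longrightarrow> 0 < measure \<sigma> (tbox I n k)"
  proof (intro AE_all_countable[THEN iffD2] allI AE_finite_allI finite_half_index finite_I)
    fix n k assume k: "k \<in> half_index I n"
    show "AE x in \<sigma>. x \<in> tbox I n k \<longrightarrow> 0 < measure \<sigma> (tbox I n k)"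
    proof (cases "measure \<sigma> (tbox I n k) = 0")
      case True
      then have "emeasure \<sigma> (tbox I n k) = 0"
        using half_box_finite[OF k] by (simp add: emeasure_eq_ennreal_measure)
      then show ?thesis using half_box_measurable[OF k] by (intro AE_I[of _ _ "tbox I n k"]) auto
    next
      case False
      then show ?thesis by (simp add: zero_less_measure_iff)
    qed
  qed
  have 3: "AE x in \<sigma>. \<forall>m n. \<forall>a\<in>half_index I m. \<forall>b\<in>half_index I n. \<forall>q::rat.
        measure \<sigma> (tbox I m a) < of_rat q * measure \<sigma> (tbox I n b) \<longrightarrow>
        eventually (\<lambda>p. visits I p x (tbox I m a) \<le> of_rat q * visits I p x (tbox I n b)) sequentially"
  proof (intro AE_all_countable[THEN iffD2] allI AE_finite_allI finite_half_index finite_I)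
    fix m n a b and q :: rat
    assume a: "a \<in> half_index I m" and b: "b \<in> half_index I n"
    let ?A = "tbox I m a" and ?B = "tbox I n b" and ?q = "of_rat q :: real"
    let ?f = "\<lambda>x. indicator ?A x - ?q * indicator ?B x :: real"
    note mA = half_box_measurable[OF a] and mB = half_box_measurable[OF b]
    show "AE x in \<sigma>. measure \<sigma> ?A < ?q * measure \<sigma> ?B \<longrightarrow>
        eventually (\<lambda>p. visits I p x ?A \<le> ?q * visits I p x ?B) sequentially"
    proof (cases "measure \<sigma> ?A < ?q * measure \<sigma> ?B")
      case True
      have "AE x in \<sigma>. eventually (\<lambda>p. sum ?f (crossing I p x) \<le> 0) sequentially"
      proof (rule eventually_nonpos[where m = "max m n" and c = "1 + \<bar>?q\<bar>"])
        show "?f \<in> borel_measurable \<sigma>" using mA mB by measurable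
        show "\<bar>?f x\<bar> \<le> 1 + \<bar>?q\<bar>" for x
          using abs_triangle_ineq4[of 1 ?q] by (auto simp: indicator_def simp del: abs_of_rat)
        show "?f y = ?f y'" if "max m n \<le> p" "y \<in> halves I p" "y' \<in> halves I p" "posv I p y = posv I p y'" for p y y'
        proof -
          have "y \<in> ?A \<longleftrightarrow> y' \<in> ?A"
            using tbox_posv_eq[of m p I a y y'] tbox_posv_eq[of m p I a y' y] half_index_less_height[OF a] that by auto
          moreover have "y \<in> ?B \<longleftrightarrow> y' \<in> ?B"
            using tbox_posv_eq[of n p I b y y'] tbox_posv_eq[of n p I b y' y] half_index_less_height[OF b] that by auto
          ultimately show ?thesis by (simp add: indicator_def)
        qed
        show "?f x = 0" if "x \<notin> halves I (max m n)" for x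
        proof -
          have "x \<notin> ?A" "x \<notin> ?B"
            using that half_tbox_iff[OF a, of x] half_tbox_iff[OF b, of x]
              halves_mono[of m "max m n" I] halves_mono[of n "max m n" I] by auto
          then show ?thesis by simp
        qed
        have "(\<integral>x. ?f x \<partial>\<sigma>) = measure \<sigma> ?A - ?q * measure \<sigma> ?B"
          using mA mB half_box_finite[OF a] half_box_finite[OF b] sets.sets_into_space[OF mA] sets.sets_into_space[OF mB]
          by (subst Bochner_Integration.integral_diff) (auto simp: integrable_indicator_iff Int_absorb2)
        then show "(\<integral>x. ?f x \<partial>\<sigma>) < 0" using True by simp
      qed
      then show ?thesis
        by (rule AE_mp) (simp add: visits_eq_sum[OF finite_I] sum_subtractf sum_distrib_left)
    qed simp
  qed
  show ?thesis using 1 2 3 AE_space by eventually_elim (simp add: generic_def)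
qed

lemma generic_space: "generic x \<Longrightarrow> x \<in> space \<sigma>"
  by (simp add: generic_def)

lemma generic_box_pos: "generic x \<Longrightarrow> x \<in> halves I n \<Longrightarrow> 0 < measure \<sigma> (tbox I n (posv I n x))"
  unfolding generic_def using posv_half_index in_tbox_posv by blast

text \<open>
  The ratio inequality bounds the visits to \<open>B\<close> below by those to a box containing
  \<open>x\<close>.
\<close>

lemma generic_visits_pos:
  assumes x: "generic x" and b: "b \<in> half_index I n" and pos: "0 < measure \<sigma> (tbox I n b)"
  shows "eventually (\<lambda>p. 0 < visits I p x (tbox I n b)) sequentially"
proof -
  obtain m where m: "x \<in> halves I m"
    using ex_halves[OF finite_I] generic_space[OF x] space_\<sigma> by blast
  let ?A = "tbox I m (posv I m x)"
  obtain q where q: "of_nat q * measure \<sigma> (tbox I n b) > measure \<sigma> ?A"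
    using reals_Archimedean3[OF pos] by blast
  then have "measure \<sigma> ?A < of_rat (of_nat q) * measure \<sigma> (tbox I n b)" by (simp add: of_rat_of_nat_eq)
  then have "eventually (\<lambda>p. visits I p x ?A \<le> of_rat (of_nat q) * visits I p x (tbox I n b)) sequentially"
    using x b posv_half_index[OF m] unfolding generic_def by blast
  with eventually_ge_at_top[of m] show ?thesis
  proof eventually_elim
    case (elim p)
    have "1 \<le> visits I p x ?A" using halves_mono[OF elim(1), of I] m in_tbox_posv[OF m]
      by (intro visits_ge_1 finite_I) auto
    then have "0 < of_nat q * visits I p x (tbox I n b)" using elim(2) by (simp add: of_rat_of_nat_eq)
    then show ?case using visits_nonneg[of I p x "tbox I n b"] by (simp add: zero_less_mult_iff)
  qed
qed

lemma generic_ratio: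
  assumes x: "generic x" and a: "a \<in> half_index I m" and b: "b \<in> half_index I n"
    and pos: "0 < measure \<sigma> (tbox I n b)"
  shows "(\<lambda>p. visits I p x (tbox I m a) / visits I p x (tbox I n b)) \<longlonglongrightarrow>
      measure \<sigma> (tbox I m a) / measure \<sigma> (tbox I n b)"
proof (rule order_tendstoI)
  let ?A = "tbox I m a" and ?B = "tbox I n b"
  note evB = generic_visits_pos[OF x b pos]
  fix y assume y: "measure \<sigma> ?A / measure \<sigma> ?B < y"
  obtain q where q: "measure \<sigma> ?A / measure \<sigma> ?B < of_rat q" "of_rat q < y"
    using of_rat_dense[OF y] by blast
  have "measure \<sigma> ?A < of_rat q * measure \<sigma> ?B" using q(1) pos by (simp add: field_simps)
  then have "eventually (\<lambda>p. visits I p x ?A \<le> of_rat q * visits I p x ?B) sequentially"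
    using x a b unfolding generic_def by blast
  with evB show "eventually (\<lambda>p. visits I p x ?A / visits I p x ?B < y) sequentially"
  proof eventually_elim
    case (elim p)
    then have "visits I p x ?A / visits I p x ?B \<le> of_rat q" by (simp add: field_simps)
    then show ?case using q(2) by simp
  qed
next
  let ?A = "tbox I m a" and ?B = "tbox I n b"
  note evB = generic_visits_pos[OF x b pos]
  fix y assume y: "y < measure \<sigma> ?A / measure \<sigma> ?B"
  show "eventually (\<lambda>p. y < visits I p x ?A / visits I p x ?B) sequentially"
  proof (cases "y < 0")
    case True
    then show ?thesis using visits_nonneg[of I _ x ?A] visits_nonneg[of I _ x ?B]
      by (intro always_eventually allI) (meson divide_nonneg_nonneg less_le_trans)
  next
    case False
    obtain q where q: "y < of_rat q" "of_rat q < measure \<sigma> ?A / measure \<sigma> ?B"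
      using of_rat_dense[OF y] by blast
    have q0: "0 < (of_rat q :: real)" using False q(1) by linarith
    have "measure \<sigma> ?B < of_rat (1 / q) * measure \<sigma> ?A"
      using q(2) pos q0 by (simp add: of_rat_divide field_simps)
    then have "eventually (\<lambda>p. visits I p x ?B \<le> of_rat (1 / q) * visits I p x ?A) sequentially"
      using x a b unfolding generic_def by blast
    with evB show ?thesis
    proof eventually_elim
      case (elim p)
      then have "of_rat q \<le> visits I p x ?A / visits I p x ?B" using q0 by (simp add: of_rat_divide field_simps)
      then show ?case using q(1) by simp
    qed
  qed
qed

end

section \<open>Crossings inside a crossing of the next order\<close>

lemma copy_start_values:
  "copy_start n 0 = 0" "copy_start n (Suc 0) = height n" "copy_start n 2 = 2 * height n + 1" "copy_start n (Suc (Suc 0)) = 2 * height n + 1"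
  by (auto simp: copy_start_def)

text \<open>
  The copies of tower \<open>n\<close> start at least $h_n$ apart. In $C_n$ positions differ by less
  than $h_n / 2$, so comparing two coordinates leaves an ambiguity smaller than $h_n$ and determines
  the digits.
\<close>

lemma copy_gap:
  assumes "s < 3" "t < 3" "\<bar>int (copy_start n s) - int (copy_start n t)\<bar> < int (height n)"
  shows "s = t"
proof -
  have "s = 0 \<or> s = 1 \<or> s = 2" "t = 0 \<or> t = 1 \<or> t = 2" using assms by auto
  then show ?thesis using assms(3) by (auto simp: copy_start_values)
qed

lemma half_distance:
  fixes a b h :: nat
  assumes "a < h div 2" "b < h div 2" shows "2 * \<bar>int a - int b\<bar> < int h"
  using assms by (auto simp: abs_if)

lemma displacement_bound:
  fixes p q c d z h :: int
  assumes "p + c = q + c0 + z" "p' + d = q' + d0 + z" "2 * \<bar>p - q\<bar> < h" "2 * \<bar>p' - q'\<bar> < h"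
  shows "\<bar>c - c0 - (d - d0)\<bar> < h"
  using assms by (simp add: abs_if split: if_splits)

lemma displacement_small:
  fixes p q c d z h :: int
  assumes "2 * \<bar>p - q\<bar> < h" "p + c = q + z" "0 \<le> c" "2 * \<bar>p' - q'\<bar> < h" "p' + d = q' + d0 + z" "d \<le> d0"
  shows "2 * \<bar>z\<bar> < h"
  using assms by (simp add: abs_if split: if_splits)

lemma displacement_bound':
  fixes p q c c0 z h :: int
  assumes "p + c = q + c0 + z" "2 * \<bar>p - q\<bar> < h" "2 * \<bar>z\<bar> < h"
  shows "\<bar>c - c0\<bar> < h"
  using assms by (simp add: abs_if split: if_splits)

text \<open>
  The two situations in which all crossings of order \<open>n\<close> within the crossing of order
  \<open>n + 1\<close> of \<open>x\<close> lie on the same diagonal.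
\<close>

definition single_diagonal_step :: "'i set \<Rightarrow> nat \<Rightarrow> ('i \<Rightarrow> real) \<Rightarrow> bool" where
  "single_diagonal_step I n x \<longleftrightarrow> (\<forall>i\<in>I. \<forall>j\<in>I. digit n (x i) = digit n (x j)) \<or>
     ((\<exists>i\<in>I. digit n (x i) = 0) \<and> (\<exists>i\<in>I. digit n (x i) = 2))"

lemma crossing_Suc_cases:
  assumes y: "y \<in> crossing I (Suc n) x" and yh: "y \<in> halves I n" and xh: "x \<in> halves I n"
  obtains z where "\<And>i. i \<in> I \<Longrightarrow> int (pos n (y i)) + int (copy_start n (digit n (y i)))
      = int (pos n (x i)) + int (copy_start n (digit n (x i))) + z"
    "\<And>i. i \<in> I \<Longrightarrow> offset (Suc n) (y i) = offset (Suc n) (x i)"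
    "\<And>i. i \<in> I \<Longrightarrow> digit n (y i) < 3" "\<And>i. i \<in> I \<Longrightarrow> digit n (x i) < 3"
    "\<And>i. i \<in> I \<Longrightarrow> 2 * \<bar>int (pos n (y i)) - int (pos n (x i))\<bar> < int (height n)"
proof -
  obtain z where z: "\<And>i. i \<in> I \<Longrightarrow> offset (Suc n) (y i) = offset (Suc n) (x i)"
    "\<And>i. i \<in> I \<Longrightarrow> int (pos (Suc n) (y i)) = int (pos (Suc n) (x i)) + z" using y by (rule crossingE) blast
  show thesis
  proof (rule that[of z])
    fix i assume i: "i \<in> I"
    note cy = halves_covered[OF yh i] and cx = halves_covered[OF xh i]
    show "int (pos n (y i)) + int (copy_start n (digit n (y i)))
      = int (pos n (x i)) + int (copy_start n (digit n (x i))) + z"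
      using z(2)[OF i] by (simp add: pos_Suc[OF cy] pos_Suc[OF cx])
    show "digit n (y i) < 3" "digit n (x i) < 3" by (rule digit_less[OF cy], rule digit_less[OF cx])
    have "pos n (y i) < height n div 2" "pos n (x i) < height n div 2"
      using xh yh i by (auto simp: halves_iff)
    then show "2 * \<bar>int (pos n (y i)) - int (pos n (x i))\<bar> < int (height n)"
      by (rule half_distance)
  qed (rule z(1))
qed

text \<open>
  Equal digits stay equal along the crossing of order \<open>n + 1\<close>, so that all coordinates
  have moved by the same amount inside their copies. If 0 and 2 both occur, the coordinate in the
  first copy bounds the displacement \<open>z\<close> from below and the one in the third copy bounds
  it from above, by $h_n / 2$; then no coordinate can change its copy.
\<close>

lemma single_diagonal_step:
  assumes step: "single_diagonal_step I n x" and y: "y \<in> crossing I (Suc n) x"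
    and yh: "y \<in> halves I n" and xh: "x \<in> halves I n"
  shows "\<exists>z. \<forall>i\<in>I. int (pos n (y i)) = int (pos n (x i)) + z"
proof -
  obtain z where eq: "\<And>i. i \<in> I \<Longrightarrow> int (pos n (y i)) + int (copy_start n (digit n (y i)))
      = int (pos n (x i)) + int (copy_start n (digit n (x i))) + z"
    and dy: "\<And>i. i \<in> I \<Longrightarrow> digit n (y i) < 3" and dx: "\<And>i. i \<in> I \<Longrightarrow> digit n (x i) < 3"
    and e: "\<And>i. i \<in> I \<Longrightarrow> 2 * \<bar>int (pos n (y i)) - int (pos n (x i))\<bar> < int (height n)"
    using crossing_Suc_cases[OF y yh xh] by metis
  from step show ?thesis unfolding single_diagonal_step_def
  proof
    assume const: "\<forall>i\<in>I. \<forall>j\<in>I. digit n (x i) = digit n (x j)"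
    show ?thesis
    proof (cases "I = {}")
      case False
      then obtain j where j: "j \<in> I" by blast
      have "int (pos n (y i)) = int (pos n (x i)) + (int (pos n (y j)) - int (pos n (x j)))" if i: "i \<in> I" for i
      proof -
        have c: "digit n (x i) = digit n (x j)" using const i j by blast
        have "\<bar>int (copy_start n (digit n (y i))) - int (copy_start n (digit n (y j)))\<bar> < int (height n)"
          using displacement_bound[OF eq[OF i] eq[OF j] e[OF i] e[OF j]] by (simp add: c)
        from copy_gap[OF dy[OF i] dy[OF j] this] show ?thesis using eq[OF i] eq[OF j] c by simp
      qed
      then show ?thesis by blast
    qed simp
  next
    assume "(\<exists>i\<in>I. digit n (x i) = 0) \<and> (\<exists>i\<in>I. digit n (x i) = 2)"
    then obtain i0 i2 where i: "i0 \<in> I" "digit n (x i0) = 0" "i2 \<in> I" "digit n (x i2) = 2" by blast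
    have "copy_start n (digit n (y i2)) \<le> 2 * height n + 1" by (simp add: copy_start_def)
    then have z: "2 * \<bar>z\<bar> < int (height n)"
      using eq[OF i(1)] eq[OF i(3)] i(2,4)
      by (intro displacement_small[OF e[OF i(1)] _ _ e[OF i(3)],
          of "int (copy_start n (digit n (y i0)))" _ "int (copy_start n (digit n (y i2)))" "2 * int (height n) + 1"])
        (simp_all add: copy_start_values)
    have "int (pos n (y i)) = int (pos n (x i)) + z" if i: "i \<in> I" for i
    proof -
      have "\<bar>int (copy_start n (digit n (y i))) - int (copy_start n (digit n (x i)))\<bar> < int (height n)"
        by (rule displacement_bound'[OF eq[OF i] e[OF i] z])
      from copy_gap[OF dy[OF i] dx[OF i] this] show ?thesis using eq[OF i] by simp
    qed
    then show ?thesis by blast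
  qed
qed

text \<open>
  Induction on the order of the larger crossing. A point of it may have offsets different from those
  of \<open>x\<close>; replacing them by the offsets of \<open>x\<close> gives a point of the previous
  crossing in the same boxes.
\<close>

lemma single_diagonal:
  assumes n: "n \<le> m" and x: "\<And>p. n \<le> p \<Longrightarrow> x \<in> halves I p \<and> single_diagonal_step I p x"
    and y: "y \<in> crossing I m x" "y \<in> halves I n"
  shows "\<exists>z. \<forall>i\<in>I. int (pos n (y i)) = int (pos n (x i)) + z"
  using n y
proof (induction m arbitrary: y rule: dec_induct)
  case base
  then show ?case by (elim crossingE) blast
next
  case (step m)
  have ym: "y \<in> halves I m" using step.prems(2) halves_mono[OF step.hyps(1), of I] by auto
  have xm: "x \<in> halves I m" using x step.hyps by auto
  obtain z where z: "\<forall>i\<in>I. int (pos m (y i)) = int (pos m (x i)) + z"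
    using single_diagonal_step[of I m x y] x[of m] step.hyps(1) step.prems(1) ym xm by blast
  define w where "w = (\<lambda>i\<in>I. tower m ! pos m (y i) + offset m (x i))"
  have w: "w i \<in> covered m" "pos m (w i) = pos m (y i)" "offset m (w i) = offset m (x i)" if i: "i \<in> I" for i
  proof -
    note c = pos_less[OF halves_covered[OF ym i]] offset_bounds[OF halves_covered[OF xm i]]
    show "w i \<in> covered m" "pos m (w i) = pos m (y i)" "offset m (w i) = offset m (x i)"
      using point_covered[OF c] pos_point[OF c] offset_point[OF c] i by (auto simp: w_def)
  qed
  have wm: "w \<in> halves I m" using w ym by (auto simp: halves_iff w_def)
  have wc: "w \<in> crossing I m x" using w z by (intro crossingI[OF xm wm, where z = z]) auto
  have wy: "w i \<in> covered n \<and> pos n (w i) = pos n (y i)" if i: "i \<in> I" for i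
    using pos_coarser[OF step.hyps(1) halves_covered[OF step.prems(2) i] w(1)[OF i] w(2)[OF i]] .
  have "w \<in> halves I n" using wy step.prems(2) by (auto simp: halves_iff w_def)
  from step.IH[OF wc this] show ?case using wy by auto
qed

text \<open>
  Going one level down (or up) in a late tower is going one level down (or up) in an early one, except
  at the ends of the early tower.
\<close>

lemma pos_pred_coarser:
  assumes "m \<le> n" "u \<in> covered m" "v \<in> covered n" "pos n u = Suc (pos n v)" "1 \<le> pos m u"
  shows "v \<in> covered m \<and> pos m u = Suc (pos m v)"
proof -
  let ?k = "pos m u - 1"
  have k: "?k < height m" using pos_less[OF assms(2)] by simp
  note c = k offset_bounds[OF assms(2)]
  let ?u = "tower m ! ?k + offset m u"
  note uu = point_covered[OF c] pos_point[OF c] offset_point[OF c]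
  have "int (pos n ?u) - int (pos n u) = int (pos m ?u) - int (pos m u)"
    using offset_finer[OF assms(1,2) uu(1) uu(3)] by blast
  then have "pos n v = pos n ?u" using assms(4,5) uu(2) by linarith
  from pos_coarser[OF assms(1) uu(1) assms(3) this] show ?thesis using uu(2) assms(5) by simp
qed

lemma pos_succ_coarser:
  assumes "m \<le> n" "v \<in> covered m" "u \<in> covered n" "pos n u = Suc (pos n v)" "Suc (pos m v) < height m"
  shows "u \<in> covered m \<and> pos m u = Suc (pos m v)"
proof -
  note c = assms(5) offset_bounds[OF assms(2)]
  let ?u = "tower m ! Suc (pos m v) + offset m v"
  note uu = point_covered[OF c] pos_point[OF c] offset_point[OF c]
  have "int (pos n ?u) - int (pos n v) = int (pos m ?u) - int (pos m v)"
    using offset_finer[OF assms(1,2) uu(1) uu(3)] by blast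
  then have "pos n u = pos n ?u" using assms(4) uu(2) by linarith
  from pos_coarser[OF assms(1) uu(1) assms(3) this] show ?thesis using uu(2) by simp
qed

lemma pos_positive_finer:
  assumes "m \<le> n" "u \<in> covered m" "1 \<le> pos m u"
  shows "1 \<le> pos n u"
proof (rule ccontr)
  assume "\<not> 1 \<le> pos n u"
  then have eq: "pos n u = pos n 0" by simp
  have "u \<in> covered n" using assms covered_mono by blast
  from pos_coarser[OF assms(1) zero_covered this eq] show False using assms(3) by simp
qed

definition lower :: "'i set \<Rightarrow> 'i set \<Rightarrow> ('i \<Rightarrow> nat) \<Rightarrow> ('i \<Rightarrow> nat)" where
  "lower I K a = (\<lambda>i\<in>I. if i \<in> K then a i - 1 else a i)"

lemma lower_half_index: "a \<in> half_index I n \<Longrightarrow> lower I K a \<in> half_index I n"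
proof -
  assume a: "a \<in> half_index I n"
  have "lower I K a i < height n div 2" if "i \<in> I" for i
    using half_index_less[OF a that] that less_imp_diff_less by (auto simp: lower_def)
  then show ?thesis unfolding half_index_def by (auto simp: lower_def)
qed

text \<open>
  The remaining situation: the digits take the value 1, on \<open>K\<close>, and exactly one of the
  values 0 and 2. If the other value is 0, applying $T^{h_n}$ increases each digit by one, but the
  spacer above the second copy delays the coordinates in \<open>K\<close> by one step. If it is 2,
  going back by $h_n + 1$ decreases each digit by one, again leaving the coordinates in
  \<open>K\<close> one level too low.
\<close>

locale splitting_step =
  fixes I K :: "'i set" and n :: nat and x :: "'i \<Rightarrow> real"
  assumes fin: "finite I" and xh: "x \<in> halves I n"
    and K_def: "K = {i \<in> I. digit n (x i) = 1}" and K1: "K \<noteq> {}" and K2: "K \<noteq> I"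
    and two: "(\<forall>i\<in>I. digit n (x i) \<noteq> 2) \<or> (\<forall>i\<in>I. digit n (x i) \<noteq> 0)"
begin

text \<open>
  Whether the second crossing comes after the one of \<open>x\<close> (digits 0 and 1) or before it
  (digits 1 and 2).
\<close>

definition up where "up \<longleftrightarrow> (\<forall>i\<in>I. digit n (x i) \<noteq> 2)"

definition new_digit where "new_digit i = (if up then digit n (x i) + 1 else digit n (x i) - 1)"

lemma digit_cases:
  assumes "i \<in> I"
  shows "up \<Longrightarrow> digit n (x i) = (if i \<in> K then 1 else 0)"
    and "\<not> up \<Longrightarrow> digit n (x i) = (if i \<in> K then 1 else 2)"
proof -
  have "digit n (x i) < 3" by (rule digit_less[OF halves_covered[OF xh assms]])
  then show "up \<Longrightarrow> digit n (x i) = (if i \<in> K then 1 else 0)"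
    "\<not> up \<Longrightarrow> digit n (x i) = (if i \<in> K then 1 else 2)"
    using assms two by (auto simp: up_def K_def)
qed

lemma new_digit_less: "i \<in> I \<Longrightarrow> new_digit i < 3"
  using digit_cases[of i] by (auto simp: new_digit_def)

lemma new_digit_neq: "i \<in> I \<Longrightarrow> new_digit i \<noteq> digit n (x i)"
  using digit_cases[of i] by (auto simp: new_digit_def split: if_splits)

text \<open>
  Compare a coordinate outside \<open>K\<close> with one inside \<open>K\<close>: their displacements
  inside the copies differ by less than $h_n$, which leaves only the old pair of digits and the new
  pair. One coordinate with its old digit forces all others to keep theirs.
\<close>

lemma classify:
  assumes w: "w \<in> crossing I (Suc n) x" "w \<notin> crossing I n x" and wh: "w \<in> halves I n"
  shows "\<exists>z. \<forall>i\<in>I. digit n (w i) = new_digit i \<and>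
     int (pos n (w i)) + (if i \<in> K then 1 else 0) = int (pos n (x i)) + z"
proof -
  obtain z where eq: "\<And>i. i \<in> I \<Longrightarrow> int (pos n (w i)) + int (copy_start n (digit n (w i)))
      = int (pos n (x i)) + int (copy_start n (digit n (x i))) + z"
    and off: "\<And>i. i \<in> I \<Longrightarrow> offset (Suc n) (w i) = offset (Suc n) (x i)"
    and dw: "\<And>i. i \<in> I \<Longrightarrow> digit n (w i) < 3" and dx: "\<And>i. i \<in> I \<Longrightarrow> digit n (x i) < 3"
    and e: "\<And>i. i \<in> I \<Longrightarrow> 2 * \<bar>int (pos n (w i)) - int (pos n (x i))\<bar> < int (height n)"
    using crossing_Suc_cases[OF w(1) wh xh] by metis
  have pair: "(digit n (w i) = digit n (x i) \<and> digit n (w j) = digit n (x j)) \<or>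
      (digit n (w i) = new_digit i \<and> digit n (w j) = new_digit j)" if i: "i \<in> I" "i \<notin> K" and j: "j \<in> K" for i j
  proof -
    have jI: "j \<in> I" using j K_def by auto
    have b: "\<bar>int (copy_start n (digit n (w i))) - int (copy_start n (digit n (x i)))
        - (int (copy_start n (digit n (w j))) - int (copy_start n (digit n (x j))))\<bar> < int (height n)"
      by (rule displacement_bound[OF eq[OF i(1)] eq[OF jI] e[OF i(1)] e[OF jI]])
    have "digit n (w i) = 0 \<or> digit n (w i) = 1 \<or> digit n (w i) = 2"
      "digit n (w j) = 0 \<or> digit n (w j) = 1 \<or> digit n (w j) = 2"
      using dw[OF i(1)] dw[OF jI] by linarith+
    then show ?thesis
      using b digit_cases[OF i(1)] digit_cases[OF jI] i j
      by (cases up) (auto simp: copy_start_values new_digit_def)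
  qed
  obtain j0 where j0: "j0 \<in> K" using K1 by blast
  obtain i0 where i0: "i0 \<in> I" "i0 \<notin> K" using K2 K_def by blast
  have KI: "K \<subseteq> I" using K_def by blast
  have "\<forall>i\<in>I. digit n (w i) = new_digit i"
  proof (rule ccontr)
    assume "\<not> ?thesis"
    then obtain k where k: "k \<in> I" "digit n (w k) \<noteq> new_digit k" by blast
    have i0x: "digit n (w i0) = digit n (x i0)"
    proof (cases "k \<in> K")
      case True then show ?thesis using pair[OF i0 True] k by blast
    next
      case False
      then have "digit n (w j0) = digit n (x j0)" using pair[OF k(1) False j0] k by blast
      then show ?thesis using pair[OF i0 j0] new_digit_neq[of j0] KI j0 by auto
    qed
    have jx: "digit n (w j) = digit n (x j)" if "j \<in> K" for j
      using pair[OF i0 that] i0x new_digit_neq[OF i0(1)] by auto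
    have all: "digit n (w i) = digit n (x i)" if "i \<in> I" for i
      using pair[OF that _ j0] jx[OF j0] jx[of i] new_digit_neq[of j0] KI j0 by (cases "i \<in> K") auto
    have "offset n (w i) = offset n (x i)" if i: "i \<in> I" for i
      using off[OF i] all[OF i] offset_Suc[OF halves_covered[OF wh i]] offset_Suc[OF halves_covered[OF xh i]] by simp
    then have "w \<in> crossing I n x" using eq all by (intro crossingI[OF xh wh, where z = z]) auto
    then show False using w(2) by contradiction
  qed
  moreover have "int (pos n (w i)) + (if i \<in> K then 1 else 0) =
      int (pos n (x i)) + (if up then z - int (height n) else z + int (height n) + 1)" if i: "i \<in> I" for i
    using eq[OF i] digit_cases[OF i] calculation i by (auto simp: copy_start_values new_digit_def split: if_splits)
  ultimately show ?thesis by blast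
qed

text \<open>
  The map \<open>\<phi>\<close> below lowers the coordinates in \<open>K\<close> by one level and
  replaces the digits by the new ones. It is a bijection from the visits of the crossing of
  \<open>x\<close> to the box \<open>a\<close> onto the visits of the other crossing to the lowered
  box; \<open>\<psi>\<close> is its inverse.
\<close>

lemma visits_split:
  assumes mn: "m \<le> n" and a: "a \<in> half_index I m" and a1: "\<And>i. i \<in> K \<Longrightarrow> 1 \<le> a i"
  shows "visits I (Suc n) x (tbox I m (lower I K a))
       = visits I n x (tbox I m (lower I K a)) + visits I n x (tbox I m a)"
proof -
  let ?B = "tbox I m a" and ?B' = "tbox I m (lower I K a)"
  let ?C = "crossing I n x" and ?C' = "crossing I (Suc n) x"
  note a' = lower_half_index[OF a, of K]
  have KI: "K \<subseteq> I" using K_def by blast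
  have Bh: "y \<in> halves I m" "y \<in> halves I n" if "y \<in> ?B" for y
    using that half_tbox_iff[OF a] halves_mono[OF mn, of I] by auto
  have B'h: "y \<in> halves I m" "y \<in> halves I n" if "y \<in> ?B'" for y
    using that half_tbox_iff[OF a'] halves_mono[OF mn, of I] by auto
  have Bp: "pos m (y i) = a i" if "y \<in> ?B" "i \<in> I" for y i
    using that tbox_iff[of I a m y] half_index_less_height[OF a] by auto
  have B'p: "pos m (y i) = lower I K a i" if "y \<in> ?B'" "i \<in> I" for y i
    using that tbox_iff[of I "lower I K a" m y] half_index_less_height[OF a'] by auto
  define \<phi> where "\<phi> y = (\<lambda>i\<in>I. tower n ! (pos n (y i) - (if i \<in> K then 1 else 0)) +
      (real (new_digit i) / 3 ^ Suc n + offset (Suc n) (x i)))" for y :: "'i \<Rightarrow> real"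
  define \<psi> where "\<psi> w = (\<lambda>i\<in>I. tower n ! (pos n (w i) + (if i \<in> K then 1 else 0)) +
      (real (digit n (x i)) / 3 ^ Suc n + offset (Suc n) (x i)))" for w :: "'i \<Rightarrow> real"
  have ob: "0 \<le> offset (Suc n) (x i)" "offset (Suc n) (x i) < 1 / 3 ^ Suc n" if "i \<in> I" for i
    using offset_bounds[of "x i" "Suc n"] halves_covered[OF xh that] covered_mono_Suc by blast+
  have phi: "\<phi> y i \<in> covered n" "pos n (\<phi> y i) = pos n (y i) - (if i \<in> K then 1 else 0)"
    "digit n (\<phi> y i) = new_digit i" "offset (Suc n) (\<phi> y i) = offset (Suc n) (x i)"
    if y: "y \<in> halves I n" and i: "i \<in> I" for y i
  proof -
    have k: "pos n (y i) - (if i \<in> K then 1 else 0) < height n"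
      using pos_less[OF halves_covered[OF y i]] by simp
    note c = k new_digit_less[OF i] ob[OF i]
    show "\<phi> y i \<in> covered n" "pos n (\<phi> y i) = pos n (y i) - (if i \<in> K then 1 else 0)"
    "digit n (\<phi> y i) = new_digit i" "offset (Suc n) (\<phi> y i) = offset (Suc n) (x i)"
      using copy_point_covered[OF c] copy_point_pos[OF c] copy_point_digit[OF c] copy_point_offset[OF c] i
      by (simp_all add: \<phi>_def del: power_Suc)
  qed
  have psi: "\<psi> w i \<in> covered n" "pos n (\<psi> w i) = pos n (w i) + (if i \<in> K then 1 else 0)"
    "digit n (\<psi> w i) = digit n (x i)" "offset (Suc n) (\<psi> w i) = offset (Suc n) (x i)"
    if w: "w \<in> halves I n" and i: "i \<in> I" for w i
  proof -
    have "pos n (w i) < height n div 2" using w i by (auto simp: halves_iff)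
    then have k: "pos n (w i) + (if i \<in> K then 1 else 0) < height n" by auto
    note c = k digit_less[OF halves_covered[OF xh i]] ob[OF i]
    show "\<psi> w i \<in> covered n" "pos n (\<psi> w i) = pos n (w i) + (if i \<in> K then 1 else 0)"
    "digit n (\<psi> w i) = digit n (x i)" "offset (Suc n) (\<psi> w i) = offset (Suc n) (x i)"
      using copy_point_covered[OF c] copy_point_pos[OF c] copy_point_digit[OF c] copy_point_offset[OF c] i
      by (simp_all add: \<psi>_def del: power_Suc)
  qed
  have phi_mem: "\<phi> y \<in> (?C' - ?C) \<inter> ?B'" if y: "y \<in> ?C \<inter> ?B" for y
  proof -
    have yC: "y \<in> ?C" and yB: "y \<in> ?B" using y by auto
    note yh = Bh(2)[OF yB]
    obtain z where z: "\<And>i. i \<in> I \<Longrightarrow> offset n (y i) = offset n (x i)"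
      "\<And>i. i \<in> I \<Longrightarrow> int (pos n (y i)) = int (pos n (x i)) + z" using yC by (rule crossingE) blast
    have p1: "1 \<le> pos n (y i)" if "i \<in> K" for i
      using pos_positive_finer[OF mn halves_covered[OF Bh(1)[OF yB], of i]] Bp[OF yB, of i] a1[OF that] KI that by auto
    have h: "\<phi> y \<in> halves I n"
      using phi[OF yh] yh by (auto simp: halves_iff \<phi>_def less_imp_diff_less)
    have h': "\<phi> y \<in> halves I (Suc n)" "x \<in> halves I (Suc n)" using h xh halves_mono[of n "Suc n" I] by auto
    have "\<phi> y \<in> ?C'"
    proof (rule crossingI[OF h'(2,1), where z = "z + (if up then int (height n) else - int (height n) - 1)"])
      fix i assume i: "i \<in> I"
      show "offset (Suc n) (\<phi> y i) = offset (Suc n) (x i)" by (rule phi(4)[OF yh i])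
      show "int (pos (Suc n) (\<phi> y i)) = int (pos (Suc n) (x i)) + (z + (if up then int (height n) else - int (height n) - 1))"
        unfolding pos_Suc[OF phi(1)[OF yh i]] pos_Suc[OF halves_covered[OF xh i]] phi(2,3)[OF yh i]
        using z(2)[OF i] digit_cases[OF i] p1[of i]
        by (auto simp: new_digit_def copy_start_values of_nat_diff split: if_splits)
    qed
    moreover have "\<phi> y \<notin> ?C"
    proof
      assume "\<phi> y \<in> ?C"
      moreover obtain i where i: "i \<in> I" using K1 KI by blast
      ultimately have "offset n (\<phi> y i) = offset n (x i)" by (auto elim: crossingE)
      then show False using phi(3)[OF yh i] new_digit_neq[OF i] by (simp add: digit_def)
    qed
    moreover have "\<phi> y \<in> ?B'"
    proof -
      have "\<phi> y i \<in> covered m \<and> pos m (\<phi> y i) = lower I K a i" if i: "i \<in> I" for i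
      proof (cases "i \<in> K")
        case True
        have s: "pos n (y i) = Suc (pos n (\<phi> y i))" using phi(2)[OF yh i] p1[OF True] True by simp
        have "1 \<le> pos m (y i)" using Bp[OF yB i] a1[OF True] by simp
        from pos_pred_coarser[OF mn halves_covered[OF Bh(1)[OF yB] i] phi(1)[OF yh i] s this]
        show ?thesis using Bp[OF yB i] True i by (simp add: lower_def)
      next
        case False
        have "pos n (\<phi> y i) = pos n (y i)" using phi(2)[OF yh i] False by simp
        from pos_coarser[OF mn halves_covered[OF Bh(1)[OF yB] i] phi(1)[OF yh i] this]
        show ?thesis using Bp[OF yB i] False i by (simp add: lower_def)
      qed
      then show ?thesis using tbox_iff[of I "lower I K a" m "\<phi> y"] half_index_less_height[OF a'] by (simp add: \<phi>_def)
    qed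
    ultimately show ?thesis by blast
  qed
  have psi_mem: "\<psi> w \<in> ?C \<inter> ?B" and new: "\<And>i. i \<in> I \<Longrightarrow> digit n (w i) = new_digit i"
    if w: "w \<in> (?C' - ?C) \<inter> ?B'" for w
  proof -
    have wC: "w \<in> ?C'" "w \<notin> ?C" and wB: "w \<in> ?B'" using w by auto
    note wh = B'h(2)[OF wB]
    obtain z where z: "\<And>i. i \<in> I \<Longrightarrow> digit n (w i) = new_digit i"
      "\<And>i. i \<in> I \<Longrightarrow> int (pos n (w i)) + (if i \<in> K then 1 else 0) = int (pos n (x i)) + z"
      using classify[OF wC wh] by blast
    show "\<And>i. i \<in> I \<Longrightarrow> digit n (w i) = new_digit i" by (rule z(1))
    have B: "\<psi> w \<in> ?B"
    proof -
      have "\<psi> w i \<in> covered m \<and> pos m (\<psi> w i) = a i" if i: "i \<in> I" for i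
      proof (cases "i \<in> K")
        case True
        have s: "pos n (\<psi> w i) = Suc (pos n (w i))" using psi(2)[OF wh i] True by simp
        have q: "Suc (pos m (w i)) = a i" using B'p[OF wB i] a1[OF True] True i by (simp add: lower_def)
        then have "Suc (pos m (w i)) < height m" using half_index_less_height[OF a i] by simp
        from pos_succ_coarser[OF mn halves_covered[OF B'h(1)[OF wB] i] psi(1)[OF wh i] s this]
        show ?thesis using q by simp
      next
        case False
        have "pos n (\<psi> w i) = pos n (w i)" using psi(2)[OF wh i] False by simp
        from pos_coarser[OF mn halves_covered[OF B'h(1)[OF wB] i] psi(1)[OF wh i] this]
        show ?thesis using B'p[OF wB i] False i by (simp add: lower_def)
      qed
      then show ?thesis using tbox_iff[of I a m "\<psi> w"] half_index_less_height[OF a] by (simp add: \<psi>_def)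
    qed
    have "\<psi> w \<in> ?C"
    proof (rule crossingI[OF xh Bh(2)[OF B], where z = z])
      fix i assume i: "i \<in> I"
      show "offset n (\<psi> w i) = offset n (x i)"
        using offset_Suc[OF psi(1)[OF wh i]] offset_Suc[OF halves_covered[OF xh i]] psi(3,4)[OF wh i] by simp
      show "int (pos n (\<psi> w i)) = int (pos n (x i)) + z" using psi(2)[OF wh i] z(2)[OF i] by (auto split: if_splits)
    qed
    then show "\<psi> w \<in> ?C \<inter> ?B" using B by blast
  qed
  have recon: "u = (\<lambda>i\<in>I. tower n ! pos n (u i) + (real (digit n (u i)) / 3 ^ Suc n + offset (Suc n) (u i)))"
    if u: "u \<in> halves I n" for u
  proof (rule extensionalityI[of _ I])
    fix i assume i: "i \<in> I"
    show "u i = (\<lambda>i\<in>I. tower n ! pos n (u i) + (real (digit n (u i)) / 3 ^ Suc n + offset (Suc n) (u i))) i"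
      unfolding offset_Suc[OF halves_covered[OF u i]] using i by (simp add: offset_Suc[OF halves_covered[OF u i]] pos_offset)
  qed (use u in \<open>auto simp: halves_iff\<close>)
  have "bij_betw \<phi> (?C \<inter> ?B) ((?C' - ?C) \<inter> ?B')"
  proof (rule bij_betw_byWitness[where f' = \<psi>])
    show "\<forall>y\<in>?C \<inter> ?B. \<psi> (\<phi> y) = y"
    proof
      fix y assume y: "y \<in> ?C \<inter> ?B"
      have yh: "y \<in> halves I n" and yB: "y \<in> ?B" using y Bh by auto
      have o: "offset n (y i) = offset n (x i)" if "i \<in> I" for i using y that by (auto elim: crossingE)
      have "offset (Suc n) (y i) = offset (Suc n) (x i)" "digit n (y i) = digit n (x i)" if i: "i \<in> I" for i
        using o[OF i] offset_Suc[OF halves_covered[OF yh i]] offset_Suc[OF halves_covered[OF xh i]] by (auto simp: digit_def)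
      moreover have "pos n (\<phi> y i) + (if i \<in> K then 1 else 0) = pos n (y i)" if i: "i \<in> I" for i
        using phi(2)[OF yh i] pos_positive_finer[OF mn halves_covered[OF Bh(1)[OF yB] i]] Bp[OF yB i] a1[of i] by auto
      ultimately have "\<psi> (\<phi> y) = (\<lambda>i\<in>I. tower n ! pos n (y i) + (real (digit n (y i)) / 3 ^ Suc n + offset (Suc n) (y i)))"
        unfolding \<psi>_def by (intro restrict_ext) simp
      then show "\<psi> (\<phi> y) = y" using recon[OF yh] by simp
    qed
    show "\<forall>w\<in>(?C' - ?C) \<inter> ?B'. \<phi> (\<psi> w) = w"
    proof
      fix w assume w: "w \<in> (?C' - ?C) \<inter> ?B'"
      have wh: "w \<in> halves I n" using w B'h by auto
      have wC: "w \<in> ?C'" using w by blast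
      have o: "offset (Suc n) (w i) = offset (Suc n) (x i)" if "i \<in> I" for i using wC that by (auto elim: crossingE)
      have "\<phi> (\<psi> w) = (\<lambda>i\<in>I. tower n ! pos n (w i) + (real (digit n (w i)) / 3 ^ Suc n + offset (Suc n) (w i)))"
        unfolding \<phi>_def using psi(2)[OF wh] o new[OF w] by (intro restrict_ext) simp
      then show "\<phi> (\<psi> w) = w" using recon[OF wh] by simp
    qed
    show "\<phi> ` (?C \<inter> ?B) \<subseteq> (?C' - ?C) \<inter> ?B'" using phi_mem by blast
    show "\<psi> ` ((?C' - ?C) \<inter> ?B') \<subseteq> ?C \<inter> ?B" using psi_mem by blast
  qed
  then have card: "card ((?C' - ?C) \<inter> ?B') = card (?C \<inter> ?B)" by (simp add: bij_betw_same_card)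
  have "?C' \<inter> ?B' = (?C \<inter> ?B') \<union> ((?C' - ?C) \<inter> ?B')" using crossing_mono[of n "Suc n" I x] by auto
  then have "card (?C' \<inter> ?B') = card (?C \<inter> ?B') + card ((?C' - ?C) \<inter> ?B')"
    using finite_crossing[OF fin] by (simp add: card_Un_disjoint[symmetric] Int_Diff Diff_Int_distrib2 disjoint_iff)
  then show ?thesis using card by (simp add: visits_def)
qed

end

section \<open>Visited boxes and finite visits\<close>

definition finite_visits :: "'i set \<Rightarrow> ('i \<Rightarrow> real) \<Rightarrow> bool" where
  "finite_visits I x \<longleftrightarrow> (\<forall>m. \<exists>c. \<forall>p. visits I p x (halves I m) \<le> c)"

definition diagonal_point :: "'i set \<Rightarrow> ('i \<Rightarrow> real) \<Rightarrow> bool" where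
  "diagonal_point I x \<longleftrightarrow> (\<exists>n1\<ge>1. \<forall>n\<ge>n1. x \<in> halves I n \<and> single_diagonal_step I n x)"

definition splits :: "'i set \<Rightarrow> 'i set \<Rightarrow> ('i \<Rightarrow> real) \<Rightarrow> bool" where
  "splits I K x \<longleftrightarrow> infinite {n. splitting_step I K n x}"

text \<open>
  A point of a crossing of \<open>x\<close> is an image of \<open>x\<close> or has \<open>x\<close> as
  an image, and it is determined by the number of steps because the transformation is injective.
\<close>

lemma finite_visitsI:
  assumes fin: "finite I" and x: "x \<in> space (powX I)"
    and fw: "\<And>m. eventually (\<lambda>j. (chacon_pow I ^^ j) x \<notin> halves I m) sequentially"
    and bw: "\<And>m. eventually (\<lambda>j. x \<notin> (chacon_pow I ^^ j) ` halves I m) sequentially"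
  shows "finite_visits I x"
  unfolding finite_visits_def
proof
  fix m
  let ?S = "chacon_pow I"
  obtain J where J: "\<And>j. j \<ge> J \<Longrightarrow> (?S ^^ j) x \<notin> halves I m \<and> x \<notin> (?S ^^ j) ` halves I m"
    using eventually_conj[OF fw[of m] bw[of m]] unfolding eventually_sequentially by blast
  let ?F = "(\<lambda>j. (?S ^^ j) x) ` {..<J} \<union> (\<lambda>j. inv_into (space (powX I)) (?S ^^ j) x) ` {..<J}"
  have sub: "crossing I p x \<inter> halves I m \<subseteq> ?F" for p
  proof
    fix y assume y: "y \<in> crossing I p x \<inter> halves I m"
    then obtain j where j: "y = (?S ^^ j) x \<or> x = (?S ^^ j) y" using crossing_orbit by blast
    then have jJ: "j < J" using J[of j] y by (meson IntD2 image_eqI not_le)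
    from j show "y \<in> ?F"
    proof
      assume "x = (?S ^^ j) y"
      moreover have "y \<in> space (powX I)" using y halves_space by blast
      moreover have "inj_on (?S ^^ j) (space (powX I))" unfolding chacon_pow_eq_shift by (rule shift_iter_inj)
      ultimately have "y = inv_into (space (powX I)) (?S ^^ j) x" by (simp add: inv_into_f_f)
      then show ?thesis using jJ by blast
    qed (use jJ in blast)
  qed
  have "visits I p x (halves I m) \<le> real (card ?F)" for p
    unfolding visits_def by (intro of_nat_mono card_mono sub) auto
  then show "\<exists>c. \<forall>p. visits I p x (halves I m) \<le> c" by blast
qed

text \<open>
  There are finitely many subsets of \<open>I\<close>, so one of them serves for infinitely many
  \<open>n\<close>.
\<close>

lemma splitting_alternative:
  assumes fin: "finite I" and x: "x \<in> space (powX I)" and nd: "\<not> diagonal_point I x"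
  shows "\<exists>K\<subseteq>I. K \<noteq> {} \<and> K \<noteq> I \<and> splits I K x"
proof -
  obtain N where N: "\<And>n. n \<ge> N \<Longrightarrow> x \<in> halves I n"
    using eventually_halves[OF fin x, of 0] unfolding eventually_sequentially by blast
  have step: "splitting_step I {i \<in> I. digit n (x i) = 1} n x"
    if n: "n \<ge> N" and ns: "\<not> single_diagonal_step I n x" for n
  proof
    show "finite I" by (rule fin)
    show xh: "x \<in> halves I n" by (rule N[OF n])
    have lt: "digit n (x i) < 3" if "i \<in> I" for i by (rule digit_less[OF halves_covered[OF xh that]])
    obtain i j where ij: "i \<in> I" "j \<in> I" "digit n (x i) \<noteq> digit n (x j)"
      using ns unfolding single_diagonal_step_def by blast
    show two: "(\<forall>i\<in>I. digit n (x i) \<noteq> 2) \<or> (\<forall>i\<in>I. digit n (x i) \<noteq> 0)"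
      using ns unfolding single_diagonal_step_def by metis
    have "digit n (x i) = 1 \<or> digit n (x j) = 1" "digit n (x i) \<noteq> 1 \<or> digit n (x j) \<noteq> 1"
    proof -
      have v: "digit n (x i) = 0 \<or> digit n (x i) = 1 \<or> digit n (x i) = 2"
        "digit n (x j) = 0 \<or> digit n (x j) = 1 \<or> digit n (x j) = 2"
        using lt[OF ij(1)] lt[OF ij(2)] by linarith+
      have "(digit n (x i) \<noteq> 2 \<and> digit n (x j) \<noteq> 2) \<or> (digit n (x i) \<noteq> 0 \<and> digit n (x j) \<noteq> 0)"
        using two ij(1,2) by blast
      then show "digit n (x i) = 1 \<or> digit n (x j) = 1" using v ij(3) by auto
      show "digit n (x i) \<noteq> 1 \<or> digit n (x j) \<noteq> 1" using ij(3) by auto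
    qed
    then show "{i \<in> I. digit n (x i) = 1} \<noteq> {}" "{i \<in> I. digit n (x i) = 1} \<noteq> I"
      using ij(1,2) by blast+
  qed simp
  have "infinite {n. n \<ge> N \<and> \<not> single_diagonal_step I n x}"
  proof
    assume "finite {n. n \<ge> N \<and> \<not> single_diagonal_step I n x}"
    then obtain M where M: "\<And>n. n \<ge> N \<Longrightarrow> \<not> single_diagonal_step I n x \<Longrightarrow> n < M"
      unfolding finite_nat_set_iff_bounded by blast
    have "diagonal_point I x"
      unfolding diagonal_point_def
    proof (intro exI[of _ "max 1 (max N M)"] conjI allI impI)
      fix n assume "max 1 (max N M) \<le> n"
      then show "x \<in> halves I n" "single_diagonal_step I n x" using N M[of n] by auto
    qed simp
    then show False using nd by simp
  qed
  moreover have "finite (Pow I)" using fin by simp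
  ultimately have "\<exists>K\<in>Pow I. infinite {n. n \<ge> N \<and> \<not> single_diagonal_step I n x \<and> {i \<in> I. digit n (x i) = 1} = K}"
    using pigeonhole_infinite_rel[of "{n. n \<ge> N \<and> \<not> single_diagonal_step I n x}" "Pow I"
        "\<lambda>n K. {i \<in> I. digit n (x i) = 1} = K"] by (auto simp: conj_assoc)
  then obtain K where K: "K \<subseteq> I" "infinite {n. n \<ge> N \<and> \<not> single_diagonal_step I n x \<and> {i \<in> I. digit n (x i) = 1} = K}"
    by blast
  then have inf: "splits I K x" unfolding splits_def
    using step by (elim infinite_super[rotated]) blast
  then obtain n where "splitting_step I K n x" unfolding splits_def
    by (metis (mono_tags) Collect_empty_eq finite.emptyI)
  then interpret splitting_step I K n x .
  show ?thesis using K(1) K1 K2 inf by blast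
qed

text \<open>
  Let \<open>B\<close> be a box containing \<open>x\<close> that can be lowered. Each of the
  infinitely many splitting steps adds to the visits to the lowered box those to \<open>B\<close>, of
  which \<open>x\<close> itself is one.
\<close>

lemma splits_unbounded:
  assumes fin: "finite I" and x: "x \<in> space (powX I)" and x0: "\<And>i. i \<in> I \<Longrightarrow> x i \<noteq> 0" and sp: "splits I K x"
  shows "\<not> finite_visits I x"
proof
  assume "finite_visits I x"
  have "eventually (\<lambda>n. x \<in> halves I n \<and> (\<forall>i\<in>I. 1 \<le> pos n (x i))) sequentially"
    by (rule eventually_halves_positive[OF fin x order_refl x0])
  then obtain m where m: "x \<in> halves I m" "\<And>i. i \<in> I \<Longrightarrow> 1 \<le> pos m (x i)"
    unfolding eventually_sequentially by blast
  let ?a = "posv I m x" and ?v = "\<lambda>n. visits I n x (tbox I m (lower I K (posv I m x)))"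
  have a: "?a \<in> half_index I m" by (rule posv_half_index[OF m(1)])
  have inc: "?v (Suc n) \<ge> ?v n + 1" if n: "m \<le> n" "splitting_step I K n x" for n
  proof -
    interpret splitting_step I K n x by (rule n)
    have "1 \<le> visits I n x (tbox I m ?a)"
      by (rule visits_ge_1[OF fin xh in_tbox_posv[OF m(1)]])
    then show ?thesis using visits_split[OF n(1) a] m(2) K_def by (auto simp: posv_def)
  qed
  have "\<exists>n. real N \<le> ?v n" for N
  proof (induction N)
    case 0
    show ?case by (intro exI[of _ 0]) (simp add: visits_nonneg)
  next
    case (Suc N)
    then obtain n where n: "real N \<le> ?v n" by blast
    obtain n' where n': "n' \<ge> max m n" "splitting_step I K n' x"
      using sp unfolding splits_def infinite_nat_iff_unbounded_le by blast
    have "?v n \<le> ?v n'" using n' by (intro visits_mono fin) auto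
    then have "real (Suc N) \<le> ?v (Suc n')" using inc[of n'] n n' by simp
    then show ?case by blast
  qed
  moreover obtain c where c: "\<And>p. visits I p x (halves I m) \<le> c"
    using \<open>finite_visits I x\<close> unfolding finite_visits_def by blast
  have "?v p \<le> c" for p
  proof -
    have "tbox I m (lower I K ?a) \<subseteq> halves I m" using half_tbox_iff[OF lower_half_index[OF a]] by blast
    then have "?v p \<le> visits I p x (halves I m)"
      unfolding visits_def using finite_crossing[OF fin, of p x] by (intro of_nat_mono card_mono) auto
    then show ?thesis using c[of p] by simp
  qed
  moreover obtain N :: nat where "c < real N" using reals_Archimedean2 by blast
  ultimately show False by (meson not_le order_trans)
qed

context ergodic_power
begin

text \<open>
  Almost every point lies only in boxes of positive mass, and the crossings of a generic point visit
  all such boxes.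
\<close>

lemma AE_visited:
  assumes x: "generic x"
  shows "AE y in \<sigma>. \<forall>n. y \<in> halves I n \<longrightarrow>
      (\<forall>N. \<exists>p\<ge>N. \<exists>w\<in>crossing I p x. w \<in> halves I n \<and> posv I n w = posv I n y)"
proof -
  have "AE y in \<sigma>. \<forall>n. \<forall>k\<in>half_index I n. y \<in> tbox I n k \<longrightarrow> 0 < measure \<sigma> (tbox I n k)"
    using AE_generic by eventually_elim (auto simp: generic_def)
  then show ?thesis
  proof eventually_elim
    case (elim y)
    show ?case
    proof (intro allI impI)
      fix n N assume y: "y \<in> halves I n"
      let ?k = "posv I n y"
      have k: "?k \<in> half_index I n" by (rule posv_half_index[OF y])
      have "0 < measure \<sigma> (tbox I n ?k)" using elim k in_tbox_posv[OF y] by blast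
      from eventually_conj[OF generic_visits_pos[OF x k this] eventually_ge_at_top[of N]]
      obtain p where p: "p \<ge> N" "0 < visits I p x (tbox I n ?k)" unfolding eventually_sequentially by blast
      then have "crossing I p x \<inter> tbox I n ?k \<noteq> {}" unfolding visits_def by (metis card.empty of_nat_0 less_irrefl)
      then obtain w where "w \<in> crossing I p x" "w \<in> tbox I n ?k" by blast
      then show "\<exists>p\<ge>N. \<exists>w\<in>crossing I p x. w \<in> halves I n \<and> posv I n w = posv I n y"
        using p half_tbox_iff[OF k] by blast
    qed
  qed
qed

section \<open>Diagonal measures\<close>

text \<open>
  From a box \<open>b\<close> with a coordinate at the bottom, the diagonal ends when the highest
  coordinate reaches the last level of the bottom half. For the two maximality conditions the midpoint
  \<open>e\<close> of the box is a convenient witness: its coordinates are positive, hence have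
  preimages.
\<close>

lemma diagonal_of_box:
  assumes n: "n \<ge> 1" and b: "b \<in> half_index I n" and i0: "i0 \<in> I" "b i0 = 0"
  shows "n_diagonal I n {(S ^^ j) ` tbox I n b |j. j \<le> height n div 2 - 1 - Max (b ` I)}"
    and "\<And>j. j \<le> height n div 2 - 1 - Max (b ` I) \<Longrightarrow> (S ^^ j) ` tbox I n b = tbox I n (\<lambda>i\<in>I. b i + j)"
proof -
  let ?l = "height n div 2 - 1 - Max (b ` I)"
  have "Max (b ` I) \<in> b ` I" using finite_I I_nonempty by (intro Max_in) auto
  then obtain i1 where i1: "i1 \<in> I" "Max (b ` I) = b i1" by auto
  have l1: "b i1 + Suc ?l = height n div 2" using half_index_less[OF b i1(1)] i1(2) by simp
  have bl: "b i + j < height n div 2" if "i \<in> I" "j \<le> ?l" for i j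
  proof -
    have "b i \<le> b i1" unfolding i1(2)[symmetric] using finite_I that by auto
    then show ?thesis using that l1 by linarith
  qed
  have bj: "(\<lambda>i\<in>I. b i + j) \<in> half_index I n" if "j \<le> ?l" for j
    using bl[OF _ that] by (auto simp: half_index_def)
  show img: "(S ^^ j) ` tbox I n b = tbox I n (\<lambda>i\<in>I. b i + j)" if j: "j \<le> ?l" for j
  proof (intro equalityI subsetI)
    fix y assume "y \<in> (S ^^ j) ` tbox I n b"
    then obtain u where u: "u \<in> tbox I n b" "y = (S ^^ j) u" by blast
    have "u \<in> space (powX I)" using u half_tbox_iff[OF b] halves_space by blast
    moreover have "b i + j < height n" if "i \<in> I" for i using bl[OF that j] by linarith
    ultimately show "y \<in> tbox I n (\<lambda>i\<in>I. b i + j)" using S_iter_box[of b j n u] u by blast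
  next
    fix y assume "y \<in> tbox I n (\<lambda>i\<in>I. b i + j)"
    then have y: "y \<in> halves I n" "posv I n y = (\<lambda>i\<in>I. b i + j)" using half_tbox_iff[OF bj[OF j]] by auto
    define u where "u = (\<lambda>i\<in>I. tower n ! b i + offset n (y i))"
    have u: "u i \<in> covered n" "pos n (u i) = b i" "offset n (u i) = offset n (y i)" if i: "i \<in> I" for i
    proof -
      note c = half_index_less_height[OF b i] offset_bounds[OF halves_covered[OF y(1) i]]
      show "u i \<in> covered n" "pos n (u i) = b i" "offset n (u i) = offset n (y i)"
        using point_covered[OF c] pos_point[OF c] offset_point[OF c] i by (auto simp: u_def)
    qed
    have uh: "u \<in> halves I n" using u half_index_less[OF b] by (auto simp: halves_iff u_def)
    have py: "int (pos n (y i)) = int (pos n (u i)) + int j" if i: "i \<in> I" for i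
      using fun_cong[OF y(2), of i] u(2)[OF i] i by (simp add: posv_def)
    have "y \<in> crossing I n u" using u py by (intro crossingI[OF uh y(1), where z = "int j"]) auto
    then have "y = (S ^^ j) u" using py by (rule crossing_forward)
    moreover have "u \<in> tbox I n b" using u half_index_less_height[OF b] tbox_iff[of I b n u] by (auto simp: u_def)
    ultimately show "y \<in> (S ^^ j) ` tbox I n b" by blast
  qed
  define e where "e = (\<lambda>i\<in>I. tower n ! b i + 1 / (2 * 3 ^ n))"
  have half: "0 \<le> 1 / (2 * 3 ^ n :: real)" "1 / (2 * 3 ^ n :: real) < 1 / 3 ^ n" by (auto simp: divide_simps)
  have e: "e i \<in> covered n" "pos n (e i) = b i" "offset n (e i) = 1 / (2 * 3 ^ n)" if i: "i \<in> I" for i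
  proof -
    note c = half_index_less_height[OF b i] half
    show "e i \<in> covered n" "pos n (e i) = b i" "offset n (e i) = 1 / (2 * 3 ^ n)"
      using point_covered[OF c] pos_point[OF c] offset_point[OF c] i by (auto simp: e_def)
  qed
  have e_box: "e \<in> tbox I n b" using e half_index_less_height[OF b] tbox_iff[of I b n e] by (auto simp: e_def)
  have e_pos: "0 < e i" if i: "i \<in> I" for i
  proof -
    have "tower n ! b i + 0 \<in> covered n" using half_index_less_height[OF b i] by (intro point_covered) auto
    then show ?thesis using i covered_nonneg by (auto simp: e_def intro!: add_nonneg_pos)
  qed
  show "n_diagonal I n {(S ^^ j) ` tbox I n b |j. j \<le> ?l}"
    unfolding n_diagonal_def
  proof (intro exI[of _ "tbox I n b"] exI[of _ ?l] conjI ballI)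
    fix A assume "A \<in> {(S ^^ j) ` tbox I n b |j. j \<le> ?l}"
    then obtain j where "j \<le> ?l" "A = tbox I n (\<lambda>i\<in>I. b i + j)" using img by auto
    then show "n_box I n A"
      unfolding n_box_def using bl by (intro exI[of _ "\<lambda>i\<in>I. b i + j"]) (auto simp: tbox_def)
  next
    let ?u = "\<lambda>i\<in>I. chacon_inv (e i)"
    have us: "?u \<in> space (powX I)" by (auto simp: space_powX_iff chacon_inv_nonneg)
    have "S ?u = e" using e_pos by (auto simp: chacon_pow_def fun_eq_iff chacon_chacon_inv e_def)
    then have "?u \<in> S -` tbox I n b \<inter> space (powX I)" using us e_box by simp
    moreover have "?u \<notin> (\<Pi>\<^sub>E i\<in>I. bottom_half n)"
    proof
      assume "?u \<in> (\<Pi>\<^sub>E i\<in>I. bottom_half n)"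
      then have "chacon_inv (e i0) \<in> bottom_half n" using i0(1) by (auto simp: PiE_iff)
      then have c: "chacon_inv (e i0) \<in> covered n" "Suc (pos n (chacon_inv (e i0))) < height n"
        by (auto simp: bottom_half_iff)
      have "pos n (e i0) = Suc (pos n (chacon_inv (e i0)))"
        using pos_chacon[OF c] chacon_chacon_inv[OF e_pos[OF i0(1)]] by simp
      then show False using e(2)[OF i0(1)] i0(2) by simp
    qed
    ultimately show "\<not> S -` tbox I n b \<inter> space (powX I) \<subseteq> (\<Pi>\<^sub>E i\<in>I. bottom_half n)" by blast
  next
    have "(S ^^ Suc ?l) e \<notin> (\<Pi>\<^sub>E i\<in>I. bottom_half n)"
    proof
      assume "(S ^^ Suc ?l) e \<in> (\<Pi>\<^sub>E i\<in>I. bottom_half n)"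
      then have "((S ^^ Suc ?l) e) i1 \<in> bottom_half n" using i1(1) by (auto simp: PiE_iff)
      moreover have "((S ^^ Suc ?l) e) i1 = (chacon ^^ Suc ?l) (e i1)"
        using chacon_pow_iter[of e I "Suc ?l"] i1(1) by (simp add: e_def)
      moreover have "pos n (e i1) + Suc ?l < height n"
        using e(2)[OF i1(1)] l1 half_height_double[OF n] half_height_pos[OF n] by linarith
      then have "pos n ((chacon ^^ Suc ?l) (e i1)) = height n div 2"
        using pos_chacon_iter[OF e(1)[OF i1(1)], of "Suc ?l"] e(2)[OF i1(1)] l1 by simp
      ultimately show False by (simp add: bottom_half_iff)
    qed
    then show "\<not> (S ^^ Suc ?l) ` tbox I n b \<subseteq> (\<Pi>\<^sub>E i\<in>I. bottom_half n)" using e_box by blast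
  qed simp
qed

text \<open>
  By \<open>single_diagonal\<close> the crossings of \<open>x\<close> meet $C_n^I$ on the diagonal of
  \<open>x\<close> only, and by \<open>AE_visited\<close> almost every point of $C_n^I$ lies in a box
  that they visit.
\<close>

lemma diagonal_measureI:
  assumes x: "generic x" and d: "diagonal_point I x"
  shows "diagonal_measure I \<sigma>"
  unfolding diagonal_measure_def
proof (intro conjI sets_\<sigma> bdd_finite invariant)
  obtain n1 where n1: "n1 \<ge> 1" "\<And>n. n \<ge> n1 \<Longrightarrow> x \<in> halves I n \<and> single_diagonal_step I n x"
    using d unfolding diagonal_point_def by blast
  show "\<exists>n0\<ge>1. \<forall>n\<ge>n0. \<exists>D. n_diagonal I n D \<and>
     (AE y in \<sigma>. y \<in> (\<Pi>\<^sub>E i\<in>I. bottom_half n) \<longrightarrow> y \<in> \<Union>D)"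
  proof (intro exI[of _ n1] conjI allI impI n1(1))
    fix n assume n: "n1 \<le> n"
    have xh: "x \<in> halves I n" using n1(2)[OF n] by blast
    let ?k = "posv I n x"
    let ?m = "Min (?k ` I)"
    define b where "b = (\<lambda>i\<in>I. ?k i - ?m)"
    let ?l = "height n div 2 - 1 - Max (b ` I)"
    have k: "?k \<in> half_index I n" by (rule posv_half_index[OF xh])
    have m: "?m \<le> ?k i" if "i \<in> I" for i using finite_I that by auto
    have "?m \<in> ?k ` I" using finite_I I_nonempty by (intro Min_in) auto
    then obtain i0 where i0: "i0 \<in> I" "?k i0 = ?m" by auto
    have bi0: "b i0 = 0" using i0 by (simp add: b_def)
    have "b i < height n div 2" if "i \<in> I" for i
      using half_index_less[OF k that] that by (simp add: b_def less_imp_diff_less)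
    then have b: "b \<in> half_index I n" by (auto simp: half_index_def b_def)
    have n1': "n \<ge> 1" using n n1 by simp
    note D = diagonal_of_box[OF n1' b i0(1) bi0]
    have "AE y in \<sigma>. y \<in> halves I n \<longrightarrow> y \<in> \<Union>{(S ^^ j) ` tbox I n b |j. j \<le> ?l}"
      using AE_visited[OF x]
    proof eventually_elim
      case (elim y)
      show ?case
      proof
        assume y: "y \<in> halves I n"
        obtain p w where w: "p \<ge> n" "w \<in> crossing I p x" "w \<in> halves I n" "posv I n w = posv I n y"
          using elim y by blast
        have hyp: "x \<in> halves I q \<and> single_diagonal_step I q x" if "n \<le> q" for q using n1(2)[of q] n that by simp
        obtain z where z: "\<forall>i\<in>I. int (pos n (w i)) = int (pos n (x i)) + z"
          using single_diagonal[OF w(1) hyp w(2,3)] by blast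
        have wy: "pos n (w i) = pos n (y i)" if "i \<in> I" for i
          using fun_cong[OF w(4), of i] that by (simp add: posv_def)
        define j where "j = nat (int ?m + z)"
        have eqb: "int (pos n (y i)) = int (b i) + (int ?m + z)" if i: "i \<in> I" for i
          using z wy[OF i] m[OF i] i by (auto simp: b_def posv_def of_nat_diff)
        have j0: "0 \<le> int ?m + z" using eqb[OF i0(1)] bi0 by simp
        have eqj: "pos n (y i) = b i + j" if i: "i \<in> I" for i
          using eqb[OF i] j0 unfolding j_def by linarith
        have "Max (b ` I) \<in> b ` I" using finite_I I_nonempty by (intro Max_in) auto
        then obtain i1 where i1: "i1 \<in> I" "Max (b ` I) = b i1" by auto
        have "pos n (y i1) < height n div 2" using y i1 by (auto simp: halves_iff)
        then have jl: "j \<le> ?l" using eqj[OF i1(1)] i1(2) by linarith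
        have "posv I n y = (\<lambda>i\<in>I. b i + j)" using eqj by (auto simp: posv_def)
        then have "y \<in> (S ^^ j) ` tbox I n b" using in_tbox_posv[OF y] D(2)[OF jl] by simp
        then show "y \<in> \<Union>{(S ^^ j) ` tbox I n b |j. j \<le> ?l}" using jl by blast
      qed
    qed
    then show "\<exists>D. n_diagonal I n D \<and> (AE y in \<sigma>. y \<in> (\<Pi>\<^sub>E i\<in>I. bottom_half n) \<longrightarrow> y \<in> \<Union>D)"
      using D(1) unfolding halves_def by blast
  qed
qed

text \<open>
  In $C_N^I$ the orbit of \<open>x\<close> has finitely many points. A point distinct from all of them
  is separated from them by its boxes of high order, which are then not visited.
\<close>

lemma single_orbitI:
  assumes x: "generic x" and fv: "finite_visits I x"
  shows "supported_on_single_orbit \<sigma> S"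
  unfolding supported_on_single_orbit_def
proof (intro bexI)
  show xs: "x \<in> space \<sigma>" by (rule generic_space[OF x])
  show "AE y in \<sigma>. y \<in> saturation \<sigma> S {x}"
    using AE_visited[OF x] AE_space
  proof eventually_elim
    case (elim y)
    have ys: "y \<in> space (powX I)" using elim(2) space_\<sigma> by simp
    obtain N where N: "\<And>n. n \<ge> N \<Longrightarrow> y \<in> halves I n"
      using eventually_halves[OF finite_I ys, of 0] unfolding eventually_sequentially by blast
    define F where "F = (\<Union>p. crossing I p x \<inter> halves I N)"
    obtain c where c: "\<And>p. visits I p x (halves I N) \<le> c" using fv unfolding finite_visits_def by blast
    have finF: "finite F"
    proof -
      have "card G \<le> nat \<lceil>c\<rceil>" if G: "G \<subseteq> F" "finite G" for G
      proof -
        have "\<exists>p. G \<subseteq> crossing I p x \<inter> halves I N"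
          using G(2,1)
        proof (induction G rule: finite_induct)
          case (insert g G)
          then obtain p q where "G \<subseteq> crossing I p x \<inter> halves I N" "g \<in> crossing I q x \<inter> halves I N"
            unfolding F_def by blast
          then have "insert g G \<subseteq> crossing I (max p q) x \<inter> halves I N"
            using crossing_mono[of p "max p q" I x] crossing_mono[of q "max p q" I x] by auto
          then show ?case by blast
        qed auto
        then obtain p where "G \<subseteq> crossing I p x \<inter> halves I N" by blast
        then have "card G \<le> card (crossing I p x \<inter> halves I N)"
          using finite_crossing[OF finite_I] by (intro card_mono) auto
        then have "real (card G) \<le> c" using c[of p] unfolding visits_def by linarith
        then show ?thesis by linarith
      qed
      then show ?thesis using finite_if_finite_subsets_card_bdd by blast
    qed
    have "y \<in> F"
    proof (rule ccontr)
      assume "y \<notin> F"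
      have "eventually (\<lambda>n. \<forall>w\<in>F. posv I n w \<noteq> posv I n y) sequentially"
      proof (intro eventually_ball_finite finF ballI)
        fix w assume w: "w \<in> F"
        then have wh: "w \<in> halves I N" and wy: "w \<noteq> y" using \<open>y \<notin> F\<close> by (auto simp: F_def)
        have we: "w \<in> extensional I" "y \<in> extensional I" using wh ys by (auto simp: halves_iff space_powX_iff)
        obtain i where i: "i \<in> I" "w i \<noteq> y i" using wy extensionalityI[OF we] by blast
        have "0 \<le> w i" "0 \<le> y i" using wh ys i covered_nonneg[OF halves_covered[OF wh i(1)]] by (auto simp: space_powX_iff)
        from points_separated[OF this i(2)] show "eventually (\<lambda>n. posv I n w \<noteq> posv I n y) sequentially"
        proof eventually_elim
          case (elim n)
          then show ?case using i(1) by (auto simp: posv_def dest: fun_cong[of _ _ i])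
        qed
      qed
      then obtain n where n: "n \<ge> N" "\<forall>w\<in>F. posv I n w \<noteq> posv I n y"
        unfolding eventually_sequentially by (meson linear order_refl)
      obtain p w where w: "w \<in> crossing I p x" "w \<in> halves I n" "posv I n w = posv I n y"
        using elim(1) N[OF n(1)] by blast
      have "w i \<in> covered N \<and> pos N (w i) = pos N (y i)" if i: "i \<in> I" for i
        using pos_coarser[OF n(1) halves_covered[OF N[OF order_refl] i] halves_covered[OF w(2) i]]
          fun_cong[OF w(3), of i] i by (simp add: posv_def)
      then have "w \<in> halves I N" using N[OF order_refl] w(2) by (auto simp: halves_iff)
      then have "w \<in> F" using w(1) unfolding F_def by blast
      then show False using n(2) w(3) by blast
    qed
    then obtain p where "y \<in> crossing I p x" unfolding F_def by blast
    then obtain j where "y = (S ^^ j) x \<or> x = (S ^^ j) y" using crossing_orbit by blast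
    then show ?case using elim(2) unfolding saturation_def by blast
  qed
qed

end

section \<open>Invariance under a partial shift\<close>

text \<open>
  The condition on \<open>K\<close> is essential: the preimage of the lowest level of a tower is not a
  level.
\<close>

lemma shift_tbox:
  assumes x: "x \<in> space (powX I)" and a: "\<And>i. i \<in> I \<Longrightarrow> a i < height n" and a1: "\<And>i. i \<in> K \<Longrightarrow> 1 \<le> a i"
  shows "shift I K x \<in> tbox I n a \<longleftrightarrow> x \<in> tbox I n (lower I K a)"
proof -
  have l: "lower I K a i < height n" if "i \<in> I" for i
    using a[OF that] that by (simp add: lower_def less_imp_diff_less)
  have xe: "x \<in> extensional I" and x0: "\<And>i. i \<in> I \<Longrightarrow> 0 \<le> x i" using x by (auto simp: space_powX_iff)
  have 1: "(shift I K x i \<in> covered n \<and> pos n (shift I K x i) = a i) \<longleftrightarrow>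
      (x i \<in> covered n \<and> pos n (x i) = lower I K a i)" if i: "i \<in> I" for i
  proof (cases "i \<in> K")
    case True
    have "lower I K a i + 1 = a i" using a1[OF True] True i by (simp add: lower_def)
    then show ?thesis
      using chacon_iter_level_iff[of "lower I K a i" 1 n "x i"] a[OF i] x0[OF i] True i by (simp add: shift_def)
  next
    case False
    then show ?thesis using i by (simp add: shift_def lower_def)
  qed
  have L: "shift I K x \<in> tbox I n a \<longleftrightarrow> (\<forall>i\<in>I. shift I K x i \<in> covered n \<and> pos n (shift I K x i) = a i)"
    using tbox_iff[of I a n, OF a] by (simp add: shift_def)
  have R: "x \<in> tbox I n (lower I K a) \<longleftrightarrow> (\<forall>i\<in>I. x i \<in> covered n \<and> pos n (x i) = lower I K a i)"
    using tbox_iff[of I "lower I K a" n, OF l] xe by simp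
  show ?thesis unfolding L R using 1 by blast
qed

context invariant_power
begin

lemma shift_measurable': "shift I K \<in> measurable \<sigma> (powX I)" "shift I K \<in> measurable \<sigma> \<sigma>"
  using shift_measurable[of I K] measurable_cong_sets[OF sets_\<sigma> refl] measurable_cong_sets[OF sets_\<sigma> sets_\<sigma>] by auto

lemma shift_iter_measurable': "shift I K ^^ j \<in> measurable \<sigma> \<sigma>"
  using shift_iter_measurable measurable_cong_sets[OF sets_\<sigma> sets_\<sigma>] by blast

lemma AE_eventually_not_in:
  assumes A: "\<And>j. A j \<in> sets \<sigma>" and fin: "\<And>j. emeasure \<sigma> (A j) < \<infinity>"
    and sum: "summable (\<lambda>j. measure \<sigma> (A j))"
  shows "AE x in \<sigma>. eventually (\<lambda>j. x \<notin> A j) sequentially"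
  using borel_cantelli_AE1[OF A fin sum] by (rule AE_mp) (auto elim: eventually_mono)

lemma ex_of_AE:
  assumes "emeasure \<sigma> (space \<sigma>) \<noteq> 0" "AE x in \<sigma>. P x" shows "\<exists>x. P x"
proof (rule ccontr)
  assume "\<not> ?thesis"
  then have "AE x in \<sigma>. \<not> True" using assms(2) by simp
  then show False using assms(1) emeasure_eq_0_AE[of "\<lambda>_. True" \<sigma>] by simp
qed

text \<open>
  Let \<open>R\<close> and \<open>L\<close> be the shifts on \<open>K\<close> and on its complement,
  and let \<open>x\<close> be in $C_m^I$. If $S^j x$ is in $C_m^I$, then so is $R^j x$, because
  $R^j x$ takes its coordinates in \<open>K\<close> from $S^j x$ and the other ones from
  \<open>x\<close>. If $x = S^j y$ with \<open>y\<close> in $C_m^I$, then similarly $x = L^j u$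
  for some \<open>u\<close> in $C_m^I$. Both sets of points have masses at most $r^j$ times the mass
  of $C_m^I$, and the Borel-Cantelli lemma applies.
\<close>

lemma contraction_finite_visits:
  assumes K: "K \<subseteq> I" and r: "0 < r" "r < 1"
    and cK: "\<And>E. E \<in> sets \<sigma> \<Longrightarrow> emeasure \<sigma> (shift I K -` E \<inter> space \<sigma>) = ennreal r * emeasure \<sigma> E"
    and cL: "\<And>E. E \<in> sets \<sigma> \<Longrightarrow> emeasure \<sigma> E = ennreal r * emeasure \<sigma> (shift I (I - K) -` E \<inter> space \<sigma>)"
  shows "AE x in \<sigma>. finite_visits I x"
proof -
  let ?R = "shift I K" and ?L = "shift I (I - K)"
  have iterK: "emeasure \<sigma> ((?R ^^ j) -` E \<inter> space \<sigma>) = ennreal (r ^ j) * emeasure \<sigma> E" if E: "E \<in> sets \<sigma>" for E j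
  proof (induction j)
    case (Suc j)
    let ?B = "(?R ^^ j) -` E \<inter> space \<sigma>"
    have B: "?B \<in> sets \<sigma>" by (rule measurable_sets[OF shift_iter_measurable' E])
    have "(?R ^^ Suc j) -` E \<inter> space \<sigma> = ?R -` ?B \<inter> space \<sigma>"
      using shift_space space_\<sigma> by (auto simp: funpow_swap1)
    then have "emeasure \<sigma> ((?R ^^ Suc j) -` E \<inter> space \<sigma>) = ennreal r * (ennreal (r ^ j) * emeasure \<sigma> E)"
      using cK[OF B] Suc by (simp only:)
    moreover have "ennreal (r ^ Suc j) = ennreal r * ennreal (r ^ j)" using r by (simp add: ennreal_mult)
    ultimately show ?case by (simp only: mult.assoc)
  qed (use E sets.sets_into_space[OF E] in \<open>auto simp: Int_absorb2\<close>)
  have iterL: "emeasure \<sigma> E = ennreal (r ^ j) * emeasure \<sigma> ((?L ^^ j) -` E \<inter> space \<sigma>)" if E: "E \<in> sets \<sigma>" for E j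
  proof (induction j)
    case (Suc j)
    let ?B = "(?L ^^ j) -` E \<inter> space \<sigma>"
    have B: "?B \<in> sets \<sigma>" by (rule measurable_sets[OF shift_iter_measurable' E])
    have eq: "(?L ^^ Suc j) -` E \<inter> space \<sigma> = ?L -` ?B \<inter> space \<sigma>"
      using shift_space space_\<sigma> by (auto simp: funpow_swap1)
    have "emeasure \<sigma> E = ennreal (r ^ j) * emeasure \<sigma> ?B" by (rule Suc)
    also have "\<dots> = ennreal (r ^ j) * (ennreal r * emeasure \<sigma> (?L -` ?B \<inter> space \<sigma>))"
      using cL[OF B] by simp
    also have "\<dots> = ennreal (r ^ Suc j) * emeasure \<sigma> ((?L ^^ Suc j) -` E \<inter> space \<sigma>)"
      unfolding eq using r by (simp add: ennreal_mult mult.assoc mult.commute mult.left_commute)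
    finally show ?case .
  qed (use E sets.sets_into_space[OF E] in \<open>auto simp: Int_absorb2\<close>)
  have bc: "AE x in \<sigma>. \<forall>m. eventually (\<lambda>j. x \<notin> A m j) sequentially"
    if A: "\<And>m j. A m j \<in> sets \<sigma>" and le: "\<And>m j. emeasure \<sigma> (A m j) \<le> ennreal (r ^ j) * emeasure \<sigma> (halves I m)"
    for A :: "nat \<Rightarrow> nat \<Rightarrow> ('i \<Rightarrow> real) set"
  proof (intro AE_all_countable[THEN iffD2] allI AE_eventually_not_in A)
    fix m j
    have e: "ennreal (r ^ j) * emeasure \<sigma> (halves I m) = ennreal (r ^ j * measure \<sigma> (halves I m))" for j
      using emeasure_halves_finite[of m] r by (simp add: emeasure_eq_ennreal_measure ennreal_mult)
    show "emeasure \<sigma> (A m j) < \<infinity>" using le[of m j] unfolding e by (simp add: order_le_less_trans)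
    have "measure \<sigma> (A m j) \<le> r ^ j * measure \<sigma> (halves I m)" for j
      using le[of m j] r unfolding e measure_def by (simp add: enn2real_leI)
    moreover have "summable (\<lambda>j. r ^ j * measure \<sigma> (halves I m))"
      using r by (intro summable_mult2 summable_geometric) auto
    ultimately show "summable (\<lambda>j. measure \<sigma> (A m j))"
      by (elim summable_comparison_test'[where N = 0]) auto
  qed
  have AE1: "AE x in \<sigma>. \<forall>m. eventually (\<lambda>j. x \<notin> halves I m \<inter> ((?R ^^ j) -` halves I m \<inter> space \<sigma>)) sequentially"
  proof (rule bc)
    fix m j
    have S: "(?R ^^ j) -` halves I m \<inter> space \<sigma> \<in> sets \<sigma>"
      by (rule measurable_sets[OF shift_iter_measurable' halves_measurable])
    then show "halves I m \<inter> ((?R ^^ j) -` halves I m \<inter> space \<sigma>) \<in> sets \<sigma>" using halves_measurable by blast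
    show "emeasure \<sigma> (halves I m \<inter> ((?R ^^ j) -` halves I m \<inter> space \<sigma>)) \<le> ennreal (r ^ j) * emeasure \<sigma> (halves I m)"
      unfolding iterK[OF halves_measurable, symmetric] using S by (intro emeasure_mono) auto
  qed
  have AE2: "AE x in \<sigma>. \<forall>m. eventually (\<lambda>j. x \<notin> halves I m \<inter> (?L ^^ j) ` halves I m) sequentially"
  proof (rule bc)
    fix m j
    let ?G = "halves I m \<inter> (?L ^^ j) ` halves I m"
    have "(?L ^^ j) ` halves I m \<in> sets \<sigma>"
      using shift_iter_image_sets[OF finite_I halves_sets[OF finite_I]] sets_\<sigma> by simp
    then show G: "?G \<in> sets \<sigma>" using halves_measurable by blast
    have "(?L ^^ j) -` ?G \<inter> space \<sigma> \<subseteq> halves I m"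
      using halves_space[of I m] shift_iter_inj[where I = I and K = "I - K" and j = j] space_\<sigma> by (auto dest!: inj_onD)
    then have "emeasure \<sigma> ((?L ^^ j) -` ?G \<inter> space \<sigma>) \<le> emeasure \<sigma> (halves I m)"
      by (intro emeasure_mono halves_measurable)
    then show "emeasure \<sigma> ?G \<le> ennreal (r ^ j) * emeasure \<sigma> (halves I m)"
      by (subst iterL[OF G, of j]) (rule mult_left_mono, auto)
  qed
  show ?thesis using AE1 AE2 AE_space
  proof eventually_elim
    case (elim x)
    have xs: "x \<in> space (powX I)" using elim(3) space_\<sigma> by simp
    then have xe: "x \<in> extensional I" by (simp add: space_powX_iff)
    have up: "\<exists>m'\<ge>m. x \<in> halves I m'" for m using ex_halves[OF finite_I xs] by blast
    show ?case
    proof (rule finite_visitsI[OF finite_I xs])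
      fix m
      obtain m' where m': "m' \<ge> m" "x \<in> halves I m'" using up by blast
      note mono = halves_mono[OF m'(1), of I]
      have "eventually (\<lambda>j. x \<notin> halves I m' \<inter> ((?R ^^ j) -` halves I m' \<inter> space \<sigma>)) sequentially" using elim(1) by blast
      then show "eventually (\<lambda>j. (S ^^ j) x \<notin> halves I m) sequentially"
      proof eventually_elim
        case (elim j)
        show ?case
        proof
          assume "(S ^^ j) x \<in> halves I m"
          then have y: "(S ^^ j) x \<in> halves I m'" using mono by blast
          have "(?R ^^ j) x \<in> halves I m'"
            using y m'(2) unfolding shift_iter[OF xe] chacon_pow_iter[OF xe] by (auto simp: halves_iff)
          then show False using elim m'(2) xs space_\<sigma> by auto
        qed
      qed
      have "eventually (\<lambda>j. x \<notin> halves I m' \<inter> (?L ^^ j) ` halves I m') sequentially" using elim(2) by blast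
      then show "eventually (\<lambda>j. x \<notin> (S ^^ j) ` halves I m) sequentially"
      proof eventually_elim
        case (elim j)
        show ?case
        proof
          assume "x \<in> (S ^^ j) ` halves I m"
          then obtain y where y: "y \<in> halves I m'" "x = (S ^^ j) y" using mono by blast
          have ye: "y \<in> extensional I" using y by (simp add: halves_iff)
          \<comment> \<open>As \<open>L\<close> moves only the coordinates outside \<open>K\<close>, its \<open>j\<close>-th iterate maps this point to \<open>x\<close>.\<close>
          define u where "u = (\<lambda>i\<in>I. if i \<in> K then x i else y i)"
          have uh: "u \<in> halves I m'" using y(1) m'(2) by (auto simp: halves_iff u_def)
          have ue: "u \<in> extensional I" by (simp add: u_def)
          have "x = (?L ^^ j) u"
            unfolding shift_iter[OF ue]
          proof (rule extensionalityI[OF xe])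
            fix i assume i: "i \<in> I"
            have "x i = (chacon ^^ j) (y i)" using y(2) chacon_pow_iter[OF ye] i by simp
            then show "x i = (\<lambda>i\<in>I. if i \<in> I - K then (chacon ^^ j) (u i) else u i) i"
              using i by (simp add: u_def)
          qed simp
          then show False using elim m'(2) uh by blast
        qed
      qed
    qed
  qed
qed

end

context ergodic_power
begin

text \<open>
  Along the splitting steps, \<open>visits_split\<close> and the ratio theorem show that the number of
  visits to a fixed box \<open>B\<close> is asymptotically multiplied by
  \<open>1 + \<kappa>\<close>, where \<open>\<kappa>\<close> is the mass ratio of the raised box
  \<open>A\<close> to \<open>B\<close>. The growth factor of the visits is the same for every box, so
  \<open>\<kappa>\<close> does not depend on the box.
\<close>

lemma splits_scaling:
  assumes x: "generic x" and KI: "K \<subseteq> I" and sp: "splits I K x"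
  shows "\<exists>\<kappa>>0. \<forall>m. \<forall>a\<in>half_index I m. (\<forall>i\<in>K. 1 \<le> a i) \<longrightarrow>
      measure \<sigma> (tbox I m a) = \<kappa> * measure \<sigma> (tbox I m (lower I K a))"
proof -
  have xs: "x \<in> space (powX I)" using generic_space[OF x] space_\<sigma> by simp
  obtain m0 where m0: "x \<in> halves I m0" "\<forall>i\<in>I. pos m0 (x i) + 1 < height m0 div 2"
    using ex_halves[OF finite_I xs, of 0 1] by blast
  define b where "b = posv I m0 x"
  \<comment> \<open>The box \<open>b\<close> of \<open>x\<close> is obtained by lowering \<open>a0\<close>.\<close>
  define a0 where "a0 = (\<lambda>i\<in>I. if i \<in> K then b i + 1 else b i)"
  have b: "b \<in> half_index I m0" unfolding b_def by (rule posv_half_index[OF m0(1)])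
  have "a0 i < height m0 div 2" if "i \<in> I" for i
    using m0(2) half_index_less[OF b that] that by (auto simp: a0_def b_def posv_def)
  then have a0: "a0 \<in> half_index I m0" by (auto simp: half_index_def a0_def)
  have la0: "lower I K a0 = b" using b by (auto simp: lower_def a0_def half_index_def PiE_iff extensional_def fun_eq_iff)
  let ?B = "tbox I m0 b" and ?A = "tbox I m0 a0"
  have Bpos: "0 < measure \<sigma> ?B" unfolding b_def by (rule generic_box_pos[OF x m0(1)])
  define \<kappa> where "\<kappa> = measure \<sigma> ?A / measure \<sigma> ?B"
  obtain s :: "nat \<Rightarrow> nat" where s0: "strict_mono s \<and> (\<forall>n. s n \<in> {n. splitting_step I K n x})"
    using infinite_enumerate[OF sp[unfolded splits_def]] by (rule exE)
  then have s: "strict_mono s" "\<And>n. splitting_step I K (s n) x" by simp_all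
  have s': "strict_mono (\<lambda>n. Suc (s n))" using s(1) by (simp add: strict_mono_def)
  have split: "visits I (Suc (s n)) x (tbox I m (lower I K a))
       = visits I (s n) x (tbox I m (lower I K a)) + visits I (s n) x (tbox I m a)"
    if "m \<le> n" "a \<in> half_index I m" "\<forall>i\<in>K. 1 \<le> a i" for m n a
  proof -
    interpret splitting_step I K "s n" x by (rule s(2))
    show ?thesis using that seq_suble[OF s(1), of n] by (intro visits_split) auto
  qed
  have a01: "\<forall>i\<in>K. 1 \<le> a0 i" using KI by (auto simp: a0_def)
  have lim: "(\<lambda>n. visits I (s n) x (tbox I m a) / visits I (s n) x ?B) \<longlonglongrightarrow> measure \<sigma> (tbox I m a) / measure \<sigma> ?B"
    and lim': "(\<lambda>n. visits I (Suc (s n)) x (tbox I m a) / visits I (Suc (s n)) x ?B) \<longlonglongrightarrow> measure \<sigma> (tbox I m a) / measure \<sigma> ?B"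
    if "a \<in> half_index I m" for m a
    using LIMSEQ_subseq_LIMSEQ[OF generic_ratio[OF x that b Bpos] s(1)]
      LIMSEQ_subseq_LIMSEQ[OF generic_ratio[OF x that b Bpos] s'] by (simp_all add: o_def)
  have evB: "eventually (\<lambda>n. 0 < visits I (s n) x ?B) sequentially"
    using eventually_subseq[OF s(1) generic_visits_pos[OF x b Bpos]] .
  have evB': "eventually (\<lambda>n. 0 < visits I (Suc (s n)) x ?B) sequentially"
    using eventually_subseq[OF s' generic_visits_pos[OF x b Bpos]] .
  have growth: "(\<lambda>n. visits I (Suc (s n)) x ?B / visits I (s n) x ?B) \<longlonglongrightarrow> 1 + \<kappa>"
  proof (rule Lim_transform_eventually)
    show "(\<lambda>n. 1 + visits I (s n) x ?A / visits I (s n) x ?B) \<longlonglongrightarrow> 1 + \<kappa>"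
      unfolding \<kappa>_def by (intro tendsto_intros lim a0)
    show "eventually (\<lambda>n. 1 + visits I (s n) x ?A / visits I (s n) x ?B = visits I (Suc (s n)) x ?B / visits I (s n) x ?B) sequentially"
      using evB eventually_ge_at_top[of m0]
    proof eventually_elim
      case (elim n)
      have "visits I (Suc (s n)) x ?B = visits I (s n) x ?B + visits I (s n) x ?A"
        using split[OF elim(2) a0 a01] by (simp add: la0)
      then show ?case using elim(1) by (simp add: field_simps)
    qed
  qed
  have main: "measure \<sigma> (tbox I m a) = \<kappa> * measure \<sigma> (tbox I m (lower I K a))"
    if a: "a \<in> half_index I m" "\<forall>i\<in>K. 1 \<le> a i" for m a
  proof -
    let ?C = "tbox I m a" and ?C' = "tbox I m (lower I K a)"
    note a' = lower_half_index[OF a(1), of K]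
    have "(\<lambda>n. (visits I (Suc (s n)) x ?C' / visits I (Suc (s n)) x ?B) * (visits I (Suc (s n)) x ?B / visits I (s n) x ?B))
        \<longlonglongrightarrow> measure \<sigma> ?C' / measure \<sigma> ?B * (1 + \<kappa>)"
      by (intro tendsto_mult lim' a' growth)
    moreover have "(\<lambda>n. (visits I (Suc (s n)) x ?C' / visits I (Suc (s n)) x ?B) * (visits I (Suc (s n)) x ?B / visits I (s n) x ?B))
        \<longlonglongrightarrow> measure \<sigma> ?C' / measure \<sigma> ?B + measure \<sigma> ?C / measure \<sigma> ?B"
    proof (rule Lim_transform_eventually)
      show "(\<lambda>n. visits I (s n) x ?C' / visits I (s n) x ?B + visits I (s n) x ?C / visits I (s n) x ?B)
          \<longlonglongrightarrow> measure \<sigma> ?C' / measure \<sigma> ?B + measure \<sigma> ?C / measure \<sigma> ?B"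
        by (intro tendsto_add lim a a')
      show "eventually (\<lambda>n. visits I (s n) x ?C' / visits I (s n) x ?B + visits I (s n) x ?C / visits I (s n) x ?B =
         (visits I (Suc (s n)) x ?C' / visits I (Suc (s n)) x ?B) * (visits I (Suc (s n)) x ?B / visits I (s n) x ?B)) sequentially"
        using evB' eventually_ge_at_top[of m]
      proof eventually_elim
        case (elim n)
        have "X / visits I (Suc (s n)) x ?B * (visits I (Suc (s n)) x ?B / c) = X / c" for X c
          using elim(1) by simp
        then have eq: "visits I (Suc (s n)) x ?C' / visits I (Suc (s n)) x ?B * (visits I (Suc (s n)) x ?B / visits I (s n) x ?B)
            = visits I (Suc (s n)) x ?C' / visits I (s n) x ?B" .
        show ?case by (subst eq) (simp only: split[OF elim(2) a] add_divide_distrib)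
      qed
    qed
    ultimately have "measure \<sigma> ?C' / measure \<sigma> ?B * (1 + \<kappa>) = measure \<sigma> ?C' / measure \<sigma> ?B + measure \<sigma> ?C / measure \<sigma> ?B"
      by (rule LIMSEQ_unique)
    then show ?thesis using Bpos by (simp add: field_simps)
  qed
  have "\<kappa> > 0"
  proof -
    have "eventually (\<lambda>n. x \<in> halves I n \<and> (\<forall>i\<in>I. 1 \<le> pos n (x i))) sequentially"
      using x by (intro eventually_halves_positive finite_I xs) (auto simp: generic_def)
    then obtain m where m: "x \<in> halves I m" "\<And>i. i \<in> I \<Longrightarrow> 1 \<le> pos m (x i)"
      unfolding eventually_sequentially by blast
    have "0 < \<kappa> * measure \<sigma> (tbox I m (lower I K (posv I m x)))"
      using main[OF posv_half_index[OF m(1)]] generic_box_pos[OF x m(1)] m(2) KI by (auto simp: posv_def subset_iff)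
    then show ?thesis by (simp add: zero_less_mult_iff)
  qed
  then show ?thesis using main by blast
qed

text \<open>
  The boxes that can be lowered cover all points whose coordinates in \<open>K\<close> are nonzero,
  and the others are null both for \<open>\<sigma>\<close> and for its image.
\<close>

lemma scaling_measurable:
  assumes KI: "K \<subseteq> I" and k0: "0 < \<kappa>"
    and sc: "\<And>m a. a \<in> half_index I m \<Longrightarrow> (\<forall>i\<in>K. 1 \<le> a i) \<Longrightarrow>
      measure \<sigma> (tbox I m a) = \<kappa> * measure \<sigma> (tbox I m (lower I K a))"
    and E: "E \<in> sets \<sigma>"
  shows "emeasure \<sigma> E = ennreal \<kappa> * emeasure \<sigma> (shift I K -` E \<inter> space \<sigma>)"
proof -
  let ?N = "distr (density \<sigma> (\<lambda>_. ennreal \<kappa>)) (powX I) (shift I K)"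
  have sm: "shift I K \<in> measurable (density \<sigma> (\<lambda>_. ennreal \<kappa>)) (powX I)"
    using shift_measurable'(1) by simp
  have em: "emeasure ?N B = ennreal \<kappa> * emeasure \<sigma> (shift I K -` B \<inter> space \<sigma>)" if "B \<in> sets (powX I)" for B
    using measurable_sets[OF shift_measurable'(1) that]
    by (subst emeasure_distr[OF sm that]) (simp add: emeasure_density_const)
  let ?E = "{tbox I m a |m a. a \<in> half_index I m \<and> (\<forall>i\<in>K. 1 \<le> a i)}"
  have inE: "eventually (\<lambda>n. tbox I n (posv I n y) \<in> ?E) sequentially"
    if y: "y \<in> space (powX I)" "\<And>i. i \<in> K \<Longrightarrow> y i \<noteq> 0" for y
  proof -
    have "eventually (\<lambda>n. y \<in> halves I n \<and> (\<forall>i\<in>K. 1 \<le> pos n (y i))) sequentially"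
      by (rule eventually_halves_positive[OF finite_I y(1) KI]) (rule y(2))
    then show ?thesis
    proof eventually_elim
      case (elim n)
      then have "posv I n y \<in> half_index I n" "\<forall>i\<in>K. 1 \<le> posv I n y i"
        using posv_half_index[of y I n] KI by (auto simp: posv_def)
      then show ?case by blast
    qed
  qed
  have cover: "y \<in> \<Union>?E" if y: "y \<in> space (powX I)" "\<And>i. i \<in> K \<Longrightarrow> y i \<noteq> 0" for y
  proof -
    obtain n where "tbox I n (posv I n y) \<in> ?E" "y \<in> halves I n"
      using eventually_conj[OF inE[OF y] eventually_halves[OF finite_I y(1), of 0]]
      unfolding eventually_sequentially by blast
    then show ?thesis using in_tbox_posv by blast
  qed
  have EB: "?E \<subseteq> boxes I" using half_tbox_in_boxes by blast
  have Em: "\<Union>?E \<in> sets (powX I)"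
    using boxes_sets[OF finite_I] EB by (intro sets.countable_Union countable_subset[OF EB countable_boxes[OF finite_I]]) auto
  have "\<sigma> = ?N"
  proof (rule tbox_measure_unique[OF finite_I sets_\<sigma> _ EB])
    show "sets ?N = sets (powX I)" by simp
    fix y assume "y \<in> \<Union>?E"
    then obtain m a where a: "a \<in> half_index I m" "\<forall>i\<in>K. 1 \<le> a i" "y \<in> tbox I m a" by blast
    have ym: "y \<in> halves I m" "posv I m y = a" using half_tbox_iff[OF a(1)] a(3) by auto
    have "tbox I n (posv I n y) \<in> ?E" if n: "m \<le> n" for n
    proof -
      have yn: "y \<in> halves I n" using halves_mono[OF n, of I] ym by blast
      have "1 \<le> posv I n y i" if i: "i \<in> K" for i
      proof -
        have iI: "i \<in> I" using i KI by blast
        have "pos m (y i) = a i" using fun_cong[OF ym(2), of i] iI by (simp add: posv_def)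
        then show ?thesis using pos_positive_finer[OF n halves_covered[OF ym(1) iI]] a(2) i iI by (simp add: posv_def)
      qed
      then show ?thesis using posv_half_index[OF yn] by blast
    qed
    then show "eventually (\<lambda>n. tbox I n (posv I n y) \<in> ?E) sequentially"
      unfolding eventually_sequentially by blast
  next
    have "AE y in \<sigma>. \<forall>i\<in>K. y i \<noteq> 0"
      by (rule AE_finite_allI[OF finite_subset[OF KI finite_I]]) (rule AE_nonzero, use KI in blast)
    then show "AE y in \<sigma>. y \<in> \<Union>?E"
      using AE_space by eventually_elim (intro cover, auto simp: space_\<sigma>)
    have "shift I K y \<in> \<Union>?E" if y: "y \<in> space \<sigma>" for y
    proof (rule cover)
      show "shift I K y \<in> space (powX I)" using y space_\<sigma> by (intro shift_space) simp
      show "shift I K y i \<noteq> 0" if "i \<in> K" for i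
      proof -
        have "i \<in> I" using that KI by blast
        then show ?thesis using that y chacon_positive[of "y i"] by (simp add: shift_def space_\<sigma> space_powX_iff)
      qed
    qed
    then have "AE y in density \<sigma> (\<lambda>_. ennreal \<kappa>). shift I K y \<in> \<Union>?E"
      by (intro AE_I2) simp
    moreover have "{y \<in> space (powX I). y \<in> \<Union>?E} \<in> sets (powX I)"
      using sets.Int_space_eq2[OF Em] Em by (simp add: Int_def conj_commute)
    ultimately show "AE y in ?N. y \<in> \<Union>?E" by (subst AE_distr_iff[OF sm]) auto
  next
    fix B assume "B \<in> ?E"
    then obtain m a where a: "a \<in> half_index I m" "\<forall>i\<in>K. 1 \<le> a i" "B = tbox I m a" by blast
    show "emeasure \<sigma> B \<noteq> \<infinity>" using half_box_finite[OF a(1)] a(3) by simp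
    note a' = lower_half_index[OF a(1), of K]
    have ls: "tbox I m (lower I K a) \<subseteq> space \<sigma>" using half_box_measurable[OF a'] by (rule sets.sets_into_space)
    have "shift I K -` B \<inter> space \<sigma> = tbox I m (lower I K a)"
      using shift_tbox[of _ I a m K] half_index_less_height[OF a(1)] a(2,3) ls space_\<sigma> by auto
    then have "emeasure ?N B = ennreal \<kappa> * emeasure \<sigma> (tbox I m (lower I K a))"
      using em[of B] half_box_measurable[OF a(1)] a(3) sets_\<sigma> by simp
    also have "\<dots> = ennreal (\<kappa> * measure \<sigma> (tbox I m (lower I K a)))"
      using half_box_finite[OF a'] k0 by (simp add: emeasure_eq_ennreal_measure ennreal_mult)
    also have "\<dots> = ennreal (measure \<sigma> B)" using sc[OF a(1,2)] a(3) by simp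
    also have "\<dots> = emeasure \<sigma> B" using half_box_finite[OF a(1)] a(3) by (simp add: emeasure_eq_ennreal_measure)
    finally show "emeasure \<sigma> B = emeasure ?N B" by simp
  qed
  then have "emeasure \<sigma> E = emeasure ?N E" by simp
  then show ?thesis using em[of E] E sets_\<sigma> by simp
qed

text \<open>
  The two partial shifts compose to the full one, which preserves the measure, so their effects on
  masses are inverse to each other.
\<close>

lemma scaling_complement:
  assumes KI: "K \<subseteq> I"
    and sc: "\<And>E. E \<in> sets \<sigma> \<Longrightarrow> emeasure \<sigma> E = ennreal \<kappa> * emeasure \<sigma> (shift I K -` E \<inter> space \<sigma>)"
    and E: "E \<in> sets \<sigma>"
  shows "emeasure \<sigma> (shift I (I - K) -` E \<inter> space \<sigma>) = ennreal \<kappa> * emeasure \<sigma> E"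
proof -
  let ?L = "shift I (I - K)"
  have L: "?L -` E \<inter> space \<sigma> \<in> sets \<sigma>" by (rule measurable_sets[OF shift_measurable'(2) E])
  have "S x = ?L (shift I K x)" for x
    using KI by (auto simp: chacon_pow_def shift_def fun_eq_iff)
  then have "shift I K -` (?L -` E \<inter> space \<sigma>) \<inter> space \<sigma> = S -` E \<inter> space \<sigma>"
    using shift_space space_\<sigma> by auto
  then show ?thesis using sc[OF L] emeasure_S_iter[OF E, of 1] by simp
qed

text \<open>
  If \<open>\<kappa>\<close> were greater than 1, the shift on \<open>K\<close> would contract
  preimages, and if it were less than 1, the shift on the complement would. Either way almost all
  points would have finite visits, contradicting \<open>splits_unbounded\<close>.
\<close>

lemma diagonal_or_partially_invariant:
  assumes nz: "emeasure \<sigma> (space \<sigma>) \<noteq> 0"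
  shows "diagonal_measure I \<sigma> \<or> (\<exists>K\<subseteq>I. K \<noteq> {} \<and> K \<noteq> I \<and>
      (\<forall>E\<in>sets \<sigma>. emeasure \<sigma> (shift I K -` E \<inter> space \<sigma>) = emeasure \<sigma> E))"
proof (cases "\<exists>x. generic x \<and> diagonal_point I x")
  case True
  then show ?thesis using diagonal_measureI by blast
next
  case False
  have unb: "\<not> finite_visits I x" if x: "generic x" for x
  proof -
    have xs: "x \<in> space (powX I)" using generic_space[OF x] space_\<sigma> by simp
    obtain K where "splits I K x" using splitting_alternative[OF finite_I xs] False x by blast
    then show ?thesis using splits_unbounded[OF finite_I xs] x by (auto simp: generic_def)
  qed
  have no: "\<not> (AE x in \<sigma>. finite_visits I x)"
  proof
    assume "AE x in \<sigma>. finite_visits I x"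
    with AE_generic have "AE x in \<sigma>. generic x \<and> finite_visits I x" by eventually_elim simp
    from ex_of_AE[OF nz this] show False using unb by blast
  qed
  obtain x where x: "generic x" using ex_of_AE[OF nz AE_generic] by blast
  have xs: "x \<in> space (powX I)" using generic_space[OF x] space_\<sigma> by simp
  obtain K where K: "K \<subseteq> I" "K \<noteq> {}" "K \<noteq> I" "splits I K x"
    using splitting_alternative[OF finite_I xs] False x by blast
  obtain \<kappa> where k: "\<kappa> > 0" "\<And>m a. a \<in> half_index I m \<Longrightarrow> (\<forall>i\<in>K. 1 \<le> a i) \<Longrightarrow>
      measure \<sigma> (tbox I m a) = \<kappa> * measure \<sigma> (tbox I m (lower I K a))"
    using splits_scaling[OF x K(1,4)] by blast
  have sc: "emeasure \<sigma> E = ennreal \<kappa> * emeasure \<sigma> (shift I K -` E \<inter> space \<sigma>)" if "E \<in> sets \<sigma>" for E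
    by (rule scaling_measurable[OF K(1) k(1) _ that]) (rule k(2))
  have sc': "emeasure \<sigma> (shift I (I - K) -` E \<inter> space \<sigma>) = ennreal \<kappa> * emeasure \<sigma> E" if "E \<in> sets \<sigma>" for E
    by (rule scaling_complement[OF K(1) _ that]) (rule sc)
  have "\<kappa> = 1"
  proof (rule ccontr)
    assume "\<kappa> \<noteq> 1"
    then consider "\<kappa> > 1" | "\<kappa> < 1" by linarith
    then show False
    proof cases
      case 1
      have inv: "ennreal (1 / \<kappa>) * (ennreal \<kappa> * c) = c" for c
        using k(1) by (simp add: mult.assoc[symmetric] ennreal_mult[symmetric])
      have "AE x in \<sigma>. finite_visits I x"
      proof (rule contraction_finite_visits[OF K(1), of "1 / \<kappa>"])
        fix E assume E: "E \<in> sets \<sigma>"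
        show "emeasure \<sigma> (shift I K -` E \<inter> space \<sigma>) = ennreal (1 / \<kappa>) * emeasure \<sigma> E"
          by (subst sc[OF E]) (simp only: inv)
        show "emeasure \<sigma> E = ennreal (1 / \<kappa>) * emeasure \<sigma> (shift I (I - K) -` E \<inter> space \<sigma>)"
          by (subst sc'[OF E]) (simp only: inv)
      qed (use 1 in auto)
      then show False using no by simp
    next
      case 2
      have "AE x in \<sigma>. finite_visits I x"
      proof (rule contraction_finite_visits[of "I - K" \<kappa>])
        have KK: "I - (I - K) = K" using K(1) by blast
        fix E assume E: "E \<in> sets \<sigma>"
        show "emeasure \<sigma> (shift I (I - K) -` E \<inter> space \<sigma>) = ennreal \<kappa> * emeasure \<sigma> E" by (rule sc'[OF E])
        show "emeasure \<sigma> E = ennreal \<kappa> * emeasure \<sigma> (shift I (I - (I - K)) -` E \<inter> space \<sigma>)"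
          unfolding KK by (rule sc[OF E])
      qed (use 2 k(1) in auto)
      then show False using no by simp
    qed
  qed
  then have "\<forall>E\<in>sets \<sigma>. emeasure \<sigma> (shift I K -` E \<inter> space \<sigma>) = emeasure \<sigma> E" using sc by simp
  then show ?thesis using K by blast
qed

section \<open>Totally dissipative systems\<close>

text \<open>
  The preimages of a wandering set \<open>W\<close> are disjoint. Pulling back the events $x \in W$,
  $S^j x \in C_m^I$ (for \<open>j < N\<close>) to preimages of \<open>W\<close> inside
  $S^{-N} C_m^I$, and the events $x \in W \cap S^j C_m^I$ to preimages of \<open>W\<close>
  inside $C_m^I$, bounds the sums of their masses by the mass of $C_m^I$. So almost every point of
  \<open>W\<close> has finite visits, and \<open>W\<close> is not null because its saturation is not.
\<close>

lemma dissipative_diagonal: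
  assumes nz: "emeasure \<sigma> (space \<sigma>) \<noteq> 0" and diss: "totally_dissipative \<sigma> S"
  shows "diagonal_measure I \<sigma> \<and> supported_on_single_orbit \<sigma> S"
proof -
  obtain W where W: "W \<in> sets \<sigma>"
    and disj: "\<And>m n. m \<noteq> n \<Longrightarrow> ((S ^^ m) -` W \<inter> space \<sigma>) \<inter> ((S ^^ n) -` W \<inter> space \<sigma>) = {}"
    and sat: "AE x in \<sigma>. x \<in> saturation \<sigma> S W"
    using diss unfolding totally_dissipative_def wandering_def by blast
  have Wsp: "W \<subseteq> space \<sigma>" by (rule sets.sets_into_space[OF W])
  have img: "(S ^^ j) ` A \<in> sets \<sigma>" if "A \<in> sets \<sigma>" for A j
    using shift_iter_image_sets[where I = I and K = I and j = j, OF finite_I, of A] that sets_\<sigma> unfolding chacon_pow_eq_shift by simp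
  have inj: "inj_on (S ^^ j) (space \<sigma>)" for j
    unfolding chacon_pow_eq_shift space_\<sigma> by (rule shift_iter_inj)
  have pre: "(S ^^ j) -` A \<inter> space \<sigma> \<in> sets \<sigma>" if "A \<in> sets \<sigma>" for A j
    by (rule measurable_sets[OF S_iter_measurable that])
  have Wpos: "emeasure \<sigma> W \<noteq> 0"
  proof
    assume W0: "emeasure \<sigma> W = 0"
    have "(S ^^ j) -` W \<inter> space \<sigma> \<in> null_sets \<sigma>" for j
      using emeasure_S_iter[OF W] W0 pre[OF W] by (intro null_setsI) auto
    moreover have "(S ^^ j) ` W \<in> null_sets \<sigma>" for j
    proof (intro null_setsI img W)
      have "(S ^^ j) -` ((S ^^ j) ` W) \<inter> space \<sigma> = W"
        using inj[of j] Wsp by (auto dest: inj_onD)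
      then show "emeasure \<sigma> ((S ^^ j) ` W) = 0" using emeasure_S_iter[OF img[OF W], of j j] W0 by simp
    qed
    ultimately have "saturation \<sigma> S W \<in> null_sets \<sigma>"
      unfolding saturation_def by (intro null_sets.Un null_sets_UN) auto
    from AE_not_in[OF this] sat have "AE x in \<sigma>. False" by eventually_elim blast
    from ex_of_AE[OF nz this] show False by simp
  qed
  have Afin: "emeasure \<sigma> (halves I m) < \<infinity>" for m by (rule emeasure_halves_finite)
  have bc: "AE x in \<sigma>. \<forall>m. eventually (\<lambda>j. x \<notin> V m j) sequentially"
    if V: "\<And>m j. V m j \<in> sets \<sigma>"
      and P: "\<And>m N. \<exists>P. disjoint_family_on P {..<N} \<and>
        (\<forall>j<N. P j \<in> sets \<sigma> \<and> emeasure \<sigma> (P j) = emeasure \<sigma> (V m j)) \<and>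
        emeasure \<sigma> (\<Union>j<N. P j) \<le> emeasure \<sigma> (halves I m)" for V :: "nat \<Rightarrow> nat \<Rightarrow> ('i \<Rightarrow> real) set"
  proof (intro AE_all_countable[THEN iffD2] allI AE_eventually_not_in V)
    fix m j
    have part: "(\<Sum>j<N. emeasure \<sigma> (V m j)) \<le> emeasure \<sigma> (halves I m)" for N
    proof -
      obtain P where P: "disjoint_family_on P {..<N}" "\<forall>j<N. P j \<in> sets \<sigma> \<and> emeasure \<sigma> (P j) = emeasure \<sigma> (V m j)"
        "emeasure \<sigma> (\<Union>j<N. P j) \<le> emeasure \<sigma> (halves I m)" using P[of N m] by blast
      have "(\<Sum>j<N. emeasure \<sigma> (V m j)) = (\<Sum>j<N. emeasure \<sigma> (P j))" using P(2) by (intro sum.cong) auto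
      also have "\<dots> = emeasure \<sigma> (\<Union>j<N. P j)" using P(1,2) by (intro sum_emeasure) auto
      finally show ?thesis using P(3) by simp
    qed
    have fin: "emeasure \<sigma> (V m j) < \<infinity>" for j
    proof -
      have "emeasure \<sigma> (V m j) \<le> (\<Sum>i<Suc j. emeasure \<sigma> (V m i))" by simp
      also have "\<dots> \<le> emeasure \<sigma> (halves I m)" by (rule part)
      also have "\<dots> < \<infinity>" by (rule Afin)
      finally show ?thesis .
    qed
    then show "emeasure \<sigma> (V m j) < \<infinity>" .
    show "summable (\<lambda>j. measure \<sigma> (V m j))"
    proof (rule bounded_imp_summable)
      fix N
      have "ennreal (\<Sum>j\<le>N. measure \<sigma> (V m j)) = (\<Sum>j\<le>N. emeasure \<sigma> (V m j))"
        using fin by (subst sum_ennreal[symmetric]) (auto intro!: sum.cong simp: emeasure_eq_ennreal_measure less_top)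
      also have "\<dots> \<le> ennreal (measure \<sigma> (halves I m))"
        using part[of "Suc N"] Afin[of m] by (simp add: emeasure_eq_ennreal_measure lessThan_Suc_atMost)
      finally show "(\<Sum>j\<le>N. measure \<sigma> (V m j)) \<le> measure \<sigma> (halves I m)"
        by (simp add: ennreal_le_iff)
    qed simp
  qed
  have fw: "AE x in \<sigma>. \<forall>m. eventually (\<lambda>j. x \<notin> W \<inter> ((S ^^ j) -` halves I m \<inter> space \<sigma>)) sequentially"
  proof (rule bc)
    fix m N :: nat
    let ?V = "\<lambda>j. W \<inter> ((S ^^ j) -` halves I m \<inter> space \<sigma>)"
    show V: "?V j \<in> sets \<sigma>" for j using W pre[OF halves_measurable] by blast
    \<comment> \<open>The exponent \<open>N - j\<close> puts all events inside the same set $S^{-N} C_m^I$.\<close>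
    let ?P = "\<lambda>j. (S ^^ (N - j)) -` ?V j \<inter> space \<sigma>"
    have "disjoint_family_on ?P {..<N}"
      unfolding disjoint_family_on_def
    proof (intro ballI impI)
      fix i j assume ij: "i \<in> {..<N}" "j \<in> {..<N}" "i \<noteq> j"
      then have "N - i \<noteq> N - j" by auto
      from disj[OF this] show "?P i \<inter> ?P j = {}" by blast
    qed
    moreover have "\<forall>j<N. ?P j \<in> sets \<sigma> \<and> emeasure \<sigma> (?P j) = emeasure \<sigma> (?V j)"
      using pre[OF V] emeasure_S_iter[OF V] by blast
    moreover have "(\<Union>j<N. ?P j) \<subseteq> (S ^^ N) -` halves I m \<inter> space \<sigma>"
    proof
      fix x assume "x \<in> (\<Union>j<N. ?P j)"
      then obtain j where "j < N" "x \<in> space \<sigma>" "(S ^^ j) ((S ^^ (N - j)) x) \<in> halves I m" by auto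
      moreover from this have "(S ^^ j) ((S ^^ (N - j)) x) = (S ^^ N) x"
        using funpow_add[of j "N - j" S] by (simp add: fun_eq_iff)
      ultimately show "x \<in> (S ^^ N) -` halves I m \<inter> space \<sigma>" by simp
    qed
    then have "emeasure \<sigma> (\<Union>j<N. ?P j) \<le> emeasure \<sigma> (halves I m)"
      unfolding emeasure_S_iter[OF halves_measurable, of N m, symmetric]
      by (intro emeasure_mono pre halves_measurable)
    ultimately show "\<exists>P. disjoint_family_on P {..<N} \<and>
        (\<forall>j<N. P j \<in> sets \<sigma> \<and> emeasure \<sigma> (P j) = emeasure \<sigma> (?V j)) \<and>
        emeasure \<sigma> (\<Union>j<N. P j) \<le> emeasure \<sigma> (halves I m)" by (intro exI[of _ ?P]) blast
  qed
  have bw: "AE x in \<sigma>. \<forall>m. eventually (\<lambda>j. x \<notin> W \<inter> (S ^^ j) ` halves I m) sequentially"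
  proof (rule bc)
    fix m N :: nat
    let ?V = "\<lambda>j. W \<inter> (S ^^ j) ` halves I m"
    show V: "?V j \<in> sets \<sigma>" for j using W img[OF halves_measurable] by blast
    let ?P = "\<lambda>j. (S ^^ j) -` ?V j \<inter> space \<sigma>"
    have "disjoint_family_on ?P {..<N}"
      unfolding disjoint_family_on_def
    proof (intro ballI impI)
      fix i j :: nat assume ij: "i \<noteq> j"
      from disj[OF this] show "?P i \<inter> ?P j = {}" by blast
    qed
    moreover have "\<forall>j<N. ?P j \<in> sets \<sigma> \<and> emeasure \<sigma> (?P j) = emeasure \<sigma> (?V j)"
      using pre[OF V] emeasure_S_iter[OF V] by blast
    moreover have "(\<Union>j<N. ?P j) \<subseteq> halves I m"
    proof
      fix x assume "x \<in> (\<Union>j<N. ?P j)"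
      then obtain j u where u: "x \<in> space \<sigma>" "(S ^^ j) x = (S ^^ j) u" "u \<in> halves I m" by auto
      then have "u \<in> space \<sigma>" using halves_space space_\<sigma> by blast
      then show "x \<in> halves I m" using inj_onD[OF inj[of j]] u by blast
    qed
    then have "emeasure \<sigma> (\<Union>j<N. ?P j) \<le> emeasure \<sigma> (halves I m)"
      by (intro emeasure_mono halves_measurable)
    ultimately show "\<exists>P. disjoint_family_on P {..<N} \<and>
        (\<forall>j<N. P j \<in> sets \<sigma> \<and> emeasure \<sigma> (P j) = emeasure \<sigma> (?V j)) \<and>
        emeasure \<sigma> (\<Union>j<N. P j) \<le> emeasure \<sigma> (halves I m)" by (intro exI[of _ ?P]) blast
  qed
  have "AE x in \<sigma>. generic x \<and> (x \<in> W \<longrightarrow> finite_visits I x)"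
    using fw bw AE_generic
  proof eventually_elim
    case (elim x)
    have "finite_visits I x" if xW: "x \<in> W"
    proof (rule finite_visitsI[OF finite_I])
      show xs: "x \<in> space (powX I)" using generic_space[OF elim(3)] space_\<sigma> by simp
      fix m
      have "eventually (\<lambda>j. x \<notin> W \<inter> ((S ^^ j) -` halves I m \<inter> space \<sigma>)) sequentially" using elim(1) by blast
      then show "eventually (\<lambda>j. (S ^^ j) x \<notin> halves I m) sequentially"
        by (rule eventually_mono) (use xW xs space_\<sigma> in auto)
      have "eventually (\<lambda>j. x \<notin> W \<inter> (S ^^ j) ` halves I m) sequentially" using elim(2) by blast
      then show "eventually (\<lambda>j. x \<notin> (S ^^ j) ` halves I m) sequentially"
        by (rule eventually_mono) (use xW in auto)
    qed
    then show ?case using elim(3) by blast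
  qed
  then obtain x where x: "x \<in> W" "generic x" "finite_visits I x"
  proof (rule_tac ccontr)
    assume ae: "AE x in \<sigma>. generic x \<and> (x \<in> W \<longrightarrow> finite_visits I x)" and no: "\<not> thesis"
    have "AE x in \<sigma>. x \<notin> W" using ae by (rule AE_mp) (use no that in auto)
    moreover have "{x \<in> space \<sigma>. x \<in> W} = W" using Wsp by blast
    ultimately have "emeasure \<sigma> W = 0" using emeasure_eq_0_AE[of "\<lambda>x. x \<in> W" \<sigma>] by simp
    then show False using Wpos by simp
  qed
  have xs: "x \<in> space (powX I)" using generic_space[OF x(2)] space_\<sigma> by simp
  have "diagonal_point I x"
  proof (rule ccontr)
    assume "\<not> diagonal_point I x"
    then obtain K where "splits I K x" using splitting_alternative[OF finite_I xs] by blast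
    then show False using splits_unbounded[OF finite_I xs] x by (auto simp: generic_def)
  qed
  then show ?thesis using diagonal_measureI[OF x(2)] single_orbitI[OF x(2,3)] by blast
qed

end

section \<open>Slices of a partially invariant measure\<close>

definition cylinder :: "'i set \<Rightarrow> 'i set \<Rightarrow> ('i \<Rightarrow> real) set \<Rightarrow> ('i \<Rightarrow> real) set \<Rightarrow> ('i \<Rightarrow> real) set" where
  "cylinder I K A W = {x \<in> space (powX I). restrict x K \<in> A \<and> restrict x (I - K) \<in> W}"

text \<open>
  The measure \<open>A \<mapsto> c * \<sigma> (A \<times> W)\<close> on $X^K$. The constant
  \<open>c\<close> makes the masses of the two factors of a product match.
\<close>

definition slice :: "'i set \<Rightarrow> ('i \<Rightarrow> real) measure \<Rightarrow> 'i set \<Rightarrow> real \<Rightarrow> ('i \<Rightarrow> real) set \<Rightarrow> ('i \<Rightarrow> real) measure" where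
  "slice I \<sigma> K c W = distr (density \<sigma> (\<lambda>x. ennreal c * indicator (cylinder I K (space (powX K)) W) x))
     (powX K) (\<lambda>x. restrict x K)"

lemma restrict_measurable: "K \<subseteq> I \<Longrightarrow> (\<lambda>x. restrict x K) \<in> measurable (powX I) (powX K)"
  unfolding powX_def by (rule measurable_restrict_subset)

lemma cylinder_sets:
  assumes "K \<subseteq> I" "A \<in> sets (powX K)" "W \<in> sets (powX (I - K))"
  shows "cylinder I K A W \<in> sets (powX I)"
proof -
  have "cylinder I K A W = ((\<lambda>x. restrict x K) -` A \<inter> space (powX I)) \<inter> ((\<lambda>x. restrict x (I - K)) -` W \<inter> space (powX I))"
    by (auto simp: cylinder_def)
  also have "\<dots> \<in> sets (powX I)"
    using assms by (intro sets.Int measurable_sets[OF restrict_measurable]) auto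
  finally show ?thesis .
qed

lemma cylinder_swap: "K \<subseteq> I \<Longrightarrow> cylinder I (I - K) W A = cylinder I K A W"
  by (auto simp: cylinder_def double_diff)

lemma cylinder_tbox:
  assumes K: "K \<subseteq> I" and k: "\<And>i. i \<in> I \<Longrightarrow> k i < height n"
  shows "cylinder I K (tbox K n k) (tbox (I - K) n k) = tbox I n k"
proof (intro equalityI subsetI)
  fix x assume "x \<in> cylinder I K (tbox K n k) (tbox (I - K) n k)"
  then have x: "x \<in> space (powX I)" "restrict x K \<in> tbox K n k" "restrict x (I - K) \<in> tbox (I - K) n k"
    by (auto simp: cylinder_def)
  have "x i \<in> level n (k i)" if "i \<in> I" for i
    using x(2,3) that by (cases "i \<in> K") (auto simp: tbox_def PiE_iff)
  then show "x \<in> tbox I n k" using x(1) by (auto simp: tbox_def PiE_iff space_powX_iff)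
next
  fix x assume x: "x \<in> tbox I n k"
  have "0 \<le> x i" if "i \<in> I" for i
    using x that tbox_iff[of I k n x, OF k] covered_nonneg by auto
  then have "x \<in> space (powX I)" using x by (auto simp: tbox_def PiE_iff space_powX_iff)
  then show "x \<in> cylinder I K (tbox K n k) (tbox (I - K) n k)"
    using x K by (auto simp: cylinder_def tbox_def PiE_iff)
qed

lemma halves_sets_diff: "finite I \<Longrightarrow> halves (I - K) n \<in> sets (powX (I - K))"
  by (intro halves_sets) simp

context invariant_power
begin

lemma cylinder_measurable:
  assumes "K \<subseteq> I" "A \<in> sets (powX K)" "W \<in> sets (powX (I - K))"
  shows "cylinder I K A W \<in> sets \<sigma>"
  using cylinder_sets[OF assms] sets_\<sigma> by simp

lemma emeasure_slice:
  assumes K: "K \<subseteq> I" and W: "W \<in> sets (powX (I - K))" and A: "A \<in> sets (powX K)"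
  shows "emeasure (slice I \<sigma> K c W) A = ennreal c * emeasure \<sigma> (cylinder I K A W)"
proof -
  let ?D = "density \<sigma> (\<lambda>x. ennreal c * indicator (cylinder I K (space (powX K)) W) x)"
  have C: "cylinder I K (space (powX K)) W \<in> sets \<sigma>" by (rule cylinder_measurable[OF K sets.top W])
  have r: "(\<lambda>x. restrict x K) \<in> measurable \<sigma> (powX K)"
    using restrict_measurable[OF K] measurable_cong_sets[OF sets_\<sigma> refl] by blast
  then have r': "(\<lambda>x. restrict x K) \<in> measurable ?D (powX K)" by simp
  let ?P = "(\<lambda>x. restrict x K) -` A \<inter> space \<sigma>"
  have P: "?P \<in> sets \<sigma>" by (rule measurable_sets[OF r A])
  have "emeasure (slice I \<sigma> K c W) A = emeasure ?D ?P"
    unfolding slice_def by (subst emeasure_distr[OF r' A]) simp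
  also have "\<dots> = (\<integral>\<^sup>+x. ennreal c * indicator (cylinder I K (space (powX K)) W) x * indicator ?P x \<partial>\<sigma>)"
    using C P by (intro emeasure_density) auto
  also have "\<dots> = (\<integral>\<^sup>+x. ennreal c * indicator (cylinder I K A W) x \<partial>\<sigma>)"
    using sets.sets_into_space[OF A]
    by (intro nn_integral_cong) (auto simp: indicator_def cylinder_def space_\<sigma>)
  also have "\<dots> = ennreal c * emeasure \<sigma> (cylinder I K A W)"
    using cylinder_measurable[OF K A W] by (simp add: nn_integral_cmult_indicator)
  finally show ?thesis .
qed

end

context ergodic_power
begin

text \<open>
  Invariance comes from the partial shift, which does not move the coordinates outside
  \<open>K\<close>. An invariant set of $X^K$ lifts to an invariant set of $X^I$, hence is null or
  conull.
\<close>

lemma slice_ergodic: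
  assumes K: "K \<subseteq> I" "K \<noteq> {}"
    and inv: "\<forall>E\<in>sets \<sigma>. emeasure \<sigma> (shift I K -` E \<inter> space \<sigma>) = emeasure \<sigma> E"
    and W: "W \<in> sets (powX (I - K))" "W \<subseteq> halves (I - K) n"
  shows "ergodic_power K (slice I \<sigma> K c W)"
proof
  let ?\<nu> = "slice I \<sigma> K c W"
  show "finite K" using finite_I K(1) by (rule finite_subset[rotated])
  show "K \<noteq> {}" by (rule K)
  show sets: "sets ?\<nu> = sets (powX K)" by (simp add: slice_def)
  have space: "space ?\<nu> = space (powX K)" by (rule sets_eq_imp_space_eq[OF sets])
  have meas: "chacon_pow K \<in> measurable (powX K) (powX K)" unfolding chacon_pow_eq_shift by (rule shift_measurable)
  have em: "A \<in> sets ?\<nu> \<Longrightarrow> emeasure ?\<nu> A = ennreal c * emeasure \<sigma> (cylinder I K A W)" for A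
    using emeasure_slice[OF K(1) W(1)] sets by simp
  show "invariant_measure ?\<nu> (chacon_pow K)"
    unfolding invariant_measure_def
  proof (intro conjI ballI)
    show "chacon_pow K \<in> measurable ?\<nu> ?\<nu>" using meas measurable_cong_sets[OF sets sets] by blast
    fix A assume A: "A \<in> sets ?\<nu>"
    have A': "chacon_pow K -` A \<inter> space ?\<nu> \<in> sets ?\<nu>"
      using measurable_sets[OF meas, of A] A sets space by simp
    have "cylinder I K (chacon_pow K -` A \<inter> space ?\<nu>) W = shift I K -` cylinder I K A W \<inter> space \<sigma>"
    proof -
      have "restrict (shift I K x) K = chacon_pow K (restrict x K)" "restrict (shift I K x) (I - K) = restrict x (I - K)" for x
        using K(1) by (auto simp: shift_def chacon_pow_def fun_eq_iff)
      moreover have "restrict x K \<in> space (powX K)" if "x \<in> space (powX I)" for x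
        using measurable_space[OF restrict_measurable[OF K(1)] that] .
      ultimately show ?thesis unfolding cylinder_def using shift_space[of _ I K] space space_\<sigma> by auto
    qed
    then show "emeasure ?\<nu> (chacon_pow K -` A \<inter> space ?\<nu>) = emeasure ?\<nu> A"
      using em[OF A'] em[OF A] bspec[OF inv cylinder_measurable[OF K(1) _ W(1), of A]] A sets by simp
  qed
  show "boundedly_finite K ?\<nu>"
    unfolding boundedly_finite_def
  proof (intro ballI impI)
    fix A assume A: "A \<in> sets ?\<nu>" "\<exists>R. \<forall>x\<in>A. \<forall>i\<in>K. \<bar>x i\<bar> \<le> R"
    then obtain R where R: "\<forall>x\<in>A. \<forall>i\<in>K. \<bar>x i\<bar> \<le> R" by blast
    have "\<bar>x i\<bar> \<le> max R (real (height n) / 3 ^ n)" if x: "x \<in> cylinder I K A W" and i: "i \<in> I" for x i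
    proof (cases "i \<in> K")
      case True
      have "restrict x K \<in> A" using x by (simp add: cylinder_def)
      then have "\<bar>restrict x K i\<bar> \<le> R" using R True by blast
      then show ?thesis using True by simp
    next
      case False
      have "restrict x (I - K) \<in> halves (I - K) n" using x W(2) by (auto simp: cylinder_def)
      from halves_covered[OF this, of i] have "x i \<in> covered n" using False i by simp
      then show ?thesis using False i by (auto simp: covered_def)
    qed
    then have "\<exists>R. \<forall>x\<in>cylinder I K A W. \<forall>i\<in>I. \<bar>x i\<bar> \<le> R" by blast
    then have "emeasure \<sigma> (cylinder I K A W) < \<infinity>"
      using bdd_finite cylinder_measurable[OF K(1) _ W(1), of A] A(1) sets unfolding boundedly_finite_def by blast
    then show "emeasure ?\<nu> A < \<infinity>" unfolding em[OF A(1)] by (simp add: ennreal_mult_less_top)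
  qed
  show "ergodic ?\<nu> (chacon_pow K)"
    unfolding ergodic_def
  proof (intro ballI impI)
    fix A assume A: "A \<in> sets ?\<nu>" "chacon_pow K -` A \<inter> space ?\<nu> = A"
    let ?A = "(\<lambda>x. restrict x K) -` A \<inter> space (powX I)"
    have Am: "?A \<in> sets \<sigma>" using measurable_sets[OF restrict_measurable[OF K(1)], of A] A(1) sets sets_\<sigma> by simp
    have res: "restrict (S x) K = chacon_pow K (restrict x K)" for x
      using K(1) by (auto simp: chacon_pow_def fun_eq_iff)
    have sp: "restrict x K \<in> space (powX K)" if "x \<in> space (powX I)" for x
      using measurable_space[OF restrict_measurable[OF K(1)] that] .
    have iff: "chacon_pow K y \<in> A \<longleftrightarrow> y \<in> A" if "y \<in> space (powX K)" for y
      using A(2) that space by blast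
    have "S -` ?A \<inter> space \<sigma> = ?A"
      using iff[OF sp] S_space by (auto simp: space_\<sigma> res)
    then have "emeasure \<sigma> ?A = 0 \<or> emeasure \<sigma> (space \<sigma> - ?A) = 0" using erg Am unfolding ergodic_def by blast
    then show "emeasure ?\<nu> A = 0 \<or> emeasure ?\<nu> (space ?\<nu> - A) = 0"
    proof
      assume 0: "emeasure \<sigma> ?A = 0"
      have "emeasure \<sigma> (cylinder I K A W) \<le> emeasure \<sigma> ?A"
        using Am by (intro emeasure_mono) (auto simp: cylinder_def)
      then show ?thesis using em[OF A(1)] 0 by simp
    next
      assume 0: "emeasure \<sigma> (space \<sigma> - ?A) = 0"
      have "emeasure \<sigma> (cylinder I K (space ?\<nu> - A) W) \<le> emeasure \<sigma> (space \<sigma> - ?A)"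
        using sets.compl_sets[OF Am] by (intro emeasure_mono) (auto simp: cylinder_def space_\<sigma> space)
      then show ?thesis using em[of "space ?\<nu> - A"] A(1) 0 by (simp add: sets.compl_sets)
    qed
  qed
qed

text \<open>
  The slice over \<open>W\<close> is absolutely continuous with respect to the slice over the larger
  set \<open>halves (I - K) n\<close>. So some point is generic for both, and its visits have both
  ratios as their limit.
\<close>

lemma slices_proportional_aux:
  assumes K: "K \<subseteq> I" "K \<noteq> {}"
    and inv: "\<forall>E\<in>sets \<sigma>. emeasure \<sigma> (shift I K -` E \<inter> space \<sigma>) = emeasure \<sigma> E"
    and W: "W \<in> sets (powX (I - K))" "W \<subseteq> halves (I - K) n"
    and a: "a \<in> half_index K m" and b: "b \<in> half_index K p"
    and pos: "0 < measure \<sigma> (cylinder I K (tbox K p b) W)"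
  shows "measure \<sigma> (cylinder I K (tbox K m a) W) * measure \<sigma> (cylinder I K (tbox K p b) (halves (I - K) n))
       = measure \<sigma> (cylinder I K (tbox K m a) (halves (I - K) n)) * measure \<sigma> (cylinder I K (tbox K p b) W)"
proof -
  let ?V = "halves (I - K) n"
  let ?A = "tbox K m a" and ?B = "tbox K p b"
  let ?\<nu> = "slice I \<sigma> K 1 W" and ?\<mu> = "slice I \<sigma> K 1 ?V"
  have V: "?V \<in> sets (powX (I - K))" by (rule halves_sets_diff[OF finite_I])
  interpret \<nu>: ergodic_power K ?\<nu> by (rule slice_ergodic[OF K inv W])
  interpret \<mu>: ergodic_power K ?\<mu> by (rule slice_ergodic[OF K inv V order_refl])
  have em\<nu>: "emeasure ?\<nu> C = emeasure \<sigma> (cylinder I K C W)" if "C \<in> sets (powX K)" for C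
    using emeasure_slice[OF K(1) W(1) that, of 1] by simp
  have em\<mu>: "emeasure ?\<mu> C = emeasure \<sigma> (cylinder I K C ?V)" if "C \<in> sets (powX K)" for C
    using emeasure_slice[OF K(1) V that, of 1] by simp
  have le: "emeasure ?\<nu> C \<le> emeasure ?\<mu> C" if "C \<in> sets (powX K)" for C
    unfolding em\<nu>[OF that] em\<mu>[OF that]
    using W(2) by (intro emeasure_mono cylinder_measurable[OF K(1) that V]) (auto simp: cylinder_def)
  have Am: "?A \<in> sets (powX K)" and Bm: "?B \<in> sets (powX K)"
    using \<nu>.half_box_measurable[OF a] \<nu>.half_box_measurable[OF b] \<nu>.sets_\<sigma> by auto
  have m: "measure ?\<nu> C = measure \<sigma> (cylinder I K C W)" "measure ?\<mu> C = measure \<sigma> (cylinder I K C ?V)"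
    if "C \<in> sets (powX K)" for C using em\<nu>[OF that] em\<mu>[OF that] by (auto simp: measure_def)
  have B\<nu>: "0 < measure ?\<nu> ?B" using pos m(1)[OF Bm] by simp
  have B\<mu>: "0 < measure ?\<mu> ?B"
  proof -
    have "measure ?\<nu> ?B \<le> measure ?\<mu> ?B"
      unfolding measure_def using le[OF Bm] \<mu>.half_box_finite[OF b] by (intro enn2real_mono) auto
    then show ?thesis using B\<nu> by simp
  qed
  have "AE y in ?\<nu>. \<mu>.generic y"
  proof -
    obtain N where N: "{y \<in> space ?\<mu>. \<not> \<mu>.generic y} \<subseteq> N" "emeasure ?\<mu> N = 0" "N \<in> sets ?\<mu>"
      using \<mu>.AE_generic by (rule AE_E)
    have Nm: "N \<in> sets (powX K)" using N(3) \<mu>.sets_\<sigma> by simp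
    have "emeasure ?\<nu> N = 0" using le[OF Nm] N(2) by simp
    then show ?thesis using N Nm \<nu>.sets_\<sigma> \<mu>.space_\<sigma> \<nu>.space_\<sigma> by (intro AE_I[of _ _ N]) auto
  qed
  with \<nu>.AE_generic have ae: "AE y in ?\<nu>. \<nu>.generic y \<and> \<mu>.generic y" by eventually_elim simp
  have "emeasure ?\<nu> (space ?\<nu>) \<noteq> 0"
    using B\<nu> emeasure_space[of ?\<nu> ?B] by (auto simp: measure_def)
  from \<nu>.ex_of_AE[OF this ae] obtain y where y: "\<nu>.generic y" "\<mu>.generic y" by blast
  have "measure ?\<nu> ?A / measure ?\<nu> ?B = measure ?\<mu> ?A / measure ?\<mu> ?B"
    using \<nu>.generic_ratio[OF y(1) a b B\<nu>] \<mu>.generic_ratio[OF y(2) a b B\<mu>] by (rule LIMSEQ_unique)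
  then have "measure ?\<nu> ?A * measure ?\<mu> ?B = measure ?\<mu> ?A * measure ?\<nu> ?B" using B\<nu> B\<mu> by (simp add: field_simps)
  then show ?thesis using m[OF Am] m[OF Bm] by simp
qed

lemma slices_proportional:
  assumes K: "K \<subseteq> I" "K \<noteq> {}"
    and inv: "\<forall>E\<in>sets \<sigma>. emeasure \<sigma> (shift I K -` E \<inter> space \<sigma>) = emeasure \<sigma> E"
    and W: "W \<in> sets (powX (I - K))" "W \<subseteq> halves (I - K) n"
    and a: "a \<in> half_index K m" and b: "b \<in> half_index K p"
  shows "measure \<sigma> (cylinder I K (tbox K m a) W) * measure \<sigma> (cylinder I K (tbox K p b) (halves (I - K) n))
       = measure \<sigma> (cylinder I K (tbox K m a) (halves (I - K) n)) * measure \<sigma> (cylinder I K (tbox K p b) W)"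
proof -
  consider "0 < measure \<sigma> (cylinder I K (tbox K p b) W)" | "0 < measure \<sigma> (cylinder I K (tbox K m a) W)"
    | "measure \<sigma> (cylinder I K (tbox K p b) W) = 0" "measure \<sigma> (cylinder I K (tbox K m a) W) = 0"
    by (metis measure_nonneg order_le_less)
  then show ?thesis
  proof cases
    case 1 then show ?thesis by (rule slices_proportional_aux[OF K inv W a b])
  next
    case 2 then show ?thesis using slices_proportional_aux[OF K inv W b a] by (simp add: mult.commute)
  qed simp
qed

lemma cross_ratio:
  fixes a :: real
  assumes "a * v = c * w" "b * v = c * s" "0 < v"
  shows "a * s = b * w"
proof -
  have "(a * s) * v = (a * v) * s" by (simp only: ac_simps)
  also have "\<dots> = (c * s) * w" unfolding assms(1) by (simp only: ac_simps)
  also have "\<dots> = (b * w) * v" unfolding assms(2)[symmetric] by (simp only: ac_simps)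
  finally show ?thesis using assms(3) by simp
qed

text \<open>
  Fix a box $A_0 \times W_0$ of positive mass \<open>s\<close>. Proportionality of the slices gives
  $s\,\sigma (A \times W) = \sigma (A \times W_0)\,\sigma (A_0 \times W)$.
\<close>

lemma product_of_slices:
  assumes nz: "emeasure \<sigma> (space \<sigma>) \<noteq> 0" and K: "K \<subseteq> I" "K \<noteq> {}" "K \<noteq> I"
    and inv: "\<forall>E\<in>sets \<sigma>. emeasure \<sigma> (shift I K -` E \<inter> space \<sigma>) = emeasure \<sigma> E"
  shows "\<exists>\<nu>1 \<nu>2. ergodic_power K \<nu>1 \<and> ergodic_power (I - K) \<nu>2 \<and>
     emeasure \<nu>1 (space \<nu>1) \<noteq> 0 \<and> emeasure \<nu>2 (space \<nu>2) \<noteq> 0 \<and>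
     (\<forall>n k. (\<forall>i\<in>I. k i < height n div 2) \<longrightarrow>
        measure \<sigma> (tbox I n k) = measure \<nu>1 (tbox K n k) * measure \<nu>2 (tbox (I - K) n k))"
proof -
  let ?L = "I - K"
  have L: "?L \<subseteq> I" "?L \<noteq> {}" "I - ?L = K" using K by auto
  have inv': "\<forall>E\<in>sets \<sigma>. emeasure \<sigma> (shift I ?L -` E \<inter> space \<sigma>) = emeasure \<sigma> E"
    using scaling_complement[OF K(1), of 1] inv by simp
  obtain x where x: "generic x" using ex_of_AE[OF nz AE_generic] by blast
  have xs: "x \<in> space (powX I)" using generic_space[OF x] space_\<sigma> by simp
  obtain n0 where n0: "x \<in> halves I n0" using ex_halves[OF finite_I xs] by blast
  define k0 where "k0 = posv I n0 x"
  have k0: "\<forall>i\<in>I. k0 i < height n0 div 2"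
    unfolding k0_def using half_index_less[OF posv_half_index[OF n0]] by blast
  define s where "s = measure \<sigma> (tbox I n0 k0)"
  have s: "0 < s" unfolding s_def k0_def by (rule generic_box_pos[OF x n0])
  let ?Abase = "tbox K n0 k0" and ?Wbase = "tbox ?L n0 k0"
  have hidx: "restrict k J \<in> half_index J n" if "J \<subseteq> I" "\<forall>i\<in>I. k i < height n div 2" for J n k
    using that by (intro restrict_half_index) blast
  have res: "tbox J n (restrict k J) = tbox J n k" for J n and k :: "'i \<Rightarrow> nat" by (rule tbox_cong) simp
  have bm: "tbox J n k \<in> sets (powX J)" "tbox J n k \<subseteq> halves J n"
    if J: "J \<subseteq> I" "\<forall>i\<in>I. k i < height n div 2" for J n k
  proof -
    have "k i < height n" if "i \<in> J" for i
    proof -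
      have "k i < height n div 2" using J that by blast
      then show ?thesis by linarith
    qed
    then show "tbox J n k \<in> sets (powX J)" using finite_subset[OF J(1) finite_I] by (intro tbox_sets)
    show "tbox J n k \<subseteq> halves J n"
      using J by (intro restrict_half_index) blast
  qed
  have cyl: "cylinder I K (tbox K n k) (tbox ?L n k) = tbox I n k" if k: "\<forall>i\<in>I. k i < height n div 2" for n k
  proof (rule cylinder_tbox[OF K(1)])
    fix i assume "i \<in> I"
    then have "k i < height n div 2" using k by blast
    then show "k i < height n" by linarith
  qed
  let ?nuK = "slice I \<sigma> K (1 / s) ?Wbase" and ?nuL = "slice I \<sigma> ?L 1 ?Abase"
  have e1: "ergodic_power K ?nuK" by (rule slice_ergodic[OF K(1,2) inv bm[OF L(1) k0]])
  have A0: "?Abase \<in> sets (powX (I - ?L))" "?Abase \<subseteq> halves (I - ?L) n0" using bm[OF K(1) k0] by (simp_all add: L(3))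
  have e2: "ergodic_power ?L ?nuL" by (rule slice_ergodic[OF L(1,2) inv' A0])
  interpret \<nu>1: ergodic_power K ?nuK by (rule e1)
  interpret \<nu>2: ergodic_power ?L ?nuL by (rule e2)
  have m1: "measure ?nuK A = measure \<sigma> (cylinder I K A ?Wbase) / s" if "A \<in> sets (powX K)" for A
    using emeasure_slice[OF K(1) bm(1)[OF L(1) k0] that, of "1 / s"] s
    by (simp add: measure_def enn2real_mult)
  have m2: "measure ?nuL W = measure \<sigma> (cylinder I K ?Abase W)" if "W \<in> sets (powX ?L)" for W
    using emeasure_slice[OF L(1) A0(1) that, of 1] cylinder_swap[OF K(1), of W ?Abase]
    by (simp add: measure_def)
  have main: "measure \<sigma> (tbox I n k) = measure ?nuK (tbox K n k) * measure ?nuL (tbox ?L n k)"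
    if k: "\<forall>i\<in>I. k i < height n div 2" for n k
  proof -
    let ?N = "max n n0"
    let ?V = "halves ?L ?N"
    let ?A = "tbox K n k" and ?W = "tbox ?L n k"
    let ?m = "\<lambda>A W. measure \<sigma> (cylinder I K A W)"
    have WV: "?W \<subseteq> ?V" "?Wbase \<subseteq> ?V"
      using bm(2)[OF L(1) k] bm(2)[OF L(1) k0] halves_mono[of n ?N ?L] halves_mono[of n0 ?N ?L] by auto
    have p1: "?m ?A ?W * ?m ?Abase ?V = ?m ?A ?V * ?m ?Abase ?W"
      using slices_proportional[OF K(1,2) inv bm(1)[OF L(1) k] WV(1) hidx[OF K(1) k] hidx[OF K(1) k0]]
      by (simp add: res)
    have p2: "?m ?A ?Wbase * ?m ?Abase ?V = ?m ?A ?V * ?m ?Abase ?Wbase"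
      using slices_proportional[OF K(1,2) inv bm(1)[OF L(1) k0] WV(2) hidx[OF K(1) k] hidx[OF K(1) k0]]
      by (simp add: res)
    have s': "?m ?Abase ?Wbase = s" unfolding s_def cyl[OF k0] by simp
    have Vpos: "0 < ?m ?Abase ?V"
    proof -
      have Vm: "cylinder I K ?Abase ?V \<in> sets \<sigma>"
        by (rule cylinder_measurable[OF K(1) bm(1)[OF K(1) k0] halves_sets_diff[OF finite_I]])
      have sub: "cylinder I K ?Abase ?V \<subseteq> halves I ?N"
      proof
        fix u assume "u \<in> cylinder I K ?Abase ?V"
        then have u: "u \<in> space (powX I)" "restrict u K \<in> ?Abase" "restrict u ?L \<in> ?V" by (auto simp: cylinder_def)
        have u': "restrict u K \<in> halves K ?N" using u(2) bm(2)[OF K(1) k0] halves_mono[of n0 ?N K] by auto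
        have "u i \<in> bottom_half ?N" if "i \<in> I" for i
          using u' u(3) that by (cases "i \<in> K") (auto simp: halves_def PiE_iff)
        then show "u \<in> halves I ?N" using u(1) by (auto simp: halves_def PiE_iff space_powX_iff)
      qed
      have "emeasure \<sigma> (cylinder I K ?Abase ?V) < \<infinity>"
        using emeasure_mono[OF sub halves_measurable] emeasure_halves_finite[of ?N] by (rule le_less_trans)
      then have "?m ?Abase ?Wbase \<le> ?m ?Abase ?V"
        unfolding measure_def using WV(2) Vm
        by (intro enn2real_mono emeasure_mono) (auto simp: cylinder_def)
      then show ?thesis using s s' by simp
    qed
    have "?m ?A ?W * s = ?m ?A ?Wbase * ?m ?Abase ?W"
      by (rule cross_ratio[OF p1 p2[unfolded s'] Vpos])
    then have "?m ?A ?W = (?m ?A ?Wbase / s) * ?m ?Abase ?W"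
      using s by (simp only: times_divide_eq_left nonzero_eq_divide_eq less_imp_neq[OF s, symmetric] simp_thms)
    then show ?thesis
      unfolding cyl[OF k] m1[OF bm(1)[OF K(1) k]] m2[OF bm(1)[OF L(1) k]] .
  qed
  have nz1: "emeasure ?nuK (space ?nuK) \<noteq> 0" and nz2: "emeasure ?nuL (space ?nuL) \<noteq> 0"
  proof -
    have "0 < measure ?nuK ?Abase * measure ?nuL ?Wbase" using main[OF k0] s unfolding s_def by (rule subst)
    then have "measure ?nuK ?Abase \<noteq> 0" "measure ?nuL ?Wbase \<noteq> 0" by auto
    then have "emeasure ?nuK ?Abase \<noteq> 0" "emeasure ?nuL ?Wbase \<noteq> 0"
      unfolding measure_def by (metis enn2real_0)+
    then show "emeasure ?nuK (space ?nuK) \<noteq> 0" "emeasure ?nuL (space ?nuL) \<noteq> 0"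
      using emeasure_space[of ?nuK ?Abase] emeasure_space[of ?nuL ?Wbase] by auto
  qed
  show ?thesis using e1 e2 nz1 nz2 main by blast
qed

end

section \<open>The decomposition\<close>

text \<open>
  Induction on the number of coordinates. Product formulas on boxes are easier to combine than product
  measures; only boxes of $C_n^I$ are needed to determine a measure.
\<close>

lemma box_decomposition:
  assumes "ergodic_power I \<sigma>" "emeasure \<sigma> (space \<sigma>) \<noteq> 0"
  shows "\<exists>P \<tau>. partition_on I P \<and> (\<forall>J\<in>P. diagonal_measure J (\<tau> J)) \<and>
     (\<forall>n k. (\<forall>i\<in>I. k i < height n div 2) \<longrightarrow>
        measure \<sigma> (tbox I n k) = (\<Prod>J\<in>P. measure (\<tau> J) (tbox J n k)))"
  using assms
proof (induction "card I" arbitrary: I \<sigma> rule: less_induct)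
  case less
  interpret ergodic_power I \<sigma> by (rule less.prems(1))
  from diagonal_or_partially_invariant[OF less.prems(2)] show ?case
  proof
    assume "diagonal_measure I \<sigma>"
    then show ?case
      using I_nonempty by (intro exI[of _ "{I}"] exI[of _ "\<lambda>_. \<sigma>"]) (auto simp: partition_on_def)
  next
    assume "\<exists>K\<subseteq>I. K \<noteq> {} \<and> K \<noteq> I \<and>
      (\<forall>E\<in>sets \<sigma>. emeasure \<sigma> (shift I K -` E \<inter> space \<sigma>) = emeasure \<sigma> E)"
    then obtain K where K: "K \<subseteq> I" "K \<noteq> {}" "K \<noteq> I"
      and inv: "\<forall>E\<in>sets \<sigma>. emeasure \<sigma> (shift I K -` E \<inter> space \<sigma>) = emeasure \<sigma> E" by blast
    obtain \<nu>1 \<nu>2 where \<nu>: "ergodic_power K \<nu>1" "ergodic_power (I - K) \<nu>2"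
      "emeasure \<nu>1 (space \<nu>1) \<noteq> 0" "emeasure \<nu>2 (space \<nu>2) \<noteq> 0"
      and prod: "\<And>n k. (\<forall>i\<in>I. k i < height n div 2) \<Longrightarrow>
        measure \<sigma> (tbox I n k) = measure \<nu>1 (tbox K n k) * measure \<nu>2 (tbox (I - K) n k)"
      using product_of_slices[OF less.prems(2) K inv] by blast
    have c: "card K < card I" "card (I - K) < card I"
      using K finite_I by (auto intro!: psubset_card_mono)
    obtain P1 \<tau>1 where 1: "partition_on K P1" "\<forall>J\<in>P1. diagonal_measure J (\<tau>1 J)"
      "\<And>n k. (\<forall>i\<in>K. k i < height n div 2) \<Longrightarrow> measure \<nu>1 (tbox K n k) = (\<Prod>J\<in>P1. measure (\<tau>1 J) (tbox J n k))"
      using less.hyps[OF c(1) \<nu>(1,3)] by blast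
    obtain P2 \<tau>2 where 2: "partition_on (I - K) P2" "\<forall>J\<in>P2. diagonal_measure J (\<tau>2 J)"
      "\<And>n k. (\<forall>i\<in>I - K. k i < height n div 2) \<Longrightarrow> measure \<nu>2 (tbox (I - K) n k) = (\<Prod>J\<in>P2. measure (\<tau>2 J) (tbox J n k))"
      using less.hyps[OF c(2) \<nu>(2,4)] by blast
    let ?\<tau> = "\<lambda>J. if J \<in> P1 then \<tau>1 J else \<tau>2 J"
    have disj: "P1 \<inter> P2 = {}"
    proof (rule ccontr)
      assume "P1 \<inter> P2 \<noteq> {}"
      then obtain J where J: "J \<in> P1" "J \<in> P2" by blast
      have "J \<noteq> {}" using partition_onD3[OF 1(1)] J by blast
      moreover have "J \<subseteq> K" using partition_onD1[OF 1(1)] J(1) by (metis Union_upper)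
      moreover have "J \<subseteq> I - K" using partition_onD1[OF 2(1)] J(2) by (metis Union_upper)
      ultimately show False by blast
    qed
    have fin: "finite P1" "finite P2"
      using finite_elements[OF _ 1(1)] finite_elements[OF _ 2(1)] finite_I finite_subset[OF K(1)] by auto
    have part: "partition_on I (P1 \<union> P2)"
    proof (rule partition_onI)
      have "\<Union>P1 = K" "\<Union>P2 = I - K" using partition_onD1[OF 1(1)] partition_onD1[OF 2(1)] by simp_all
      then show "\<Union>(P1 \<union> P2) = I" using K(1) by auto
      show "{} \<notin> P1 \<union> P2" using partition_onD3[OF 1(1)] partition_onD3[OF 2(1)] by blast
      fix p q assume pq: "p \<in> P1 \<union> P2" "q \<in> P1 \<union> P2" "p \<noteq> q"
      have sub: "p \<in> P1 \<Longrightarrow> p \<subseteq> K" "q \<in> P1 \<Longrightarrow> q \<subseteq> K" "p \<in> P2 \<Longrightarrow> p \<subseteq> I - K" "q \<in> P2 \<Longrightarrow> q \<subseteq> I - K"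
        using \<open>\<Union>P1 = K\<close> \<open>\<Union>P2 = I - K\<close> by blast+
      have "p \<in> P1 \<and> q \<in> P1 \<Longrightarrow> disjnt p q" "p \<in> P2 \<and> q \<in> P2 \<Longrightarrow> disjnt p q"
        using partition_onD2[OF 1(1)] partition_onD2[OF 2(1)] pq(3) by (auto simp: disjoint_def disjnt_def)
      then show "disjnt p q" using pq sub by (fastforce simp: disjnt_def)
    qed
    show ?case
    proof (intro exI conjI allI impI)
      show "partition_on I (P1 \<union> P2)" by (rule part)
      show "\<forall>J\<in>P1 \<union> P2. diagonal_measure J (?\<tau> J)" using 1(2) 2(2) by auto
      fix n and k :: "'a \<Rightarrow> nat" assume k: "\<forall>i\<in>I. k i < height n div 2"
      have "measure \<sigma> (tbox I n k) = (\<Prod>J\<in>P1. measure (\<tau>1 J) (tbox J n k)) * (\<Prod>J\<in>P2. measure (\<tau>2 J) (tbox J n k))"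
        using prod[OF k] 1(3)[of k n] 2(3)[of k n] k K(1) by auto
      also have "(\<Prod>J\<in>P1. measure (\<tau>1 J) (tbox J n k)) = (\<Prod>J\<in>P1. measure (?\<tau> J) (tbox J n k))"
        by (intro prod.cong) auto
      also have "(\<Prod>J\<in>P2. measure (\<tau>2 J) (tbox J n k)) = (\<Prod>J\<in>P2. measure (?\<tau> J) (tbox J n k))"
        using disj by (intro prod.cong) auto
      finally show "measure \<sigma> (tbox I n k) = (\<Prod>J\<in>P1 \<union> P2. measure (?\<tau> J) (tbox J n k))"
        by (simp only: prod.union_disjoint[OF fin disj])
    qed
  qed
qed

lemma boundedly_finite_halves:
  assumes "finite J" "sets \<tau> = sets (powX J)" "boundedly_finite J \<tau>"
  shows "emeasure \<tau> (halves J n) < \<infinity>"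
proof -
  have "\<bar>x i\<bar> \<le> real (height n) / 3 ^ n" if "x \<in> halves J n" "i \<in> J" for x i
    using halves_covered[OF that] by (auto simp: covered_def)
  then show ?thesis using assms halves_sets[OF assms(1)] unfolding boundedly_finite_def by blast
qed

lemma boundedly_finite_sigma_finite:
  assumes "finite J" "sets \<tau> = sets (powX J)" "boundedly_finite J \<tau>"
  shows "sigma_finite_measure \<tau>"
proof
  have sp: "space \<tau> = space (powX J)" by (rule sets_eq_imp_space_eq[OF assms(2)])
  have "(\<Union>n. halves J n) = space \<tau>"
  proof (intro equalityI subsetI)
    fix x assume "x \<in> space \<tau>"
    then obtain n where "x \<in> halves J n" using ex_halves[OF assms(1), of x] sp by blast
    then show "x \<in> (\<Union>n. halves J n)" by blast
  qed (use halves_space sp in auto)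
  then show "\<exists>A. countable A \<and> A \<subseteq> sets \<tau> \<and> \<Union>A = space \<tau> \<and> (\<forall>a\<in>A. emeasure \<tau> a \<noteq> \<infinity>)"
    using halves_sets[OF assms(1)] boundedly_finite_halves[OF assms] assms(2)
    by (intro exI[of _ "range (halves J)"]) (auto simp: less_top)
qed

text \<open>
  Under the identification of $X^I$ with the product over the blocks, a box corresponds to the product
  of its restrictions to the blocks, and measures are determined by their values on boxes. The values
  of \<open>\<tau>\<close> outside \<open>P\<close> only make the whole family sigma-finite.
\<close>

lemma block_product_eqI:
  assumes fin: "finite I" and part: "partition_on I P"
    and \<sigma>: "sets \<sigma> = sets (powX I)" "boundedly_finite I \<sigma>"
    and \<tau>: "\<And>J. J \<in> P \<Longrightarrow> sets (\<tau> J) = sets (powX J) \<and> boundedly_finite J (\<tau> J)"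
    and outside: "\<And>J. J \<notin> P \<Longrightarrow> \<tau> J = count_space {}"
    and prod: "\<And>n k. (\<forall>i\<in>I. k i < height n div 2) \<Longrightarrow>
        measure \<sigma> (tbox I n k) = (\<Prod>J\<in>P. measure (\<tau> J) (tbox J n k))"
  shows "\<sigma> = block_product P \<tau>"
proof -
  have U: "\<Union>P = I" using partition_onD1[OF part] by simp
  have finP: "finite P" by (rule finite_elements[OF fin part])
  have JI: "J \<subseteq> I" "finite J" if "J \<in> P" for J using that U finite_subset[OF _ fin] by auto
  have sf: "sigma_finite_measure (\<tau> J)" for J
  proof (cases "J \<in> P")
    case True
    then show ?thesis using \<tau>[OF True] JI(2)[OF True] by (intro boundedly_finite_sigma_finite) auto
  next
    case False
    then show ?thesis using outside[OF False] by (simp add: sigma_finite_measure_count_space_finite)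
  qed
  interpret product_sigma_finite \<tau> unfolding product_sigma_finite_def using sf by blast
  have blk: "(THE J. J \<in> P \<and> i \<in> J) = J" if "J \<in> P" "i \<in> J" for i J
    using that partition_onD2[OF part] by (intro the_equality) (auto simp: disjoint_def)
  let ?g = "\<lambda>z. \<lambda>i\<in>\<Union>P. z (THE J. J \<in> P \<and> i \<in> J) i"
  have g: "?g \<in> measurable (\<Pi>\<^sub>M J\<in>P. \<tau> J) (powX (\<Union>P))"
  proof (rule powX_measurableI)
    fix i assume i: "i \<in> \<Union>P"
    then obtain J where J: "J \<in> P" "i \<in> J" by blast
    have "(\<lambda>z. z J) \<in> measurable (\<Pi>\<^sub>M J\<in>P. \<tau> J) (\<tau> J)" by (rule measurable_component_singleton[OF J(1)])
    moreover have "(\<lambda>x. x i) \<in> measurable (\<tau> J) halfline"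
      using component_measurable[OF J(2)] \<tau>[OF J(1)] measurable_cong_sets by blast
    ultimately have "(\<lambda>z. z J i) \<in> measurable (\<Pi>\<^sub>M J\<in>P. \<tau> J) halfline" by (rule measurable_compose)
    then show "(\<lambda>z. ?g z i) \<in> measurable (\<Pi>\<^sub>M J\<in>P. \<tau> J) halfline" using i blk[OF J] by simp
  qed auto
  let ?E = "{tbox I n k |n k. k \<in> half_index I n}"
  have EB: "?E \<subseteq> boxes I" using half_tbox_in_boxes by blast
  have sb: "sets (block_product P \<tau>) = sets (powX I)" by (simp add: block_product_def U)
  have ev: "eventually (\<lambda>n. tbox I n (posv I n x) \<in> ?E) sequentially" if "x \<in> space (powX I)" for x
    using eventually_halves[OF fin that, of 0] by (rule eventually_mono) (use posv_half_index in blast)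
  have cover: "x \<in> \<Union>?E" if x: "x \<in> space (powX I)" for x
  proof -
    obtain n where n: "x \<in> halves I n" using ex_halves[OF fin x] by blast
    then have "tbox I n (posv I n x) \<in> ?E" using posv_half_index[OF n] by blast
    then show ?thesis using in_tbox_posv[OF n] by blast
  qed
  have Esp: "\<Union>?E \<subseteq> space (powX I)"
    using half_tbox_iff halves_space by blast
  have boxfin: "emeasure \<tau>' (tbox J n k) < \<infinity>"
    if "finite J" "sets \<tau>' = sets (powX J)" "boundedly_finite J \<tau>'" "\<And>i. i \<in> J \<Longrightarrow> k i < height n div 2"
    for J \<tau>' n and k :: "'a \<Rightarrow> nat"
  proof -
    have "tbox J n k \<subseteq> halves J n" by (rule restrict_half_index(3)) (rule that(4))
    then have "emeasure \<tau>' (tbox J n k) \<le> emeasure \<tau>' (halves J n)"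
      using halves_sets[OF that(1)] that(2) by (intro emeasure_mono) auto
    then show ?thesis using boundedly_finite_halves[OF that(1-3), of n] by (rule le_less_trans)
  qed
  show ?thesis
  proof (rule tbox_measure_unique[OF fin \<sigma>(1) sb EB])
    show "eventually (\<lambda>n. tbox I n (posv I n x) \<in> ?E) sequentially" if "x \<in> \<Union>?E" for x
      using ev Esp that by blast
    show "AE x in \<sigma>. x \<in> \<Union>?E"
      using cover sets_eq_imp_space_eq[OF \<sigma>(1)] by (intro AE_I2) auto
    show "AE x in block_product P \<tau>. x \<in> \<Union>?E"
      using cover sets_eq_imp_space_eq[OF sb] by (intro AE_I2) auto
    fix B assume "B \<in> ?E"
    then obtain n k where k: "k \<in> half_index I n" "B = tbox I n k" by blast
    have kl: "k i < height n div 2" if "i \<in> I" for i by (rule half_index_less[OF k(1) that])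
    have f\<sigma>: "emeasure \<sigma> B < \<infinity>" unfolding k(2) using boxfin[OF fin \<sigma> kl] .
    then show "emeasure \<sigma> B \<noteq> \<infinity>" by simp
    have f\<tau>: "emeasure (\<tau> J) (tbox J n k) < \<infinity>" if J: "J \<in> P" for J
      using \<tau>[OF J] JI[OF J] kl by (intro boxfin) auto
    have tm: "tbox J n k \<in> sets (\<tau> J)" if J: "J \<in> P" for J
    proof -
      have "k i < height n" if "i \<in> J" for i using half_index_less_height[OF k(1)] JI(1)[OF J] that by blast
      then show ?thesis using \<tau>[OF J] tbox_sets[OF JI(2)[OF J], of k n] by simp
    qed
    have Bm: "B \<in> sets (powX (\<Union>P))" using EB boxes_sets[OF fin] \<open>B \<in> ?E\<close> U by blast
    have pre: "?g -` B \<inter> space (\<Pi>\<^sub>M J\<in>P. \<tau> J) = (\<Pi>\<^sub>E J\<in>P. tbox J n k)"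
    proof (intro equalityI subsetI)
      fix z assume z: "z \<in> ?g -` B \<inter> space (\<Pi>\<^sub>M J\<in>P. \<tau> J)"
      have "z J \<in> tbox J n k" if J: "J \<in> P" for J
      proof -
        have "z J \<in> space (powX J)" using z J sets_eq_imp_space_eq[of "\<tau> J" "powX J"] \<tau>[OF J] by (auto simp: space_PiM PiE_iff)
        moreover have "z J i \<in> level n (k i)" if i: "i \<in> J" for i
        proof -
          have "?g z i \<in> level n (k i)" using z k(2) U J i unfolding tbox_def by (auto simp: PiE_iff)
          moreover have "?g z i = z J i" using blk[OF J i] J i by auto
          ultimately show ?thesis by simp
        qed
        ultimately show ?thesis by (auto simp: tbox_def PiE_iff space_powX_iff)
      qed
      then show "z \<in> (\<Pi>\<^sub>E J\<in>P. tbox J n k)" using z by (auto simp: space_PiM PiE_iff)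
    next
      fix z assume z: "z \<in> (\<Pi>\<^sub>E J\<in>P. tbox J n k)"
      have "?g z i \<in> level n (k i)" if i: "i \<in> I" for i
      proof -
        obtain J where J: "J \<in> P" "i \<in> J" using i U by blast
        have "z J i \<in> level n (k i)" using z J by (auto simp: tbox_def PiE_iff)
        then show ?thesis using blk[OF J] J by auto
      qed
      then have "?g z \<in> B" unfolding k(2) tbox_def using U by (auto simp: PiE_iff)
      moreover have "z \<in> space (\<Pi>\<^sub>M J\<in>P. \<tau> J)"
        using z tm[THEN sets.sets_into_space] by (auto simp: space_PiM PiE_iff)
      ultimately show "z \<in> ?g -` B \<inter> space (\<Pi>\<^sub>M J\<in>P. \<tau> J)" by blast
    qed
    have "emeasure (block_product P \<tau>) B = emeasure (\<Pi>\<^sub>M J\<in>P. \<tau> J) (\<Pi>\<^sub>E J\<in>P. tbox J n k)"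
      unfolding block_product_def by (subst emeasure_distr[OF g Bm]) (simp only: pre)
    also have "\<dots> = (\<Prod>J\<in>P. emeasure (\<tau> J) (tbox J n k))" by (rule emeasure_PiM[OF finP tm])
    also have "\<dots> = (\<Prod>J\<in>P. ennreal (measure (\<tau> J) (tbox J n k)))"
    proof (rule prod.cong[OF refl])
      fix J assume "J \<in> P"
      from f\<tau>[OF this] show "emeasure (\<tau> J) (tbox J n k) = ennreal (measure (\<tau> J) (tbox J n k))"
        by (simp add: emeasure_eq_ennreal_measure)
    qed
    also have "\<dots> = ennreal (measure \<sigma> B)" using prod[of k n] kl k(2) by (simp add: prod_ennreal)
    also have "\<dots> = emeasure \<sigma> B" using f\<sigma> by (simp add: emeasure_eq_ennreal_measure)
    finally show "emeasure \<sigma> B = emeasure (block_product P \<tau>) B" by simp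
  qed
qed

theorem theorem2p3:
  fixes d :: nat and \<sigma> :: "(nat \<Rightarrow> real) measure"
  assumes "d \<ge> 1"
    and "sets \<sigma> = sets (powX {1..d})"
    and "emeasure \<sigma> (space \<sigma>) \<noteq> 0"
    and "invariant_measure \<sigma> (chacon_pow {1..d})"
    and "boundedly_finite {1..d} \<sigma>"
    and "ergodic \<sigma> (chacon_pow {1..d})"
  shows "(\<exists>P \<tau>. partition_on {1..d} P \<and>
            (\<forall>J\<in>P. diagonal_measure J (\<tau> J)) \<and>
            \<sigma> = block_product P \<tau>) \<and>
         (totally_dissipative \<sigma> (chacon_pow {1..d}) \<longrightarrow>
            diagonal_measure {1..d} \<sigma> \<and>
            supported_on_single_orbit \<sigma> (chacon_pow {1..d}))"
proof (intro conjI impI)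
  interpret ergodic_power "{1..d}" \<sigma> using assms by unfold_locales auto
  obtain P \<tau> where P: "partition_on {1..d} P" "\<forall>J\<in>P. diagonal_measure J (\<tau> J)"
    "\<And>n k. (\<forall>i\<in>{1..d}. k i < height n div 2) \<Longrightarrow>
        measure \<sigma> (tbox {1..d} n k) = (\<Prod>J\<in>P. measure (\<tau> J) (tbox J n k))"
    using box_decomposition[OF ergodic_power_axioms assms(3)] by blast
  \<comment> \<open>All factors have to be sigma-finite, also those with index outside \<open>P\<close>.\<close>
  let ?\<tau> = "\<lambda>J. if J \<in> P then \<tau> J else count_space {}"
  have "\<sigma> = block_product P ?\<tau>"
    using P assms(2,5) by (intro block_product_eqI) (auto simp: diagonal_measure_def)
  then show "\<exists>P \<tau>. partition_on {1..d} P \<and> (\<forall>J\<in>P. diagonal_measure J (\<tau> J)) \<and> \<sigma> = block_product P \<tau>"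
    using P(1,2) by (intro exI[of _ P] exI[of _ ?\<tau>]) auto
next
  interpret ergodic_power "{1..d}" \<sigma> using assms by unfold_locales auto
  assume "totally_dissipative \<sigma> (chacon_pow {1..d})"
  from dissipative_diagonal[OF assms(3) this]
  show "diagonal_measure {1..d} \<sigma>" "supported_on_single_orbit \<sigma> (chacon_pow {1..d})" by blast+
qed

end
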